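(* Assume $m=ur+1$ for some positive integer $u$. Let $P_1\neq P_2$ be two rational places of $F$, different from $P_\infty$, which are totally ramified in $F/\mathbb{F}_q(x)$. Then $$|G(P_1,P_2)|=\frac{ur(r-1)(3ur^2-5ur+4r+4u-2)}{12}\quad\text{and}\quad |G(P_\infty,P_1)|=\frac{ur(r-1)(3ur^2-3ur+2r+2)}{12}.$$
   Context: Kummer setting: let $q$ be a power of a prime $p$, $m\ge 2$ an integer with $p\nmid m$, and $f(x)\in\mathbb{F}_q[x]$ a separable polynomial of degree $r$ with $\gcd(m,r)=1$. Let $F=\mathbb{F}_q(x,y)$ with $y^m=f(x)$; $F/\mathbb{F}_q(x)$ is a Kummer extension of degree $m$ with full constant field $\mathbb{F}_q$ and genus $g=(m-1)(r-1)/2$. $P_\infty$ denotes the unique place of $F$ over the pole of $x$ (it is rational and totally ramified). For each root $\alpha\in\mathbb{F}_q$ of $f$, the zero of $x-\alpha$ is totally ramified in $F/\mathbb{F}_q(x)$, and the place of $F$ over it is rational. Weierstrass semigroups: for distinct rational places $P_1,\dots,P_s$ of $F$, $H(P_1,\dots,P_s)=\{(n_1,\dots,n_s)\in\mathbb{N}^s : \exists z\in F \text{ with pole divisor } (z)_\infty=n_1P_1+\cdots+n_sP_s\}$ ($\mathbb{N}$ includes $0$), and $G(P_1,\dots,P_s)=\mathbb{N}^s\setminus H(P_1,\dots,P_s)$ is the set of gaps. *)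

theory Defs
  imports "HOL-Computational_Algebra.Polynomial"
begin

text \<open>Algebraic function field setting. The function field F is the whole (field) type 'a,
  the constant field is a finite subfield K of 'a (playing the role of F_q).\<close>

definition is_subfield :: "'a::field set \<Rightarrow> bool" where
  "is_subfield K \<longleftrightarrow> 0 \<in> K \<and> 1 \<in> K \<and> (\<forall>a\<in>K. \<forall>b\<in>K. a + b \<in> K \<and> a * b \<in> K)
     \<and> (\<forall>a\<in>K. - a \<in> K \<and> inverse a \<in> K)"

definition generated_field :: "'a::field set \<Rightarrow> 'a set" where
  "generated_field S = \<Inter>{L. is_subfield L \<and> S \<subseteq> L}"

definition poly_over :: "'a::field set \<Rightarrow> 'a poly \<Rightarrow> bool" where
  "poly_over K p \<longleftrightarrow> (\<forall>i. coeff p i \<in> K)"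

definition transcendental_over :: "'a::field set \<Rightarrow> 'a \<Rightarrow> bool" where
  "transcendental_over K x \<longleftrightarrow> (\<forall>p. poly_over K p \<and> p \<noteq> 0 \<longrightarrow> poly p x \<noteq> 0)"

definition rat_fun_field :: "'a::field set \<Rightarrow> 'a \<Rightarrow> 'a set" where
  "rat_fun_field K x = {poly a x / poly b x | a b. poly_over K a \<and> poly_over K b \<and> b \<noteq> 0}"

text \<open>A place of F/K, represented by its normalized discrete valuation v : F \<rightarrow> Z
  (value at 0, which is "infinity", is fixed to 0 as a dummy so the representation is unique);
  the valuation is trivial on the constant field K.\<close>
definition is_place :: "'a::field set \<Rightarrow> ('a \<Rightarrow> int) \<Rightarrow> bool" where
  "is_place K v \<longleftrightarrow> v 0 = 0
     \<and> (\<forall>a b. a \<noteq> 0 \<longrightarrow> b \<noteq> 0 \<longrightarrow> v (a * b) = v a + v b)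
     \<and> (\<forall>a b. a \<noteq> 0 \<longrightarrow> b \<noteq> 0 \<longrightarrow> a + b \<noteq> 0 \<longrightarrow> v (a + b) \<ge> min (v a) (v b))
     \<and> (\<forall>c\<in>K. c \<noteq> 0 \<longrightarrow> v c = 0)
     \<and> (\<exists>t. t \<noteq> 0 \<and> v t = 1)"

definition rational_place :: "'a::field set \<Rightarrow> ('a \<Rightarrow> int) \<Rightarrow> bool" where
  "rational_place K v \<longleftrightarrow> is_place K v \<and>
     (\<forall>z. z \<noteq> 0 \<longrightarrow> v z \<ge> 0 \<longrightarrow> (\<exists>c\<in>K. z = c \<or> v (z - c) > 0))"

text \<open>P is totally ramified in F/K(x) (where [F:K(x)] = m): its ramification index
  over the restriction to K(x) equals m, i.e. v(K(x)^*) = mZ.\<close>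
definition totally_ramified :: "'a::field set \<Rightarrow> 'a \<Rightarrow> nat \<Rightarrow> ('a \<Rightarrow> int) \<Rightarrow> bool" where
  "totally_ramified K x m v \<longleftrightarrow> v ` (rat_fun_field K x - {0}) = {int m * k | k. True}"

definition weierstrass_semigroup2 ::
  "'a::field set \<Rightarrow> ('a \<Rightarrow> int) \<Rightarrow> ('a \<Rightarrow> int) \<Rightarrow> (nat \<times> nat) set" where
  "weierstrass_semigroup2 K P1 P2 = {(n1, n2). \<exists>z. z \<noteq> 0
      \<and> int n1 = max 0 (- P1 z) \<and> int n2 = max 0 (- P2 z)
      \<and> (\<forall>Q. is_place K Q \<and> Q \<noteq> P1 \<and> Q \<noteq> P2 \<longrightarrow> Q z \<ge> 0)}"

definition gaps2 :: "'a::field set \<Rightarrow> ('a \<Rightarrow> int) \<Rightarrow> ('a \<Rightarrow> int) \<Rightarrow> (nat \<times> nat) set" where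
  "gaps2 K P1 P2 = UNIV - weierstrass_semigroup2 K P1 P2"

end

theory Submission
  imports "HOL-Algebra.Algebraic_Closure_Type" Defs
begin

text \<open>
  Every element of the function field is a sum of terms \<open>a\<^sub>j(x) y\<^sup>j\<close> with \<open>0 \<le> j < m\<close>. At a totally
  ramified place these terms have values in different residue classes modulo \<open>m\<close>, so the value of the
  sum is the minimum of theirs. At the remaining places one averages over the \<open>m\<close>-th roots of unity
  in the Laurent series field over an algebraic closure: if the sum has no pole above a point, neither
  has any of its terms. Hence a Weierstrass semigroup at two totally ramified places is determined by
  the monomials \<open>(x - a\<^sub>1)\<^sup>A (x - a\<^sub>2)\<^sup>B y\<^sup>j\<close>.

  Counting the pairs excluded by the monomials gives, as in the work of Kim and Homma, the sum of
  the gaps at the two places minus the number of inversions of the bijection between them. For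
  \<open>m = u r + 1\<close> the rounding \<open>\<lceil>r j / m\<rceil>\<close> equals \<open>\<lceil>j / u\<rceil>\<close>, which makes all sums polynomial.
\<close>

section \<open>Counting gaps\<close>

text \<open>Places are valuations on the type \<open>'a\<close>, and the constants form only a
  subset \<open>K\<close> of it, so regularity at places of higher degree must be used without
  naming them. Points are elements \<alpha> of the closure of \<open>'a\<close> (not of
  \<open>K\<close>). A function is examined at \<alpha> through a homomorphism into Laurent series
  that fixes constants, sends \<open>x\<close> to \<alpha> + t^m and \<open>y\<close> to an m-th
  root of f(\<alpha> + t^m). The exponent m makes f(\<alpha> + t^m) an m-th power whether or not
  \<alpha> is a root, so all finite points are treated alike. The pulled-back subdegree, once
  nontrivial and rescaled, is a place in the sense of the definitions, so regularity assumptions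
  apply to it. That T^m - f(X) is the minimal polynomial of \<open>y\<close> over K(x) is proved,
  not assumed: coprimality of \<open>m\<close> and \<open>r\<close> makes 1, y, ..., y^(m-1)
  independent at infinity. The only global relation used is that the degree of a polynomial is the
  sum of its root orders over the closure. The factor 12 combines 6 from sums of squares with 2 from
  triangular numbers.\<close>

lemma gap_count:
  fixes a b :: "'i \<Rightarrow> int" and I :: "'i set"
  defines "T \<equiv> {i \<in> I. a i > 0 \<and> b i > 0}"
  defines "G \<equiv> {(n1 :: nat, n2 :: nat).
      \<not> ((n1 = 0 \<or> (\<exists>i\<in>I. a i = int n1 \<and> b i \<le> int n2)) \<and>
         (n2 = 0 \<or> (\<exists>i\<in>I. b i = int n2 \<and> a i \<le> int n1)))}"
  assumes inj: "inj_on a I" "inj_on b I"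
    and surj: "\<And>n. n > 0 \<Longrightarrow> \<exists>i\<in>I. a i = n" "\<And>n. n > 0 \<Longrightarrow> \<exists>i\<in>I. b i = n"
    and fin: "finite T"
  shows "finite G"
    and "int (card G) + int (card {(s, t) \<in> T \<times> T. b t < b s \<and> a s < a t}) = (\<Sum>i\<in>T. a i + b i)"
proof -
  define f1 where "f1 = (\<lambda>(i, n). (nat (a i), n :: nat))"
  define f2 where "f2 = (\<lambda>(i, n :: nat). (n, nat (b i)))"
  define f3 where "f3 = (\<lambda>(s, t). (nat (a s), nat (b t)))"
  define S1 where "S1 = (SIGMA i:T. {..<nat (b i)})"
  define S2 where "S2 = (SIGMA i:T. {..<nat (a i)})"
  define S3 where "S3 = {(s, t) \<in> T \<times> T. b t < b s \<and> a s < a t}"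
  have TI: "i \<in> I" "a i > 0" "b i > 0" if "i \<in> T" for i
    using that by (auto simp: T_def)
  have aeq: "i = j" if "i \<in> I" "j \<in> I" "a i = a j" for i j
    using inj(1) that by (auto dest: inj_onD)
  have beq: "i = j" if "i \<in> I" "j \<in> I" "b i = b j" for i j
    using inj(2) that by (auto dest: inj_onD)
  \<comment> \<open>When \<open>n1 > 0\<close>, exactly one index has \<open>a i = n1\<close>, so
    the first condition fails precisely on the points (a i, n) with \<open>n < b i\<close>. The fact
    \<open>neg2\<close> is the mirror image.\<close>
  have neg1: "(n1 = 0 \<or> (\<exists>i\<in>I. a i = int n1 \<and> b i \<le> int n2)) \<longleftrightarrow> (n1, n2) \<notin> f1 ` S1" for n1 n2
  proof
    assume L: "n1 = 0 \<or> (\<exists>i\<in>I. a i = int n1 \<and> b i \<le> int n2)"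
    show "(n1, n2) \<notin> f1 ` S1"
    proof
      assume "(n1, n2) \<in> f1 ` S1"
      then obtain i where i: "i \<in> T" "n2 < nat (b i)" "n1 = nat (a i)"
        by (auto simp: f1_def S1_def)
      with TI[OF i(1)] L obtain j where "j \<in> I" "a j = a i" "b j \<le> int n2"
        by auto
      with aeq[of j i] TI[OF i(1)] i(2) show False by auto
    qed
  next
    assume R: "(n1, n2) \<notin> f1 ` S1"
    show "n1 = 0 \<or> (\<exists>i\<in>I. a i = int n1 \<and> b i \<le> int n2)"
    proof (cases "n1 = 0")
      case False
      then obtain i where i: "i \<in> I" "a i = int n1" using surj(1)[of "int n1"] by auto
      have "b i \<le> int n2"
      proof (rule ccontr)
        assume "\<not> b i \<le> int n2"
        hence "(i, n2) \<in> S1" using i False by (auto simp: S1_def T_def)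
        hence "f1 (i, n2) \<in> f1 ` S1" by blast
        thus False using R i by (simp add: f1_def)
      qed
      thus ?thesis using i by blast
    qed simp
  qed
  have neg2: "(n2 = 0 \<or> (\<exists>i\<in>I. b i = int n2 \<and> a i \<le> int n1)) \<longleftrightarrow> (n1, n2) \<notin> f2 ` S2" for n1 n2
  proof
    assume L: "n2 = 0 \<or> (\<exists>i\<in>I. b i = int n2 \<and> a i \<le> int n1)"
    show "(n1, n2) \<notin> f2 ` S2"
    proof
      assume "(n1, n2) \<in> f2 ` S2"
      then obtain i where i: "i \<in> T" "n1 < nat (a i)" "n2 = nat (b i)"
        by (auto simp: f2_def S2_def)
      with TI[OF i(1)] L obtain j where "j \<in> I" "b j = b i" "a j \<le> int n1"
        by auto
      with beq[of j i] TI[OF i(1)] i(2) show False by auto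
    qed
  next
    assume R: "(n1, n2) \<notin> f2 ` S2"
    show "n2 = 0 \<or> (\<exists>i\<in>I. b i = int n2 \<and> a i \<le> int n1)"
    proof (cases "n2 = 0")
      case False
      then obtain i where i: "i \<in> I" "b i = int n2" using surj(2)[of "int n2"] by auto
      have "a i \<le> int n1"
      proof (rule ccontr)
        assume "\<not> a i \<le> int n1"
        hence "(i, n1) \<in> S2" using i False by (auto simp: S2_def T_def)
        hence "f2 (i, n1) \<in> f2 ` S2" by blast
        thus False using R i by (simp add: f2_def)
      qed
      thus ?thesis using i by blast
    qed simp
  qed
  have G: "G = f1 ` S1 \<union> f2 ` S2"
    unfolding G_def neg1 neg2 by auto
  \<comment> \<open>A point of both families is (a s, b t) for unique \<open>s\<close> and
    \<open>t\<close>, with \<open>b t < b s\<close> from the first family and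
    \<open>a s < a t\<close> from the second. The overlap in the inclusion-exclusion is therefore
    counted by inversions.\<close>
  have int12: "f1 ` S1 \<inter> f2 ` S2 = f3 ` S3"
  proof (intro equalityI subsetI)
    fix p assume "p \<in> f1 ` S1 \<inter> f2 ` S2"
    then obtain s t n n' where "s \<in> T" "t \<in> T" "n < nat (b s)" "n' < nat (a t)"
      "p = (nat (a s), n)" "p = (n', nat (b t))"
      by (auto simp: f1_def f2_def S1_def S2_def)
    hence "(s, t) \<in> S3" "p = f3 (s, t)" using TI[of s] TI[of t]
      by (auto simp: S3_def f3_def)
    thus "p \<in> f3 ` S3" by blast
  next
    fix p assume "p \<in> f3 ` S3"
    then obtain s t where st: "(s, t) \<in> S3" "p = (nat (a s), nat (b t))" by (auto simp: f3_def)
    have "(s, nat (b t)) \<in> S1" "(t, nat (a s)) \<in> S2"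
      using st TI[of s] TI[of t] by (auto simp: S3_def S1_def S2_def)
    hence "f1 (s, nat (b t)) \<in> f1 ` S1" "f2 (t, nat (a s)) \<in> f2 ` S2" by blast+
    thus "p \<in> f1 ` S1 \<inter> f2 ` S2" using st by (simp add: f1_def f2_def)
  qed
  have aeq': "i = j" if "i \<in> T" "j \<in> T" "nat (a i) = nat (a j)" for i j
    using aeq[of i j] TI(1,2)[OF that(1)] TI(1,2)[OF that(2)] that(3) by simp
  have beq': "i = j" if "i \<in> T" "j \<in> T" "nat (b i) = nat (b j)" for i j
    using beq[of i j] TI(1,3)[OF that(1)] TI(1,3)[OF that(2)] that(3) by simp
  have i1: "inj_on f1 S1" using aeq' by (auto simp: inj_on_def f1_def S1_def)
  have i2: "inj_on f2 S2" using beq' by (auto simp: inj_on_def f2_def S2_def)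
  have i3: "inj_on f3 S3" using aeq' beq' by (auto simp: inj_on_def f3_def S3_def)
  have f12: "finite S1" "finite S2" using fin by (auto simp: S1_def S2_def)
  show "finite G" unfolding G using f12 by blast
  have "card (f1 ` S1) + card (f2 ` S2) = card G + card (f3 ` S3)"
    unfolding G int12[symmetric] using f12 by (intro card_Un_Int) auto
  moreover have "card (f1 ` S1) = (\<Sum>i\<in>T. nat (b i))"
    using card_image[OF i1] fin by (simp add: S1_def)
  moreover have "card (f2 ` S2) = (\<Sum>i\<in>T. nat (a i))"
    using card_image[OF i2] fin by (simp add: S2_def)
  moreover have "card (f3 ` S3) = card S3" using card_image[OF i3] .
  ultimately have "int (card G) + int (card S3) = (\<Sum>i\<in>T. int (nat (b i))) + (\<Sum>i\<in>T. int (nat (a i)))"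
    by (metis of_nat_add of_nat_sum)
  also have "\<dots> = (\<Sum>i\<in>T. b i) + (\<Sum>i\<in>T. a i)"
    using TI(2,3) by (intro arg_cong2[of _ _ _ _ "(+)"] sum.cong) (auto simp: less_imp_le)
  finally show "int (card G) + int (card {(s, t) \<in> T \<times> T. b t < b s \<and> a s < a t}) = (\<Sum>i\<in>T. a i + b i)"
    by (simp add: S3_def sum.distrib)
qed

text \<open>The index \<open>(k, q, A)\<close> stands for a monomial with \<open>y\<close>-exponent \<open>j = k u + q + 1\<close>, so that
  \<open>\<lceil>j / u\<rceil> = k + 1\<close>, and with a factor \<open>1 / (x - a\<^sub>1)\<close> to the power \<open>A + 1\<close>; the range is that of the
  monomials with poles at both places. The orders of these poles are \<open>gap1\<close> at the first place, and
  \<open>gap2\<close> or \<open>gap_inf\<close> at the second one.\<close>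
definition tri_index :: "nat \<Rightarrow> nat \<Rightarrow> (nat \<times> nat \<times> nat) set" where
  "tri_index u r = (SIGMA k:{..<r}. {..<u} \<times> {..<k})"

lemma sum_tri_index:
  "(\<Sum>i\<in>tri_index u r. g i) = (\<Sum>k<r. \<Sum>q<u. \<Sum>A<k. g (k, q, A))"
  unfolding tri_index_def by (simp add: sum.Sigma sum.cartesian_product)

lemma finite_tri_index [simp]: "finite (tri_index u r)"
  by (simp add: tri_index_def)

lemma card_pairs_eq_sum:
  assumes "finite S" "finite T"
  shows "int (card {(a, b). a \<in> S \<and> b \<in> T \<and> P a b}) = (\<Sum>a\<in>S. \<Sum>b\<in>T. if P a b then 1 else 0)"
proof -
  have "{(a, b). a \<in> S \<and> b \<in> T \<and> P a b} = {z \<in> S \<times> T. P (fst z) (snd z)}" by auto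
  hence "int (card {(a, b). a \<in> S \<and> b \<in> T \<and> P a b}) = (\<Sum>z\<in>{z \<in> S \<times> T. P (fst z) (snd z)}. 1)"
    by simp
  also have "\<dots> = (\<Sum>z\<in>S \<times> T. if P (fst z) (snd z) then 1 else 0)"
    using assms by (intro sum.inter_filter) auto
  finally show ?thesis by (simp add: sum.cartesian_product split_def)
qed

text \<open>For fixed \<open>y\<close>-exponents of both indices, an inversion becomes a linear
  condition on \<open>A\<close> and \<open>B\<close>. Moving these two sums innermost leaves a count
  of lattice points.\<close>

lemma card_pairs_tri_index:
  "int (card {(s, t) \<in> tri_index u r \<times> tri_index u r. R s t}) =
    (\<Sum>k<r. \<Sum>q<u. \<Sum>l<r. \<Sum>p<u. int (card {(A, B). A < k \<and> B < l \<and> R (k, q, A) (l, p, B)}))"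
proof -
  have c: "int (card {(A, B). A < k \<and> B < l \<and> P A B}) = (\<Sum>A<k. \<Sum>B<l. if P A B then 1 else 0)"
    for k l :: nat and P
    using card_pairs_eq_sum[of "{..<k}" "{..<l}" P] by simp
  have "int (card {(s, t) \<in> tri_index u r \<times> tri_index u r. R s t}) =
      (\<Sum>s\<in>tri_index u r. \<Sum>t\<in>tri_index u r. if R s t then 1 else 0)"
    using card_pairs_eq_sum[of "tri_index u r" "tri_index u r" R] by simp
  also have "\<dots> = (\<Sum>k<r. \<Sum>q<u. \<Sum>A<k. \<Sum>l<r. \<Sum>p<u. \<Sum>B<l. if R (k, q, A) (l, p, B) then 1 else 0)"
    by (simp add: sum_tri_index)
  also have "\<dots> = (\<Sum>k<r. \<Sum>q<u. \<Sum>l<r. \<Sum>p<u. \<Sum>A<k. \<Sum>B<l. if R (k, q, A) (l, p, B) then 1 else 0)"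
    by (rule sum.cong[OF refl], rule sum.cong[OF refl], rule trans[OF sum.swap],
        rule sum.cong[OF refl], rule sum.swap)
  finally show ?thesis unfolding c .
qed

section \<open>Lattice pairs in shifted triangles, and inversions as such pairs\<close>

lemma card_pairs_shift_le:
  assumes "k \<le> l"
  shows "2 * int (card {(A, B). A < k \<and> B < l \<and> A + (l - k) \<le> B}) = int k * (int k + 1)"
  using assms
proof (induction k arbitrary: l)
  case (Suc k)
  then obtain l' where l: "l = Suc l'" "k \<le> l'" by (cases l) auto
  \<comment> \<open>Lowering both bounds by one keeps the shift. The new pairs have
    \<open>B = l'\<close>, which admits every \<open>A \<le> k\<close>; for \<open>B < l'\<close>
    the inequality already forces \<open>A < k\<close>. The counts are therefore triangular numbers,
    independent of the shift.\<close>
  have "{(A, B). A < Suc k \<and> B < Suc l' \<and> A + (Suc l' - Suc k) \<le> B} =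
     {(A, B). A < k \<and> B < l' \<and> A + (l' - k) \<le> B} \<union> (\<lambda>A. (A, l')) ` {..k}"
    using l by (auto simp: image_iff)
  moreover have "finite {(A, B). A < k \<and> B < l' \<and> A + (l' - k) \<le> B}"
    by (rule finite_subset[of _ "{..<k} \<times> {..<l'}"]) auto
  moreover have "card ((\<lambda>A. (A, l')) ` {..k}) = Suc k" by (simp add: card_image inj_on_def)
  ultimately have "card {(A, B). A < Suc k \<and> B < Suc l' \<and> A + (Suc l' - Suc k) \<le> B} =
      card {(A, B). A < k \<and> B < l' \<and> A + (l' - k) \<le> B} + Suc k"
    by (simp, subst card_Un_disjoint) auto
  thus ?case using Suc.IH[OF l(2)] l by (simp add: algebra_simps)
qed simp

lemma card_pairs_shift_less:
  assumes "k \<le> l"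
  shows "2 * int (card {(A, B). A < k \<and> B < l \<and> A + (l - k) < B}) = int k * (int k - 1)"
proof (cases k)
  case (Suc k')
  have "{(A, B). A < k \<and> B < l \<and> A + (l - k) < B} = {(A, B). A < k' \<and> B < l \<and> A + (l - k') \<le> B}"
    using assms Suc by auto
  thus ?thesis using card_pairs_shift_le[of k' l] assms Suc by (simp add: algebra_simps)
qed simp

lemma card_pairs_le:
  assumes "l \<le> k"
  shows "2 * int (card {(A, B). A < k \<and> B < l \<and> A \<le> B}) = int l * (int l + 1)"
proof -
  have "{(A, B). A < k \<and> B < l \<and> A \<le> B} = {(A, B). A < l \<and> B < l \<and> A + (l - l) \<le> B}"
    using assms by auto
  thus ?thesis using card_pairs_shift_le[of l l] by simp
qed

text \<open>Two pole orders differ by a multiple of \<open>m\<close> plus a remainder smaller than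
  \<open>m\<close>. Their comparison is decided by the multiple, and by the sign of the remainder
  only when the multiple vanishes.\<close>

lemma mult_less_cancel_bounded:
  fixes m c d :: int
  assumes "\<bar>d\<bar> < m"
  shows "d < m * c \<longleftrightarrow> (if d < 0 then 0 \<le> c else 0 < c)"
proof -
  consider "c \<le> -1" | "c = 0" | "c \<ge> 1" by linarith
  thus ?thesis
  proof cases
    case 1
    hence "m * c \<le> m * (-1)" using assms by (intro mult_left_mono) auto
    thus ?thesis using 1 assms by auto
  next
    case 3
    hence "m * c \<ge> m * 1" using assms by (intro mult_left_mono) auto
    thus ?thesis using 3 assms by auto
  qed auto
qed

text \<open>The quantity is the difference of two \<open>y\<close>-exponents, both between 1 and
  \<open>u * r\<close>. Since \<open>q - p\<close> lies strictly between \<open>- u\<close> and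
  \<open>u\<close>, the blocks \<open>k\<close> and \<open>l\<close> alone give its sign when they
  differ.\<close>

lemma block_difference_bounds:
  fixes k l q p u r :: int
  assumes "0 \<le> k" "k < r" "0 \<le> l" "l < r" "0 \<le> q" "q < u" "0 \<le> p" "p < u"
  shows "\<bar>(k - l) * u + (q - p)\<bar> < u * r + 1"
    and "k < l \<Longrightarrow> (k - l) * u + (q - p) < 0"
    and "l < k \<Longrightarrow> (k - l) * u + (q - p) > 0"
proof -
  have 1: "(k - l) * u \<le> (r - 1) * u" "(l - k) * u \<le> (r - 1) * u"
    using assms by (auto intro!: mult_right_mono)
  show "\<bar>(k - l) * u + (q - p)\<bar> < u * r + 1"
    using 1 assms by (simp add: algebra_simps abs_less_iff)
  show "(k - l) * u + (q - p) < 0" if "k < l"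
  proof -
    have "(k - l) * u \<le> (-1) * u" using assms that by (intro mult_right_mono) auto
    thus ?thesis using assms by simp
  qed
  show "(k - l) * u + (q - p) > 0" if "l < k"
  proof -
    have "1 * u \<le> (k - l) * u" using assms that by (intro mult_right_mono) auto
    thus ?thesis using assms by linarith
  qed
qed

definition gap1 :: "nat \<Rightarrow> nat \<Rightarrow> nat \<times> nat \<times> nat \<Rightarrow> int" where
  "gap1 u r = (\<lambda>(k, q, A). (int u * int r + 1) * (int A + 1) - (int k * int u + int q + 1))"

definition gap2 :: "nat \<Rightarrow> nat \<Rightarrow> nat \<times> nat \<times> nat \<Rightarrow> int" where
  "gap2 u r = (\<lambda>(k, q, A). (int u * int r + 1) * (int k - int A) - (int k * int u + int q + 1))"

definition gap_inf :: "nat \<Rightarrow> nat \<Rightarrow> nat \<times> nat \<times> nat \<Rightarrow> int" where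
  "gap_inf u r = (\<lambda>(k, q, A). int r * (int k * int u + int q + 1) - (int u * int r + 1) * (int A + 1))"

text \<open>The two comparisons have opposite remainders. For \<open>k < l\<close> the comparison at
  the second place implies the one at the first, for \<open>l < k\<close> conversely. For
  \<open>k = l\<close> at least one of them is strict, so the outcome is always
  \<open>A < B\<close>. Hence \<open>q\<close> and \<open>p\<close> drop out.\<close>

lemma inversion_iff_affine:
  assumes "k < r" "l < r" "q < u" "p < u" "A < k" "B < l"
  shows "gap2 u r (l, p, B) < gap2 u r (k, q, A) \<and> gap1 u r (k, q, A) < gap1 u r (l, p, B) \<longleftrightarrow>
    (if k < l then A + (l - k) \<le> B else if k = l then A < B else A \<le> B)"
proof -
  define d where "d = (int k - int l) * int u + (int q - int p)"
  note bd = block_difference_bounds[of "int k" "int r" "int l" "int q" "int u" "int p", folded d_def]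
  have m: "\<bar>d\<bar> < int u * int r + 1" "\<bar>- d\<bar> < int u * int r + 1" using bd(1) assms by auto
  have "gap2 u r (l, p, B) < gap2 u r (k, q, A) \<longleftrightarrow> d < (int u * int r + 1) * (int k - int l + int B - int A)"
    by (simp add: gap2_def d_def algebra_simps)
  moreover have "gap1 u r (k, q, A) < gap1 u r (l, p, B) \<longleftrightarrow> - d < (int u * int r + 1) * (int B - int A)"
    by (simp add: gap1_def d_def algebra_simps)
  ultimately show ?thesis
    unfolding mult_less_cancel_bounded[OF m(1)] mult_less_cancel_bounded[OF m(2)]
    using bd(2,3) assms by auto
qed

lemma inversion_iff_infinity:
  assumes "k < r" "l < r" "q < u" "p < u" "A < k" "B < l"
  shows "gap_inf u r (l, p, B) < gap_inf u r (k, q, A) \<and> gap1 u r (k, q, A) < gap1 u r (l, p, B) \<longleftrightarrow>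
    (if k < l then (if q < p then A + (l - k) < B else A + (l - k) \<le> B)
     else if k = l then (if p < q then A \<le> B else A < B) else A \<le> B)"
proof -
  define d where "d = (int k - int l) * int u + (int q - int p)"
  \<comment> \<open>Since \<open>r * u = M - 1\<close>, multiplying the difference of the
    \<open>y\<close>-exponents by \<open>r\<close> gives \<open>M * (l - k) + e\<close>, with
    \<open>e\<close> smaller than \<open>M\<close> in absolute value. The sign of \<open>e\<close>
    is that of \<open>p - q\<close>, and for \<open>p = q\<close> that of
    \<open>k - l\<close>.\<close>
  define e where "e = int r * (int p - int q) - (int l - int k)"
  define M where "M = int u * int r + 1"
  note bd = block_difference_bounds[of "int k" "int r" "int l" "int q" "int u" "int p", folded d_def]
  have m: "\<bar>- d\<bar> < M" using bd(1) assms by (auto simp: M_def)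
  have pq: "int r * (int p - int q) \<le> int r * (int u - 1)" "int r * (int q - int p) \<le> int r * (int u - 1)"
    using assms by (auto intro!: mult_left_mono)
  have e: "\<bar>e\<bar> < M" using pq assms by (simp add: e_def M_def algebra_simps abs_less_iff)
  have "p > q \<Longrightarrow> int r * 1 \<le> int r * (int p - int q)" by (intro mult_left_mono) auto
  hence e1: "p > q \<Longrightarrow> e > 0" using assms unfolding e_def by linarith
  have "p \<le> q \<Longrightarrow> int r * (int p - int q) \<le> int r * 0" by (intro mult_left_mono) auto
  hence e2: "p \<le> q \<Longrightarrow> k < l \<Longrightarrow> e < 0" by (simp add: e_def)
  have "p < q \<Longrightarrow> int r * (int p - int q) \<le> int r * (-1)" by (intro mult_left_mono) auto
  hence e3: "p < q \<Longrightarrow> k = l \<Longrightarrow> e < 0" using assms by (simp add: e_def)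
  have e4: "p = q \<Longrightarrow> k = l \<Longrightarrow> e = 0" by (simp add: e_def)
  have 1: "gap_inf u r (l, p, B) < gap_inf u r (k, q, A) \<longleftrightarrow> e < M * (int B - int A - (int l - int k))"
    by (simp add: gap_inf_def e_def M_def algebra_simps)
  have 2: "gap1 u r (k, q, A) < gap1 u r (l, p, B) \<longleftrightarrow> - d < M * (int B - int A)"
    by (simp add: gap1_def d_def M_def algebra_simps)
  consider "k < l" | "k = l" | "l < k" by linarith
  thus ?thesis
  proof cases
    case 1
    thus ?thesis unfolding \<open>gap_inf u r (l, p, B) < _ \<longleftrightarrow> _\<close> 2
        mult_less_cancel_bounded[OF m] mult_less_cancel_bounded[OF e]
      using bd(2) assms e1 e2 by auto
  next
    \<comment> \<open>Within one block both remainders have the sign of \<open>p - q\<close>, so the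
      two comparisons become the same inequality. At two affine places the signs are opposite
      instead.\<close>
    case 2
    have "d = int q - int p" using 2 by (simp add: d_def)
    thus ?thesis unfolding 1 \<open>gap1 u r (k, q, A) < _ \<longleftrightarrow> _\<close>
        mult_less_cancel_bounded[OF m] mult_less_cancel_bounded[OF e]
      using 2 e1 e3 e4 by (cases p q rule: linorder_cases) auto
  next
    case 3
    hence "e > 0 \<or> int B - int A - (int l - int k) > 0 \<or> int B - int A < 0" by auto
    thus ?thesis unfolding 1 2
        mult_less_cancel_bounded[OF m] mult_less_cancel_bounded[OF e]
      using 3 bd(3) assms by auto
  qed
qed

section \<open>Closed forms for the gap sums and the inversion counts\<close>

lemma sum_lessThan_int:
  "2 * (\<Sum>k<n. int k) = int n * (int n - 1)"
  by (induction n) (auto simp: algebra_simps)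

lemma sum_quadratic:
  "6 * (\<Sum>k<n. \<alpha> * (int k * int k) + \<beta> * int k) =
     \<alpha> * (int n * (int n - 1) * (2 * int n - 1)) + 3 * \<beta> * (int n * (int n - 1))"
  by (induction n) (auto simp: algebra_simps)

text \<open>Peeling off the last row and column allows induction on the side length: in the double
  sums needed here, a summand on the border away from the corner depends only on the smaller
  index.\<close>

lemma sum_square_Suc:
  fixes F :: "nat \<Rightarrow> nat \<Rightarrow> int"
  shows "(\<Sum>k<Suc n. \<Sum>l<Suc n. F k l) = (\<Sum>k<n. \<Sum>l<n. F k l) + (\<Sum>k<n. F k n + F n k) + F n n"
  by (simp add: sum.distrib)

lemma scaled_sum3:
  fixes a b c :: int
  assumes "6 * a = A" "6 * b = B" "c = C"
  shows "6 * (a + b + c) = A + B + 6 * C"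
  using assms by simp

text \<open>With m = u r + 1 and j = k u + q + 1, the two orders add up to m (k + 1) - 2 j. As
  \<open>A\<close> cancels, the innermost sum is multiplication by \<open>k\<close>.\<close>

lemma sum_gaps_affine:
  "6 * (\<Sum>i\<in>tri_index u r. gap1 u r i + gap2 u r i) =
     int u * int r * (int r - 1) *
       ((int u * int r + 1 - 2 * int u) * (2 * int r - 1) + 3 * (int u * int r - int u))"
proof -
  have *: "(\<Sum>q<u. \<Sum>A<k. gap1 u r (k, q, A) + gap2 u r (k, q, A)) =
      int u * (int u * int r + 1 - 2 * int u) * (int k * int k) + int u * (int u * int r - int u) * int k" for k
  proof -
    have "(\<Sum>q<u. \<Sum>A<k. gap1 u r (k, q, A) + gap2 u r (k, q, A)) =
        int k * (int u * ((int u * int r + 1) * (int k + 1) - 2 * (int k * int u + 1)) - 2 * (\<Sum>q<u. int q))"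
      by (simp add: gap1_def gap2_def algebra_simps sum.distrib sum_subtractf sum_distrib_left)
    thus ?thesis by (simp add: sum_lessThan_int algebra_simps)
  qed
  show ?thesis unfolding sum_tri_index * sum_quadratic by (simp add: algebra_simps)
qed

text \<open>The two orders now add up to (r - 1) j, and \<open>A\<close> cancels again. The factor 2
  in the intermediate sums clears the triangular number that comes from summing over
  \<open>q\<close>.\<close>

lemma sum_gaps_infinity:
  "12 * (\<Sum>i\<in>tri_index u r. gap1 u r i + gap_inf u r i) =
     int u * int r * (int r - 1) * ((int r - 1) * (2 * int u * (2 * int r - 1) + 3 * (int u + 1)))"
proof -
  have *: "2 * (\<Sum>q<u. \<Sum>A<k. gap1 u r (k, q, A) + gap_inf u r (k, q, A)) =
      (int r - 1) * (2 * int u * int u) * (int k * int k) + (int r - 1) * (int u * (int u + 1)) * int k" for k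
  proof -
    have "(\<Sum>q<u. \<Sum>A<k. gap1 u r (k, q, A) + gap_inf u r (k, q, A)) =
        (int r - 1) * int k * (int u * (int k * int u + 1) + (\<Sum>q<u. int q))"
      by (simp add: gap1_def gap_inf_def algebra_simps sum.distrib sum_subtractf sum_distrib_left)
    hence "2 * (\<Sum>q<u. \<Sum>A<k. gap1 u r (k, q, A) + gap_inf u r (k, q, A)) =
        (int r - 1) * int k * (2 * int u * (int k * int u + 1) + 2 * (\<Sum>q<u. int q))"
      by (simp add: algebra_simps)
    thus ?thesis by (simp add: sum_lessThan_int algebra_simps)
  qed
  have "12 * (\<Sum>i\<in>tri_index u r. gap1 u r i + gap_inf u r i) =
      6 * (\<Sum>k<r. 2 * (\<Sum>q<u. \<Sum>A<k. gap1 u r (k, q, A) + gap_inf u r (k, q, A)))"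
    by (simp add: sum_tri_index sum_distrib_left)
  thus ?thesis unfolding * sum_quadratic by (simp add: algebra_simps)
qed

lemma inversion_count_affine:
  "12 * int (card {(s, t) \<in> tri_index u r \<times> tri_index u r.
      gap2 u r t < gap2 u r s \<and> gap1 u r s < gap1 u r t}) =
    int u * int u * (int r * (int r - 1) * (int r - 2) * (int r + 3))"
proof -
  \<comment> \<open>Twice the number of pairs \<open>A\<close>, \<open>B\<close> for the blocks
    \<open>k\<close> and \<open>l\<close>; since \<open>q\<close> and \<open>p\<close> do not occur,
    summing over them multiplies by \<open>u * u\<close>.\<close>
  define F where "F k l = (if k < l then int k * (int k + 1) else
      if k = l then int k * (int k - 1) else int l * (int l + 1))" for k l
  have "2 * int (card {(A, B). A < k \<and> B < l \<and>
        gap2 u r (l, p, B) < gap2 u r (k, q, A) \<and> gap1 u r (k, q, A) < gap1 u r (l, p, B)}) = F k l"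
    if "k < r" "l < r" "q < u" "p < u" for k l q p
  proof -
    have "{(A, B). A < k \<and> B < l \<and>
        gap2 u r (l, p, B) < gap2 u r (k, q, A) \<and> gap1 u r (k, q, A) < gap1 u r (l, p, B)} =
        {(A, B). A < k \<and> B < l \<and> (if k < l then A + (l - k) \<le> B else if k = l then A < B else A \<le> B)}"
      using inversion_iff_affine[OF that] by blast
    thus ?thesis using card_pairs_shift_le[of k l] card_pairs_shift_less[of k l] card_pairs_le[of l k]
      by (auto simp: F_def)
  qed
  hence "2 * int (card {(s, t) \<in> tri_index u r \<times> tri_index u r.
      gap2 u r t < gap2 u r s \<and> gap1 u r s < gap1 u r t}) = (\<Sum>k<r. \<Sum>q<u. \<Sum>l<r. \<Sum>p<u. F k l)"
    unfolding card_pairs_tri_index sum_distrib_left by (intro sum.cong refl) auto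
  also have "\<dots> = int u * int u * (\<Sum>k<r. \<Sum>l<r. F k l)"
    by (simp add: sum_distrib_left mult.assoc)
  finally have 1: "2 * int (card {(s, t) \<in> tri_index u r \<times> tri_index u r.
      gap2 u r t < gap2 u r s \<and> gap1 u r s < gap1 u r t}) = int u * int u * (\<Sum>k<r. \<Sum>l<r. F k l)" .
  have "6 * (\<Sum>k<n. \<Sum>l<n. F k l) = int n * (int n - 1) * (int n - 2) * (int n + 3)" for n
  proof (induction n)
    case (Suc n)
    have "(\<Sum>k<n. F k n + F n k) = (\<Sum>k<n. 2 * (int k * int k) + 2 * int k)"
      by (intro sum.cong) (auto simp: F_def algebra_simps)
    hence "6 * (\<Sum>k<n. F k n + F n k) =
        2 * (int n * (int n - 1) * (2 * int n - 1)) + 3 * 2 * (int n * (int n - 1))"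
      by (simp only: sum_quadratic)
    moreover have "F n n = int n * (int n - 1)" by (simp add: F_def)
    ultimately have "6 * (\<Sum>k<Suc n. \<Sum>l<Suc n. F k l) = int n * (int n - 1) * (int n - 2) * (int n + 3) +
        (2 * (int n * (int n - 1) * (2 * int n - 1)) + 3 * 2 * (int n * (int n - 1))) + 6 * (int n * (int n - 1))"
      using Suc unfolding sum_square_Suc by (intro scaled_sum3)
    thus ?case by (simp add: algebra_simps)
  qed simp
  note this[of r]
  moreover have "12 * int (card {(s, t) \<in> tri_index u r \<times> tri_index u r.
      gap2 u r t < gap2 u r s \<and> gap1 u r s < gap1 u r t}) = int u * int u * (6 * (\<Sum>k<r. \<Sum>l<r. F k l))"
    using 1 by simp
  ultimately show ?thesis by (simp only:)
qed

lemma sum_sum_if_less: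
  "2 * (\<Sum>q<u. \<Sum>p<u. if q < p then c else d) =
     (int u * (int u - 1)) * c + (int u * (int u + 1)) * (d :: int)"
  "2 * (\<Sum>q<u. \<Sum>p<u. if p < q then c else d) =
     (int u * (int u - 1)) * c + (int u * (int u + 1)) * (d :: int)"
proof -
  show "2 * (\<Sum>q<u. \<Sum>p<u. if q < p then c else d) =
     (int u * (int u - 1)) * c + (int u * (int u + 1)) * (d :: int)"
  proof (induction u)
    case (Suc u)
    have "(\<Sum>k<u. (if k < u then c else d) + (if u < k then c else d)) = (\<Sum>k<u. c + d)"
      by (intro sum.cong) auto
    thus ?case using Suc by (subst sum_square_Suc) (simp add: algebra_simps)
  qed simp
  thus "2 * (\<Sum>q<u. \<Sum>p<u. if p < q then c else d) =
     (int u * (int u - 1)) * c + (int u * (int u + 1)) * (d :: int)"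
    by (subst sum.swap)
qed

lemma inversion_count_infinity:
  "12 * int (card {(s, t) \<in> tri_index u r \<times> tri_index u r.
      gap_inf u r t < gap_inf u r s \<and> gap1 u r s < gap1 u r t}) =
    int u * (int r * (int r - 1) * (int u * int r * int r + int r - int u - 5))"
proof -
  define F where "F k q l p = (if k < l then (if q < p then int k * (int k - 1) else int k * (int k + 1)) else
      if k = l then (if p < q then int k * (int k + 1) else int k * (int k - 1))
      else int l * (int l + 1))" for k q l p :: nat
  \<comment> \<open>This is \<open>F\<close> summed over \<open>q\<close> and \<open>p\<close> and
    doubled once more: of the \<open>u * u\<close> pairs, u (u - 1) / 2 have \<open>q < p\<close>,
    and as many have \<open>p < q\<close>.\<close>
  define W where "W k l = (if k < l then
        (int u * (int u - 1)) * (int k * (int k - 1)) + (int u * (int u + 1)) * (int k * (int k + 1)) else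
      if k = l then (int u * (int u - 1)) * (int k * (int k + 1)) + (int u * (int u + 1)) * (int k * (int k - 1))
      else 2 * int u * int u * (int l * (int l + 1)))" for k l :: nat
  have "2 * int (card {(A, B). A < k \<and> B < l \<and>
        gap_inf u r (l, p, B) < gap_inf u r (k, q, A) \<and> gap1 u r (k, q, A) < gap1 u r (l, p, B)}) = F k q l p"
    if "k < r" "l < r" "q < u" "p < u" for k l q p
  proof -
    have "{(A, B). A < k \<and> B < l \<and>
        gap_inf u r (l, p, B) < gap_inf u r (k, q, A) \<and> gap1 u r (k, q, A) < gap1 u r (l, p, B)} =
        {(A, B). A < k \<and> B < l \<and> (if k < l then (if q < p then A + (l - k) < B else A + (l - k) \<le> B)
          else if k = l then (if p < q then A \<le> B else A < B) else A \<le> B)}"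
      using inversion_iff_infinity[OF that] by blast
    thus ?thesis using card_pairs_shift_le[of k l] card_pairs_shift_less[of k l] card_pairs_le[of l k]
      by (auto simp: F_def)
  qed
  hence "2 * int (card {(s, t) \<in> tri_index u r \<times> tri_index u r.
      gap_inf u r t < gap_inf u r s \<and> gap1 u r s < gap1 u r t}) = (\<Sum>k<r. \<Sum>q<u. \<Sum>l<r. \<Sum>p<u. F k q l p)"
    unfolding card_pairs_tri_index sum_distrib_left by (intro sum.cong refl) auto
  also have "\<dots> = (\<Sum>k<r. \<Sum>l<r. \<Sum>q<u. \<Sum>p<u. F k q l p)"
    by (intro sum.cong refl sum.swap)
  finally have "4 * int (card {(s, t) \<in> tri_index u r \<times> tri_index u r.
      gap_inf u r t < gap_inf u r s \<and> gap1 u r s < gap1 u r t}) = 2 * (\<Sum>k<r. \<Sum>l<r. \<Sum>q<u. \<Sum>p<u. F k q l p)"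
    by simp
  also have "\<dots> = (\<Sum>k<r. \<Sum>l<r. 2 * (\<Sum>q<u. \<Sum>p<u. F k q l p))"
    by (simp only: sum_distrib_left)
  also have "\<dots> = (\<Sum>k<r. \<Sum>l<r. W k l)"
    by (intro sum.cong refl) (auto simp: F_def W_def sum_sum_if_less)
  finally have 1: "4 * int (card {(s, t) \<in> tri_index u r \<times> tri_index u r.
      gap_inf u r t < gap_inf u r s \<and> gap1 u r s < gap1 u r t}) = (\<Sum>k<r. \<Sum>l<r. W k l)" .
  have "3 * (\<Sum>k<n. \<Sum>l<n. W k l) = int u * (int n * (int n - 1) * (int u * int n * int n + int n - int u - 5))" for n
  proof (induction n)
    case (Suc n)
    have "(\<Sum>k<n. W k n + W n k) = (\<Sum>k<n. 4 * int u * int u * (int k * int k) + (2 * int u + 2 * int u * int u) * int k)"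
      by (intro sum.cong) (auto simp: W_def algebra_simps)
    hence "6 * (\<Sum>k<n. W k n + W n k) =
        (4 * int u * int u) * (int n * (int n - 1) * (2 * int n - 1)) +
          3 * (2 * int u + 2 * int u * int u) * (int n * (int n - 1))"
      by (simp only: sum_quadratic)
    moreover have "W n n = 2 * int u * int u * (int n * int n) - 2 * int u * int n" by (simp add: W_def algebra_simps)
    ultimately have "6 * (\<Sum>k<Suc n. \<Sum>l<Suc n. W k l) =
        (2 * (int u * (int n * (int n - 1) * (int u * int n * int n + int n - int u - 5)))) +
        ((4 * int u * int u) * (int n * (int n - 1) * (2 * int n - 1)) +
          3 * (2 * int u + 2 * int u * int u) * (int n * (int n - 1))) +
        6 * (2 * int u * int u * (int n * int n) - 2 * int u * int n)"
      using Suc unfolding sum_square_Suc by (intro scaled_sum3) simp_all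
    thus ?case by (simp add: algebra_simps)
  qed simp
  from this[of r] show ?thesis using 1 by (simp add: algebra_simps)
qed

section \<open>Polynomials over subrings and ring maps\<close>

text \<open>Because the constants are a subset of the type, polynomial rings over them are subsets
  too. One predicate then serves for \<open>K\<close>, K[X], K[X][Y], valuation rings and the local
  ring of a point.\<close>

definition is_subring :: "'a::comm_ring_1 set \<Rightarrow> bool" where
  "is_subring S \<longleftrightarrow> 0 \<in> S \<and> 1 \<in> S \<and> (\<forall>a\<in>S. \<forall>b\<in>S. a + b \<in> S \<and> a * b \<in> S) \<and> (\<forall>a\<in>S. - a \<in> S)"

lemma is_subringD:
  assumes "is_subring S"
  shows "0 \<in> S" "1 \<in> S" "a \<in> S \<Longrightarrow> b \<in> S \<Longrightarrow> a + b \<in> S" "a \<in> S \<Longrightarrow> b \<in> S \<Longrightarrow> a * b \<in> S"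
    "a \<in> S \<Longrightarrow> - a \<in> S"
  using assms by (auto simp: is_subring_def)

lemma is_subring_diff: "is_subring S \<Longrightarrow> a \<in> S \<Longrightarrow> b \<in> S \<Longrightarrow> a - b \<in> S"
  using is_subringD(3)[of S a "- b"] is_subringD(5)[of S b] by simp

lemma is_subring_sum: "is_subring S \<Longrightarrow> (\<And>i. i \<in> I \<Longrightarrow> g i \<in> S) \<Longrightarrow> sum g I \<in> S"
  by (induction I rule: infinite_finite_induct) (auto simp: is_subringD)

lemma is_subring_power: "is_subring S \<Longrightarrow> a \<in> S \<Longrightarrow> a ^ n \<in> S"
  by (induction n) (auto simp: is_subringD)

lemma is_subfield_imp_subring: "is_subfield K \<Longrightarrow> is_subring K"
  by (auto simp: is_subfield_def is_subring_def)

definition polys_over :: "'a::comm_ring_1 set \<Rightarrow> 'a poly set" where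
  "polys_over S = {p. \<forall>i. coeff p i \<in> S}"

lemma poly_over_iff: "poly_over K p \<longleftrightarrow> p \<in> polys_over K"
  by (simp add: poly_over_def polys_over_def)

lemma polys_over_coeff: "p \<in> polys_over S \<Longrightarrow> coeff p i \<in> S"
  by (simp add: polys_over_def)

lemma polys_over_pCons: "pCons a p \<in> polys_over S \<longleftrightarrow> a \<in> S \<and> p \<in> polys_over S"
proof
  assume L: "pCons a p \<in> polys_over S"
  have "coeff p i \<in> S" for i using polys_over_coeff[OF L, of "Suc i"] by simp
  thus "a \<in> S \<and> p \<in> polys_over S" using polys_over_coeff[OF L, of 0] by (simp add: polys_over_def)
qed (auto simp: polys_over_def coeff_pCons split: nat.split)

lemma is_subring_polys_over:
  assumes "is_subring S" shows "is_subring (polys_over S)"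
  using is_subringD[OF assms]
  unfolding is_subring_def polys_over_def
  by (auto simp: coeff_mult coeff_1 intro!: is_subring_sum[OF assms])

lemma polys_over_const: "is_subring S \<Longrightarrow> [:c:] \<in> polys_over S \<longleftrightarrow> c \<in> S"
  by (auto simp: polys_over_pCons is_subringD is_subring_polys_over)

lemma polys_over_monom: "is_subring S \<Longrightarrow> c \<in> S \<Longrightarrow> monom c n \<in> polys_over S"
  by (auto simp: polys_over_def is_subringD)

lemma polys_over_smult: "is_subring S \<Longrightarrow> c \<in> S \<Longrightarrow> p \<in> polys_over S \<Longrightarrow> smult c p \<in> polys_over S"
  by (auto simp: polys_over_def is_subringD)

lemma poly_in_subring: "is_subring S \<Longrightarrow> p \<in> polys_over S \<Longrightarrow> c \<in> S \<Longrightarrow> poly p c \<in> S"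
  by (induction p) (auto simp: is_subringD polys_over_pCons)

lemma synthetic_div_polys_over:
  "is_subring S \<Longrightarrow> p \<in> polys_over S \<Longrightarrow> c \<in> S \<Longrightarrow> synthetic_div p c \<in> polys_over S"
  by (induction p) (auto simp: is_subringD polys_over_pCons poly_in_subring)

text \<open>Leading coefficients cannot be inverted in \<open>S\<close>, so \<open>p\<close> is
  scaled by those of \<open>g\<close> instead. For monic \<open>g\<close> this is ordinary division;
  in general it supports a Euclidean algorithm over K[X].\<close>

lemma pseudo_division_over:
  fixes p g :: "'a::idom poly"
  assumes S: "is_subring S" and g: "g \<in> polys_over S" "g \<noteq> 0" and p: "p \<in> polys_over S"
  shows "\<exists>q r s. q \<in> polys_over S \<and> r \<in> polys_over S \<and>
           smult (lead_coeff g ^ s) p = q * g + r \<and> (r = 0 \<or> degree r < degree g)"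
  using p
proof (induction "degree p" arbitrary: p rule: less_induct)
  case less
  note S' = is_subring_polys_over[OF S]
  show ?case
  proof (cases "p = 0 \<or> degree p < degree g")
    case True
    thus ?thesis using less.prems is_subringD(1)[OF S']
      by (intro exI[of _ 0] exI[of _ p]) auto
  next
    case False
    define c where "c = lead_coeff g"
    define t where "t = monom (lead_coeff p) (degree p - degree g)"
    define p' where "p' = smult c p - t * g"
    have t: "t \<in> polys_over S" and c: "c \<in> S"
      using less.prems g S by (auto simp: t_def c_def polys_over_monom polys_over_coeff)
    have p': "p' \<in> polys_over S"
      using t g c less.prems unfolding p'_def
      by (intro is_subring_diff[OF S'] polys_over_smult[OF S] is_subringD(4)[OF S'])
    have dt: "degree (t * g) = degree p" "coeff (t * g) (degree p) = lead_coeff p * c"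
      using False g by (auto simp: t_def c_def degree_mult_eq degree_monom_eq coeff_monom_mult monom_eq_0_iff)
    have "degree p' \<le> degree p"
      unfolding p'_def using dt by (intro degree_diff_le) (auto simp: degree_smult_le)
    moreover have "coeff p' (degree p) = 0" using dt by (simp add: p'_def mult.commute)
    ultimately have "p' = 0 \<or> degree p' < degree p" using eq_zero_or_degree_less by blast
    hence "\<exists>q r s. q \<in> polys_over S \<and> r \<in> polys_over S \<and>
           smult (c ^ s) p' = q * g + r \<and> (r = 0 \<or> degree r < degree g)"
    proof
      assume "p' = 0"
      thus ?thesis using is_subringD(1)[OF S'] by (intro exI[of _ 0]) auto
    next
      assume "degree p' < degree p"
      thus ?thesis using less.hyps[OF _ p'] by (simp add: c_def)
    qed
    then obtain q r s where qr: "q \<in> polys_over S" "r \<in> polys_over S"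
      "smult (c ^ s) p' = q * g + r" "r = 0 \<or> degree r < degree g" by blast
    have "smult (c ^ Suc s) p = smult (c ^ s) p' + smult (c ^ s) (t * g)"
      by (simp add: p'_def smult_diff_right mult.commute)
    also have "\<dots> = (q + smult (c ^ s) t) * g + r" using qr by (simp add: algebra_simps)
    finally have "smult (c ^ Suc s) p = (q + smult (c ^ s) t) * g + r" .
    moreover have "q + smult (c ^ s) t \<in> polys_over S"
      using qr t c by (intro is_subringD(3)[OF S'] polys_over_smult[OF S] is_subring_power[OF S])
    ultimately show ?thesis using qr unfolding c_def by blast
  qed
qed

lemma field_poly_bezout:
  fixes p q :: "'a::field poly"
  shows "\<exists>a b d. a * p + b * q = d \<and> d dvd p \<and> d dvd q"
proof (induction q arbitrary: p rule: measure_induct_rule[of "\<lambda>q. if q = 0 then 0 else Suc (degree q)"])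
  case (less q)
  show ?case
  proof (cases "q = 0")
    case True
    thus ?thesis by (intro exI[of _ 1] exI[of _ 0] exI[of _ p]) auto
  next
    case False
    hence "(if p mod q = 0 then 0 else Suc (degree (p mod q))) < (if q = 0 then 0 else Suc (degree q))"
      using degree_mod_less[of q p] by auto
    from less.IH[OF this, of q] obtain a b d where
      d: "a * q + b * (p mod q) = d" "d dvd q" "d dvd p mod q" by blast
    have "b * p + (a - b * (p div q)) * q = a * q + b * (p - p div q * q)"
      by (simp add: algebra_simps)
    also have "p - p div q * q = p mod q" by (simp add: minus_div_mult_eq_mod)
    finally have "b * p + (a - b * (p div q)) * q = d" using d by simp
    moreover have "d dvd p" using d by (metis dvd_mod_iff)
    ultimately show ?thesis using d by blast
  qed
qed

text \<open>The identity is preserved by every ring homomorphism, which is how separability of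
  \<open>f\<close> reaches an algebraic closure.\<close>

lemma coprime_imp_bezout_field_poly:
  fixes p q :: "'a::field poly"
  assumes "coprime p q"
  shows "\<exists>a b. a * p + b * q = 1"
proof -
  obtain a b d where d: "a * p + b * q = d" "d dvd p" "d dvd q"
    using field_poly_bezout by blast
  hence "d dvd 1" using assms by (meson coprime_common_divisor)
  then obtain e where "1 = d * e" by (elim dvdE)
  have "(e * a) * p + (e * b) * q = e * (a * p + b * q)" by (simp only: algebra_simps)
  also have "\<dots> = 1" using d(1) \<open>1 = d * e\<close> by (simp add: mult.commute)
  finally have "(e * a) * p + (e * b) * q = 1" .
  thus ?thesis by blast
qed

section \<open>Ring homomorphisms and substitution\<close>

locale ring_map =
  fixes h :: "'a::comm_ring_1 \<Rightarrow> 'b::comm_ring_1"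
  assumes map_one [simp]: "h 1 = 1"
    and map_add [simp]: "h (a + b) = h a + h b"
    and map_mult [simp]: "h (a * b) = h a * h b"
begin

lemma map_zero [simp]: "h 0 = 0"
  using map_add[of 0 0] by simp

lemma map_uminus [simp]: "h (- a) = - h a"
  using map_add[of a "- a"] by (simp add: eq_neg_iff_add_eq_0 add.commute)

lemma map_diff [simp]: "h (a - b) = h a - h b"
  using map_add[of a "- b"] by simp

lemma map_power [simp]: "h (a ^ n) = h a ^ n"
  by (induction n) auto

lemma map_sum: "h (sum g I) = (\<Sum>i\<in>I. h (g i))"
  by (induction I rule: infinite_finite_induct) auto

lemma map_of_nat [simp]: "h (of_nat n) = of_nat n"
  by (induction n) auto

end

lemma ring_map_field_eq_0_iff:
  fixes h :: "'a::field \<Rightarrow> 'b::field"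
  assumes "ring_map h"
  shows "h a = 0 \<longleftrightarrow> a = 0"
proof -
  interpret ring_map h by fact
  have "a \<noteq> 0 \<Longrightarrow> h a * h (inverse a) = 1" by (simp flip: map_mult)
  thus ?thesis by (metis map_zero mult_zero_left zero_neq_one)
qed

text \<open>Nested twice, it evaluates polynomials in \<open>x\<close> and \<open>y\<close>, with
  \<open>y\<close> as the outer variable.\<close>

definition eval_hom :: "('a::comm_ring_1 \<Rightarrow> 'b::comm_ring_1) \<Rightarrow> 'b \<Rightarrow> 'a poly \<Rightarrow> 'b" where
  "eval_hom h z p = poly (map_poly h p) z"

lemma eval_hom_id [simp]: "eval_hom (\<lambda>c. c) z p = poly p z"
  by (simp add: eval_hom_def)

context ring_map
begin

lemma eval_hom_0 [simp]: "eval_hom h z 0 = 0"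
  by (simp add: eval_hom_def)

lemma eval_hom_pCons [simp]: "eval_hom h z (pCons a p) = h a + z * eval_hom h z p"
  by (simp add: eval_hom_def map_poly_pCons)

lemma eval_hom_add: "eval_hom h z (p + q) = eval_hom h z p + eval_hom h z q"
  by (induction p q rule: poly_induct2) (simp_all add: algebra_simps)

lemma eval_hom_smult: "eval_hom h z (smult c p) = h c * eval_hom h z p"
  by (induction p) (simp_all add: algebra_simps)

lemma eval_hom_mult: "eval_hom h z (p * q) = eval_hom h z p * eval_hom h z q"
  by (induction p) (simp_all add: eval_hom_add eval_hom_smult algebra_simps)

lemma ring_map_eval_hom: "ring_map (eval_hom h z)"
  by unfold_locales (simp_all add: eval_hom_add eval_hom_mult one_pCons)

lemma eval_hom_monom: "eval_hom h z (monom c n) = h c * z ^ n"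
  by (induction n) (simp_all add: monom_0 monom_Suc algebra_simps)

lemma eval_hom_eq_sum:
  "degree p < n \<Longrightarrow> eval_hom h z p = (\<Sum>i<n. h (coeff p i) * z ^ i)"
proof (induction n arbitrary: p)
  case (Suc n)
  obtain a q where p: "p = pCons a q" by (cases p)
  show ?case
  proof (cases "q = 0")
    case True
    hence "coeff p (Suc i) = 0" for i by (simp add: p)
    thus ?thesis using True by (simp add: p sum.lessThan_Suc_shift del: sum.lessThan_Suc)
  next
    case False
    hence "degree q < n" using Suc.prems by (simp add: p)
    from Suc.IH[OF this] show ?thesis
      by (simp add: p sum.lessThan_Suc_shift sum_distrib_left mult_ac del: sum.lessThan_Suc)
  qed
qed simp

end

lemma ring_map_id: "ring_map (\<lambda>c. c)"
  by unfold_locales auto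

lemma ring_map_comp: "ring_map g \<Longrightarrow> ring_map h \<Longrightarrow> ring_map (\<lambda>c. g (h c))"
  by (simp add: ring_map_def)

lemma eval_hom_comp:
  assumes "ring_map g" "ring_map h"
  shows "eval_hom (\<lambda>c. g (h c)) z p = eval_hom g z (map_poly h p)"
  using assms by (simp add: eval_hom_def map_poly_map_poly o_def ring_map.map_zero)

lemma ring_map_eval_hom_commute:
  assumes "ring_map g" "ring_map h"
  shows "g (eval_hom h z p) = eval_hom (\<lambda>c. g (h c)) (g z) p"
proof -
  interpret g: ring_map g by fact
  interpret h: ring_map h by fact
  interpret gh: ring_map "\<lambda>c. g (h c)" by (rule ring_map_comp) fact+
  show ?thesis by (induction p) simp_all
qed

lemma ring_map_map_poly:
  assumes "ring_map h" shows "ring_map (map_poly h)"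
proof -
  interpret h: ring_map h by fact
  show ?thesis
    by unfold_locales
      (auto intro!: poly_eqI simp: coeff_map_poly coeff_mult h.map_sum)
qed

section \<open>Root orders under field embeddings, and roots of unity\<close>

lemma order_map_poly:
  fixes h :: "'a::field \<Rightarrow> 'b::field"
  assumes h: "ring_map h" and p: "p \<noteq> 0"
  shows "order (h a) (map_poly h p) = order a p"
proof -
  interpret h: ring_map h by fact
  interpret H: ring_map "map_poly h" by (rule ring_map_map_poly) fact
  have h0: "h c = 0 \<longleftrightarrow> c = 0" for c
    by (rule ring_map_field_eq_0_iff[OF h])
  obtain q where q: "p = [:-a, 1:] ^ order a p * q" "\<not> [:-a, 1:] dvd q"
    using order_decomp[OF p] by blast
  have "poly (map_poly h q) (h a) = h (poly q a)"
    using ring_map_eval_hom_commute[OF h ring_map_id, of a q] by (simp add: eval_hom_def)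
  hence "poly (map_poly h q) (h a) \<noteq> 0" using q(2) by (simp add: h0 poly_eq_0_iff_dvd)
  hence nd: "\<not> [:- h a, 1:] dvd map_poly h q" by (simp add: poly_eq_0_iff_dvd)
  have "map_poly h p = map_poly h ([:-a, 1:] ^ order a p * q)" using q(1) by simp
  also have "\<dots> = [:- h a, 1:] ^ order a p * map_poly h q"
    by (simp add: map_poly_pCons)
  finally have e: "map_poly h p = [:- h a, 1:] ^ order a p * map_poly h q" .
  have "map_poly h p \<noteq> 0" using p h0 by (subst map_poly_eq_0_iff) auto
  moreover have "\<not> [:- h a, 1:] ^ Suc (order a p) dvd map_poly h p"
    using nd unfolding e power_Suc2 by (subst dvd_times_left_cancel_iff) auto
  moreover have "[:- h a, 1:] ^ order a p dvd map_poly h p" unfolding e by simp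
  ultimately show ?thesis using order_unique_lemma by metis
qed

text \<open>The set \<open>S\<close> may exceed the set of roots, so that numerator and denominator
  of a rational function can be summed over the same points.\<close>

lemma degree_eq_sum_order:
  fixes p :: "'a::alg_closed_field poly"
  assumes p: "p \<noteq> 0" and fin: "finite S" and S: "{a. poly p a = 0} \<subseteq> S"
  shows "degree p = (\<Sum>a\<in>S. order a p)"
proof -
  obtain A where A: "size A = degree p" "p = smult (lead_coeff p) (\<Prod>x\<in>#A. [:-x, 1:])"
    using alg_closed_imp_factorization[OF p] by blast
  have 0: "(\<Prod>x\<in>#A. [:-x, 1:]) \<noteq> 0" for A :: "'a multiset" by (auto simp: prod_mset_zero_iff)
  have "proots (\<Prod>x\<in>#A. [:-x, 1:]) = A" for A :: "'a multiset"
  proof (induction A)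
    case (add x A)
    have "proots ([:-x, 1:] * (\<Prod>x\<in>#A. [:-x, 1:])) = proots [:-x, 1:] + proots (\<Prod>x\<in>#A. [:-x, 1:])"
      using 0[of A] by (intro proots_mult) auto
    thus ?case using add by (simp del: mult_pCons_left)
  qed simp
  hence "proots p = A" using p by (subst A(2)) simp
  hence "degree p = size (proots p)" using A by simp
  also have "\<dots> = (\<Sum>a\<in>set_mset (proots p). order a p)"
    using p by (simp add: size_multiset_overloaded_eq)
  also have "\<dots> = (\<Sum>a\<in>S. order a p)"
    using p S fin by (intro sum.mono_neutral_left) (auto simp: order_eq_0_iff)
  finally show ?thesis .
qed

text \<open>The polynomial X^m - 1 splits, and its derivative m X^(m-1) vanishes at none of its
  roots; all roots are simple and their number is the degree.\<close>

lemma card_roots_of_unity: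
  assumes m: "of_nat m \<noteq> (0 :: 'a::alg_closed_field)"
  shows "finite {w :: 'a. w ^ m = 1}" "card {w :: 'a. w ^ m = 1} = m"
proof -
  have m0: "m > 0" using m by (cases m) auto
  define p where "p = (monom 1 m - 1 :: 'a poly)"
  have dp: "degree p = m" unfolding p_def using m0
    by (subst diff_conv_add_uminus, subst degree_add_eq_left) (auto simp: degree_monom_eq)
  have p0: "p \<noteq> 0" using dp m0 by auto
  have roots: "{w. poly p w = 0} = {w. w ^ m = 1}" by (simp add: p_def poly_monom)
  have simple: "order w p = 1" if "w ^ m = 1" for w
  proof -
    have w: "poly p w = 0" using that roots by auto
    have "w \<noteq> 0" using that m0 by (auto simp: power_0_left)
    hence "poly (pderiv p) w \<noteq> 0" using m m0
      by (simp add: p_def pderiv_diff pderiv_monom poly_monom)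
    hence "order w (pderiv p) = 0" by (rule order_0I)
    show ?thesis
    proof (rule ccontr)
      assume "order w p \<noteq> 1"
      moreover have "order w p \<noteq> 0" using w p0 by (simp add: order_root)
      ultimately have "2 \<le> order w p" by linarith
      hence "[:-w, 1:] ^ 2 dvd p" by (simp add: order_divides)
      then obtain g where g: "p = [:-w, 1:] ^ 2 * g" by (elim dvdE)
      define a where "a = [:-w, 1:]"
      have "p = a * (a * g)" using g by (simp only: a_def power2_eq_square mult.assoc)
      hence "pderiv p = a * pderiv (a * g) + (a * g) * pderiv a" by (simp only: pderiv_mult)
      hence "poly (pderiv p) w = 0" by (simp add: a_def del: mult_pCons_left)
      thus False using \<open>poly (pderiv p) w \<noteq> 0\<close> by simp
    qed
  qed
  show fin: "finite {w :: 'a. w ^ m = 1}" using poly_roots_finite[OF p0] roots by simp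
  have "degree p = (\<Sum>a\<in>{w. w ^ m = 1}. order a p)"
    using p0 fin roots by (intro degree_eq_sum_order) auto
  thus "card {w :: 'a. w ^ m = 1} = m" using simple dp by simp
qed

lemma sum_roots_of_unity_power:
  assumes m: "of_nat m \<noteq> (0 :: 'a::alg_closed_field)"
  shows "(\<Sum>w\<in>{w :: 'a. w ^ m = 1}. w ^ k) = (if m dvd k then of_nat m else 0)"
proof (cases "m dvd k")
  case True
  then obtain c where k: "k = m * c" by (elim dvdE)
  have "(\<Sum>w\<in>{w :: 'a. w ^ m = 1}. w ^ k) = (\<Sum>w\<in>{w :: 'a. w ^ m = 1}. 1)"
    by (intro sum.cong) (auto simp: k power_mult)
  thus ?thesis using True card_roots_of_unity[OF m] by simp
next
  case False
  have m0: "m > 0" using m by (cases m) auto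
  define l where "l = k mod m"
  have l: "0 < l" "l < m" using False m0 by (auto simp: l_def dvd_eq_mod_eq_0)
  have kl: "w ^ k = w ^ l" if "w ^ m = 1" for w :: 'a
    using that by (metis l_def mod_mult_div_eq mult_1_right power_add power_mult power_one)
  \<comment> \<open>Otherwise X^l - 1 with 0 < l < m would have m roots. Multiplication by an
    exceptional \<open>v\<close> permutes the roots of unity and multiplies the sum by
    \<open>v ^ l\<close>, which is not 1, so the sum vanishes.\<close>
  have "\<exists>w :: 'a. w ^ m = 1 \<and> w ^ l \<noteq> 1"
  proof (rule ccontr)
    assume "\<nexists>w :: 'a. w ^ m = 1 \<and> w ^ l \<noteq> 1"
    hence sub: "{w :: 'a. w ^ m = 1} \<subseteq> {w. poly (monom 1 l - 1) w = 0}" by (auto simp: poly_monom)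
    have d: "degree (monom 1 l - 1 :: 'a poly) = l" using l
      by (subst diff_conv_add_uminus, subst degree_add_eq_left) (auto simp: degree_monom_eq)
    hence n0: "(monom 1 l - 1 :: 'a poly) \<noteq> 0" using l by auto
    have "m \<le> card {w :: 'a. poly (monom 1 l - 1) w = 0}"
      using card_mono[OF poly_roots_finite[OF n0] sub] card_roots_of_unity[OF m] by simp
    also have "\<dots> \<le> l" using card_poly_roots_bound[OF n0] d by simp
    finally show False using l by simp
  qed
  then obtain v :: 'a where v: "v ^ m = 1" "v ^ l \<noteq> 1" by blast
  hence v0: "v \<noteq> 0" using m0 by (auto simp: power_0_left)
  define s where "s = (\<Sum>w\<in>{w :: 'a. w ^ m = 1}. w ^ l)"
  have "bij_betw ((*) v) {w :: 'a. w ^ m = 1} {w. w ^ m = 1}"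
    by (rule bij_betw_byWitness[of _ "\<lambda>w. w / v"]) (use v v0 in \<open>auto simp: power_mult_distrib power_divide\<close>)
  hence "s = (\<Sum>w\<in>{w :: 'a. w ^ m = 1}. (v * w) ^ l)"
    unfolding s_def by (rule sum.reindex_bij_betw[symmetric])
  also have "\<dots> = v ^ l * s" by (simp add: s_def power_mult_distrib sum_distrib_left)
  finally have "s * (v ^ l - 1) = 0" by (simp add: algebra_simps)
  hence "s = 0" using v by simp
  moreover have "(\<Sum>w\<in>{w :: 'a. w ^ m = 1}. w ^ k) = s" unfolding s_def using kl by (intro sum.cong) auto
  ultimately show ?thesis using False by simp
qed

lemma ring_map_to_ac: "ring_map to_ac"
  by unfold_locales auto

lemma map_poly_pderiv:
  assumes "ring_map h" shows "map_poly h (pderiv p) = pderiv (map_poly h p)"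
proof -
  interpret h: ring_map h by fact
  show ?thesis by (auto intro!: poly_eqI simp: coeff_map_poly coeff_pderiv)
qed

text \<open>A double root would be a root of the images of both \<open>f\<close> and
  \<open>pderiv f\<close>, hence of the image of their Bezout identity.\<close>

lemma order_separable_le_1:
  fixes h :: "'a::field \<Rightarrow> 'b::field"
  assumes h: "ring_map h" and f: "coprime f (pderiv f)"
  shows "order a (map_poly h f) \<le> 1"
proof (rule ccontr)
  interpret H: ring_map "map_poly h" by (rule ring_map_map_poly) fact
  assume "\<not> order a (map_poly h f) \<le> 1"
  hence "[:-a, 1:] ^ 2 dvd map_poly h f" by (simp add: order_divides)
  then obtain g where g: "map_poly h f = [:-a, 1:] ^ 2 * g" by (elim dvdE)
  define l where "l = [:-a, 1:]"
  have hf: "map_poly h f = l * (l * g)" using g by (simp only: l_def power2_eq_square mult.assoc)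
  have "map_poly h (pderiv f) = l * pderiv (l * g) + (l * g) * pderiv l"
    unfolding map_poly_pderiv[OF h] hf by (simp only: pderiv_mult)
  hence d: "l dvd map_poly h f" "l dvd map_poly h (pderiv f)"
    using hf by (auto simp: mult.assoc)
  obtain u v where "u * f + v * pderiv f = 1" using coprime_imp_bezout_field_poly[OF f] by blast
  from arg_cong[OF this, of "map_poly h"]
  have "map_poly h u * map_poly h f + map_poly h v * map_poly h (pderiv f) = 1" by simp
  hence "l dvd 1" using d by (metis dvd_add dvd_mult)
  thus False by (simp add: l_def is_unit_pCons_iff)
qed

text \<open>The degree of the rational function \<open>P / D\<close> is the total of its orders at
  the finite points of the closure, and those outside \<open>A\<close> are nonnegative. This takes
  the place of the degree formula for principal divisors on the line.\<close>

lemma degree_diff_ge_order_diff: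
  fixes P D :: "'a::field poly"
  assumes "P \<noteq> 0" "D \<noteq> 0" "finite A"
    and "\<And>\<alpha>. \<alpha> \<notin> to_ac ` A \<Longrightarrow> order \<alpha> (map_poly to_ac D) \<le> order \<alpha> (map_poly to_ac P)"
  shows "int (degree P) - int (degree D) \<ge> (\<Sum>a\<in>A. int (order a P) - int (order a D))"
proof -
  have h: "ring_map (to_ac :: 'a \<Rightarrow> 'a alg_closure)" by unfold_locales auto
  define P' D' where "P' = map_poly to_ac P" and "D' = map_poly to_ac D"
  have nz: "P' \<noteq> 0" "D' \<noteq> 0" using assms by (auto simp: P'_def D'_def map_poly_eq_0_iff)
  define S where "S = {a. poly P' a = 0} \<union> {a. poly D' a = 0} \<union> to_ac ` A"
  have S: "finite S" using nz poly_roots_finite assms(3) by (auto simp: S_def)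
  have sub: "{a. poly P' a = 0} \<subseteq> S" "{a. poly D' a = 0} \<subseteq> S" by (auto simp: S_def)
  have deg: "degree P' = degree P" "degree D' = degree D"
    using assms by (auto simp: P'_def D'_def degree_map_poly)
  have "int (degree P') - int (degree D') = (\<Sum>a\<in>S. int (order a P') - int (order a D'))"
    using degree_eq_sum_order[OF nz(1) S sub(1)] degree_eq_sum_order[OF nz(2) S sub(2)]
    by (simp add: sum_subtractf)
  also have "\<dots> \<ge> (\<Sum>a\<in>to_ac ` A. int (order a P') - int (order a D'))"
    using S assms(4) by (intro sum_mono2) (auto simp: S_def P'_def D'_def)
  also have "(\<Sum>a\<in>to_ac ` A. int (order a P') - int (order a D')) =
      (\<Sum>a\<in>A. int (order (to_ac a) P') - int (order (to_ac a) D'))"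
    by (subst sum.reindex) (auto simp: inj_on_def)
  also have "\<dots> = (\<Sum>a\<in>A. int (order a P) - int (order a D))"
    using assms order_map_poly[OF h] by (simp add: P'_def D'_def)
  finally show ?thesis by (simp add: deg)
qed

section \<open>Laurent series around a point\<close>

lemma power_add_second_order:
  fixes g e :: "'a::comm_ring_1"
  shows "\<exists>k. (g + e) ^ m = g ^ m + of_nat m * g ^ (m - 1) * e + e ^ 2 * k"
proof (induction m)
  case (Suc m)
  then obtain k where k: "(g + e) ^ m = g ^ m + of_nat m * g ^ (m - 1) * e + e ^ 2 * k" by blast
  have g: "of_nat m * g ^ (m - 1) * g = of_nat m * g ^ m" by (cases m) auto
  have "(g + e) ^ Suc m = (g + e) * (g ^ m + of_nat m * g ^ (m - 1) * e + e ^ 2 * k)"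
    by (simp add: k)
  also have "\<dots> = g ^ Suc m + (of_nat m * g ^ (m - 1) * g) * e + g ^ m * e +
      e ^ 2 * (of_nat m * g ^ (m - 1) + (g + e) * k)"
    by (simp add: algebra_simps power2_eq_square)
  also have "\<dots> = g ^ Suc m + of_nat (Suc m) * g ^ (Suc m - 1) * e +
      e ^ 2 * (of_nat m * g ^ (m - 1) + (g + e) * k)"
    unfolding g by (simp add: algebra_simps)
  finally show ?case by blast
qed (auto intro: exI[of _ 0])

lemma fps_power_nth_cong:
  assumes "\<And>i. i \<le> n \<Longrightarrow> fps_nth a i = fps_nth b i" "j \<le> n"
  shows "fps_nth (a ^ m) j = fps_nth (b ^ m) j"
  using assms(2)
proof (induction m arbitrary: j)
  case (Suc m)
  thus ?case using assms(1) by (auto simp: fps_mult_nth intro!: sum.cong)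
qed simp

lemma fps_mth_root_exists:
  fixes h :: "'a::alg_closed_field fps"
  assumes m: "of_nat m \<noteq> (0 :: 'a)" and h: "fps_nth h 0 \<noteq> 0"
  shows "\<exists>g. g ^ m = h"
proof -
  have m0: "m > 0" using m by (cases m) auto
  obtain g0 where g0: "g0 ^ m = fps_nth h 0" using nth_root_exists[OF m0] by blast
  hence g00: "g0 \<noteq> 0" using h m0 by (auto simp: power_0_left)
  define P where "P = (\<lambda>n g. fps_nth g 0 = g0 \<and> (\<forall>i\<le>n. fps_nth (g ^ m) i = fps_nth h i))"
  define Q where "Q = (\<lambda>n g g'. \<forall>i\<le>n. fps_nth g' i = fps_nth (g :: 'a fps) i)"
  have "\<exists>G. \<forall>n. P n (G n) \<and> Q n (G n) (G (Suc n))"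
  proof (rule dependent_nat_choice)
    show "\<exists>g. P 0 g"
      using g0 by (intro exI[of _ "fps_const g0"]) (simp add: P_def fps_const_power)
  next
    fix g n assume g: "P n g"
    \<comment> \<open>The linear term \<open>of_nat m * g0 ^ (m - 1) * c\<close> has to supply what
      is missing in coefficient \<open>Suc n\<close>, which is possible because
      \<open>of_nat m\<close> and \<open>g0\<close> are nonzero. The quadratic term starts only in
      degree \<open>2 * Suc n\<close>.\<close>
    define c where "c = (fps_nth h (Suc n) - fps_nth (g ^ m) (Suc n)) / (of_nat m * g0 ^ (m - 1))"
    define e where "e = fps_const c * fps_X ^ Suc n"
    obtain k where k: "(g + e) ^ m = g ^ m + of_nat m * g ^ (m - 1) * e + e ^ 2 * k"
      using power_add_second_order by blast
    have e2: "fps_nth (e ^ 2 * k) i = 0" if "i \<le> Suc n" for i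
    proof -
      have *: "e ^ 2 * k = fps_X ^ (Suc n + Suc n) * (fps_const (c * c) * k)"
        by (simp add: e_def power2_eq_square power_add algebra_simps)
      show ?thesis using that unfolding * fps_X_power_mult_nth by simp
    qed
    have e1: "fps_nth (of_nat m * g ^ (m - 1) * e) i = (if i \<le> n then 0 else of_nat m * g0 ^ (m - 1) * c)"
      if "i \<le> Suc n" for i
    proof -
      have *: "of_nat m * g ^ (m - 1) * e = fps_X ^ Suc n * (fps_const (of_nat m * c) * g ^ (m - 1))"
        by (simp add: e_def fps_of_nat algebra_simps del: power_Suc flip: fps_const_mult)
      show ?thesis
      proof (cases "i \<le> n")
        case False
        hence "i = Suc n" using that by simp
        thus ?thesis using g unfolding *
          by (simp add: fps_X_power_mult_nth fps_nth_power_0 P_def del: power_Suc)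
      next
        case True
        thus ?thesis unfolding * fps_X_power_mult_nth by simp
      qed
    qed
    have "fps_nth ((g + e) ^ m) i = fps_nth h i" if "i \<le> Suc n" for i
    proof (cases "i \<le> n")
      case True
      thus ?thesis using g e1[OF that] e2[OF that] by (simp add: k P_def)
    next
      case False
      hence "i = Suc n" using that by simp
      moreover have "of_nat m * g0 ^ (m - 1) * c = fps_nth h (Suc n) - fps_nth (g ^ m) (Suc n)"
        using m g00 by (simp add: c_def)
      ultimately show ?thesis using e1[OF that] e2[OF that] by (simp add: k)
    qed
    moreover have ge: "fps_nth (g + e) i = fps_nth g i" if "i \<le> n" for i
      using that by (simp add: e_def fps_X_power_mult_right_nth del: power_Suc)
    ultimately have "P (Suc n) (g + e)" "Q n g (g + e)"
      using g by (auto simp: P_def Q_def)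
    thus "\<exists>g'. P (Suc n) g' \<and> Q n g g'" by blast
  qed
  then obtain G where G: "\<And>n. P n (G n)" "\<And>n. Q n (G n) (G (Suc n))" by blast
  \<comment> \<open>Coefficient \<open>i\<close> no longer changes from \<open>G i\<close> on, so
    the diagonal is the limit of the approximations.\<close>
  define g where "g = Abs_fps (\<lambda>i. fps_nth (G i) i)"
  have Gd: "fps_nth (G (i + d)) i = fps_nth (G i) i" for i d
    by (induction d) (use G(2) in \<open>auto simp: Q_def\<close>)
  have gG: "fps_nth g i = fps_nth (G n) i" if "i \<le> n" for i n
    using that Gd[of i "n - i"] by (simp add: g_def)
  have "fps_nth (g ^ m) n = fps_nth h n" for n
    using fps_power_nth_cong[of n g "G n" n m] gG G(1)[of n] by (simp add: P_def)
  thus ?thesis by (auto intro!: exI[of _ g] fps_ext)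
qed

lemma ring_map_fls_const: "ring_map fls_const"
  by unfold_locales (simp_all add: fls_plus_const fls_const_mult_const)

lemma ring_map_fps_const: "ring_map fps_const"
  by unfold_locales simp_all

lemma ring_map_fps_to_fls: "ring_map fps_to_fls"
  by unfold_locales (simp_all add: fls_times_fps_to_fls)

lemma ring_map_fps_nth_0: "ring_map (\<lambda>g. fps_nth g 0)"
  by unfold_locales simp_all

text \<open>At a root of \<open>f\<close> this is the genuine ramified parametrisation. At other
  points it is more ramified than necessary, which is harmless and saves a case distinction.\<close>

definition branch_point :: "nat \<Rightarrow> 'a::field \<Rightarrow> 'a fls" where
  "branch_point m a = fls_const a + fls_X ^ m"

lemma eval_branch_point_fps:
  assumes "m > 0"
  obtains g where "eval_hom fls_const (branch_point m a) p = fps_to_fls g" "fps_nth g 0 = poly p a"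
proof
  define g where "g = eval_hom fps_const (fps_const a + fps_X ^ m) p"
  have X: "fps_to_fls (fps_const a + fps_X ^ m) = branch_point m a"
    by (simp add: branch_point_def fps_to_fls_power)
  have "fps_to_fls g = eval_hom (\<lambda>c. fps_to_fls (fps_const c)) (branch_point m a) p"
    unfolding g_def ring_map_eval_hom_commute[OF ring_map_fps_to_fls ring_map_fps_const] X ..
  thus "eval_hom fls_const (branch_point m a) p = fps_to_fls g" by simp
  show "fps_nth g 0 = poly p a"
    unfolding g_def ring_map_eval_hom_commute[OF ring_map_fps_nth_0 ring_map_fps_const]
    using assms by (simp add: fps_X_power_iff)
qed

lemma eval_branch_point_unit:
  assumes "m > 0" "poly p a \<noteq> 0"
  shows "eval_hom fls_const (branch_point m a) p \<noteq> 0"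
    "fls_subdegree (eval_hom fls_const (branch_point m a) p) = 0"
proof -
  obtain g where g: "eval_hom fls_const (branch_point m a) p = fps_to_fls g" "fps_nth g 0 = poly p a"
    using eval_branch_point_fps[OF assms(1)] .
  have "g \<noteq> 0" using g assms by auto
  thus "eval_hom fls_const (branch_point m a) p \<noteq> 0" using g by simp
  show "fls_subdegree (eval_hom fls_const (branch_point m a) p) = 0"
    using g assms by (simp add: fls_subdegree_fls_to_fps subdegree_eq_0)
qed

lemma eval_branch_point_linear_power:
  "eval_hom fls_const (branch_point m a) ([:-a, 1:] ^ k * q) =
     (fls_X ^ m) ^ k * eval_hom fls_const (branch_point m a) q"
proof -
  interpret c: ring_map fls_const by (rule ring_map_fls_const)
  interpret e: ring_map "eval_hom fls_const (branch_point m a)" by (rule c.ring_map_eval_hom)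
  have "eval_hom fls_const (branch_point m a) [:-a, 1:] = fls_X ^ m"
    by (simp add: branch_point_def)
  thus ?thesis by (simp only: e.map_mult e.map_power)
qed

lemma eval_branch_point:
  assumes "m > 0" "p \<noteq> 0"
  shows "eval_hom fls_const (branch_point m a) p \<noteq> 0"
    "fls_subdegree (eval_hom fls_const (branch_point m a) p) = int m * int (order a p)"
proof -
  obtain q where q: "p = [:-a, 1:] ^ order a p * q" "\<not> [:-a, 1:] dvd q"
    using order_decomp[OF assms(2)] by blast
  have qa: "poly q a \<noteq> 0" using q by (simp add: poly_eq_0_iff_dvd)
  have e: "eval_hom fls_const (branch_point m a) p =
     (fls_X ^ m) ^ order a p * eval_hom fls_const (branch_point m a) q"
    by (subst q(1)) (rule eval_branch_point_linear_power)
  show "eval_hom fls_const (branch_point m a) p \<noteq> 0"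
    using eval_branch_point_unit(1)[OF assms(1) qa] by (simp add: e)
  show "fls_subdegree (eval_hom fls_const (branch_point m a) p) = int m * int (order a p)"
    using eval_branch_point_unit[OF assms(1) qa] by (simp add: e fls_subdegree_pow)
qed

text \<open>Substituting a + t^m turns \<open>f\<close> into t^(m k) times a unit series, where k is
  \<open>order a f\<close>. The first factor is the m-th power of t^k, and the unit has an m-th
  root.\<close>

lemma branch_root_exists:
  fixes f :: "'a::alg_closed_field poly"
  assumes m: "of_nat m \<noteq> (0 :: 'a)" and f: "f \<noteq> 0"
  shows "\<exists>\<eta>. \<eta> \<noteq> 0 \<and> \<eta> ^ m = eval_hom fls_const (branch_point m a) f \<and> fls_subdegree \<eta> = int (order a f)"
proof -
  have m0: "m > 0" using m by (cases m) auto
  obtain q where q: "f = [:-a, 1:] ^ order a f * q" "\<not> [:-a, 1:] dvd q"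
    using order_decomp[OF f] by blast
  have qa: "poly q a \<noteq> 0" using q by (simp add: poly_eq_0_iff_dvd)
  obtain h where h: "eval_hom fls_const (branch_point m a) q = fps_to_fls h" "fps_nth h 0 = poly q a"
    using eval_branch_point_fps[OF m0] .
  obtain g where g: "g ^ m = h" using fps_mth_root_exists[OF m] h(2) qa by metis
  define \<eta> where "\<eta> = fls_X ^ order a f * fps_to_fls g"
  have "\<eta> ^ m = (fls_X ^ m) ^ order a f * fps_to_fls h"
    by (simp add: \<eta>_def power_mult_distrib g flip: fps_to_fls_power power_mult)
       (simp add: mult.commute)
  also have "\<dots> = eval_hom fls_const (branch_point m a) f"
    unfolding h(1)[symmetric] eval_branch_point_linear_power[symmetric] using q(1) by simp
  finally have 1: "\<eta> ^ m = eval_hom fls_const (branch_point m a) f" .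
  hence n0: "\<eta> \<noteq> 0" using eval_branch_point(1)[OF m0 f, of a] m0 by (auto simp: power_0_left)
  have "int m * fls_subdegree \<eta> = int m * int (order a f)"
    using eval_branch_point(2)[OF m0 f, of a] unfolding 1[symmetric] by (simp add: fls_subdegree_pow)
  hence "fls_subdegree \<eta> = int (order a f)" using m0 by simp
  thus ?thesis using 1 n0 by blast
qed

lemma fls_subdegree_nonneg_sum:
  fixes g :: "'i \<Rightarrow> 'a::field fls"
  assumes "\<And>i. i \<in> I \<Longrightarrow> fls_subdegree (g i) \<ge> 0"
  shows "fls_subdegree (\<Sum>i\<in>I. fls_const (c i) * g i) \<ge> 0"
proof (rule fls_subdegree_ge0I)
  fix k :: int assume "k < 0"
  hence "fls_nth (fls_const (c i) * g i) k = 0" if "i \<in> I" for i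
    using fls_eq0_below_subdegree[of k "g i"] assms[OF that] by simp
  thus "fls_nth (\<Sum>i\<in>I. fls_const (c i) * g i) k = 0"
    by (induction I rule: infinite_finite_induct) auto
qed

section \<open>Places\<close>

text \<open>A place takes the junk value 0 at 0, hence the separate case.\<close>
definition val_ge :: "('a::field \<Rightarrow> int) \<Rightarrow> int \<Rightarrow> 'a \<Rightarrow> bool" where
  "val_ge v n z \<longleftrightarrow> z = 0 \<or> n \<le> v z"

context
  fixes K :: "'a::field set" and v :: "'a \<Rightarrow> int"
  assumes v: "is_place K v"
begin

lemma place_mult: "a \<noteq> 0 \<Longrightarrow> b \<noteq> 0 \<Longrightarrow> v (a * b) = v a + v b"
  using v by (simp add: is_place_def)

lemma place_add: "a \<noteq> 0 \<Longrightarrow> b \<noteq> 0 \<Longrightarrow> a + b \<noteq> 0 \<Longrightarrow> v (a + b) \<ge> min (v a) (v b)"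
  using v by (simp add: is_place_def)

lemma place_const: "c \<in> K \<Longrightarrow> c \<noteq> 0 \<Longrightarrow> v c = 0"
  using v by (simp add: is_place_def)

lemma place_0: "v 0 = 0"
  using v by (simp add: is_place_def)

lemma place_1: "v 1 = 0"
  using place_mult[of 1 1] by simp

lemma place_power: "a \<noteq> 0 \<Longrightarrow> v (a ^ n) = int n * v a"
  by (induction n) (simp_all add: place_1 place_mult algebra_simps)

lemma place_uminus: "v (- a) = v a"
proof (cases "a = 0")
  case False
  have "v (- 1) + v (- 1) = 0" using place_mult[of "- 1" "- 1"] place_1 by simp
  hence "v (- 1) = 0" by simp
  thus ?thesis using place_mult[of "- 1" a] False by simp
qed simp

lemma place_inverse: "a \<noteq> 0 \<Longrightarrow> v (inverse a) = - v a"
  using place_mult[of a "inverse a"] place_1 by simp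

lemma place_power_int: "a \<noteq> 0 \<Longrightarrow> v (a powi n) = n * v a"
  by (simp add: power_int_def place_power place_inverse)

lemma val_ge_0: "val_ge v n 0"
  by (simp add: val_ge_def)

lemma val_ge_add: "val_ge v n a \<Longrightarrow> val_ge v n b \<Longrightarrow> val_ge v n (a + b)"
  using place_add[of a b] unfolding val_ge_def
  by (cases "a = 0"; cases "b = 0"; cases "a + b = 0") auto

lemma val_ge_uminus: "val_ge v n a \<Longrightarrow> val_ge v n (- a)"
  by (simp add: val_ge_def place_uminus)

lemma val_ge_diff: "val_ge v n a \<Longrightarrow> val_ge v n b \<Longrightarrow> val_ge v n (a - b)"
  using val_ge_add[of n a "- b"] val_ge_uminus[of n b] by simp

lemma val_ge_mult: "val_ge v n a \<Longrightarrow> val_ge v n' b \<Longrightarrow> val_ge v (n + n') (a * b)"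
  using place_mult[of a b] by (cases "a = 0"; cases "b = 0") (auto simp: val_ge_def)

lemma val_ge_const: "c \<in> K \<Longrightarrow> val_ge v 0 c"
  using place_const[of c] by (cases "c = 0") (auto simp: val_ge_def)

lemma val_ge_const_pos: "c \<in> K \<Longrightarrow> val_ge v 1 c \<Longrightarrow> c = 0"
  using place_const[of c] by (cases "c = 0") (auto simp: val_ge_def)

lemma val_ge_mono: "val_ge v n a \<Longrightarrow> n' \<le> n \<Longrightarrow> val_ge v n' a"
  by (auto simp: val_ge_def)

lemma is_subring_valuation_ring: "is_subring {z. val_ge v 0 z}"
  using val_ge_add[of 0] val_ge_mult[of 0 _ 0] val_ge_uminus[of 0]
  by (auto simp: is_subring_def val_ge_0) (simp add: val_ge_def place_1)

lemma place_add_eq: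
  assumes "a \<noteq> 0" "val_ge v (v a + 1) b"
  shows "a + b \<noteq> 0" "v (a + b) = v a"
proof -
  show nz: "a + b \<noteq> 0"
  proof
    assume "a + b = 0"
    hence "b = - a" by (simp add: eq_neg_iff_add_eq_0 add.commute)
    thus False using assms by (simp add: val_ge_def place_uminus)
  qed
  have "val_ge v (v a) (a + b)"
    using assms by (intro val_ge_add) (auto simp: val_ge_def)
  moreover have "\<not> val_ge v (v a + 1) (a + b)"
  proof
    assume "val_ge v (v a + 1) (a + b)"
    from val_ge_diff[OF this assms(2)] show False using assms(1) by (simp add: val_ge_def)
  qed
  ultimately show "v (a + b) = v a" using nz by (simp add: val_ge_def)
qed

lemma place_sum_distinct:
  assumes "finite S" "S \<noteq> {}" "\<And>i. i \<in> S \<Longrightarrow> t i \<noteq> 0" "inj_on (\<lambda>i. v (t i)) S"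
  shows "sum t S \<noteq> 0 \<and> (\<forall>i\<in>S. v (sum t S) \<le> v (t i)) \<and> (\<exists>i\<in>S. v (sum t S) = v (t i))"
  using assms
proof (induction S rule: finite_ne_induct)
  case (insert j S)
  have IH: "sum t S \<noteq> 0" "\<And>i. i \<in> S \<Longrightarrow> v (sum t S) \<le> v (t i)" "\<exists>i\<in>S. v (sum t S) = v (t i)"
    using insert.IH insert.prems by (auto simp: inj_on_insert)
  have ne: "v (t j) \<noteq> v (t i)" if "i \<in> S" for i
    using insert.prems(2) insert.hyps(3) that unfolding inj_on_def by blast
  have eq: "sum t (insert j S) = t j + sum t S" using insert.hyps by simp
  have tj: "t j \<noteq> 0" using insert.prems by simp
  obtain i where i: "i \<in> S" "v (sum t S) = v (t i)" using IH by blast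
  consider "v (t j) < v (sum t S)" | "v (sum t S) < v (t j)" using ne[OF i(1)] i(2) by linarith
  thus ?case
  proof cases
    case 1
    have "t j + sum t S \<noteq> 0" "v (t j + sum t S) = v (t j)"
      using place_add_eq[of "t j" "sum t S"] 1 tj by (auto simp: val_ge_def)
    moreover have "v (t j) \<le> v (t i)" if "i \<in> S" for i using IH(2)[OF that] 1 by simp
    ultimately show ?thesis unfolding eq by auto
  next
    case 2
    have "t j + sum t S \<noteq> 0" "v (t j + sum t S) = v (sum t S)"
      using place_add_eq[of "sum t S" "t j"] 2 IH(1) by (auto simp: val_ge_def add.commute)
    thus ?thesis unfolding eq using IH(2) i 2 by auto
  qed
qed simp

lemma place_poly_residue:
  assumes K: "is_subring K" and p: "p \<in> polys_over K" and a: "a \<in> K" and t: "val_ge v 1 (t - a)"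
  shows "val_ge v 1 (poly p t - poly p a)"
  using p
proof (induction p)
  case (pCons c q)
  have q: "q \<in> polys_over K" "poly q a \<in> K"
    using pCons.prems K a by (auto simp: polys_over_pCons poly_in_subring)
  have t0: "val_ge v 0 t"
    using val_ge_add[OF val_ge_mono[OF t, of 0] val_ge_const[OF a]] by simp
  have "poly (pCons c q) t - poly (pCons c q) a = t * (poly q t - poly q a) + (t - a) * poly q a"
    by (simp add: algebra_simps)
  moreover have "val_ge v 1 (t * (poly q t - poly q a))"
    using val_ge_mult[OF t0 pCons.IH[OF q(1)]] by simp
  moreover have "val_ge v 1 ((t - a) * poly q a)"
    using val_ge_mult[OF t val_ge_const[OF q(2)]] by simp
  ultimately show ?case using val_ge_add by simp
qed (simp add: val_ge_0)

lemma place_poly_unit: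
  assumes K: "is_subring K" and p: "p \<in> polys_over K" and a: "a \<in> K" and t: "val_ge v 1 (t - a)"
    and pa: "poly p a \<noteq> 0"
  shows "poly p t \<noteq> 0" "v (poly p t) = 0"
proof -
  have c: "v (poly p a) = 0" using place_const poly_in_subring[OF K p a] pa by simp
  show "poly p t \<noteq> 0" "v (poly p t) = 0"
    using place_add_eq[OF pa, of "poly p t - poly p a"] place_poly_residue[OF K p a t] c by auto
qed

lemma place_poly_order:
  assumes K: "is_subring K" and a: "a \<in> K" and t: "v (t - a) > 0" "t - a \<noteq> 0"
    and p: "p \<in> polys_over K" "p \<noteq> 0"
  shows "poly p t \<noteq> 0" "v (poly p t) = v (t - a) * int (order a p)"
proof -
  have t1: "val_ge v 1 (t - a)" using t by (simp add: val_ge_def)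
  have "poly p t \<noteq> 0 \<and> v (poly p t) = v (t - a) * int (order a p)"
    using p
  proof (induction "degree p" arbitrary: p rule: less_induct)
    case less
    show ?case
    proof (cases "poly p a = 0")
      case False
      thus ?thesis using place_poly_unit[OF K less.prems(1) a t1] by (simp add: order_0I)
    next
      case True
      define q where "q = synthetic_div p a"
      have pq: "p = [:-a, 1:] * q" using synthetic_div_correct'[of a p] True by (simp add: q_def)
      have q0: "q \<noteq> 0" using less.prems pq by auto
      have "degree q < degree p" using q0 by (subst pq, subst degree_mult_eq) auto
      moreover have "q \<in> polys_over K" unfolding q_def using synthetic_div_polys_over K less.prems a by blast
      ultimately have IH: "poly q t \<noteq> 0" "v (poly q t) = v (t - a) * int (order a q)"
        using less.hyps q0 by auto
      have "order a p = 1 + order a q"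
        using less.prems(2) unfolding pq by (subst order_mult) (use order_power_n_n[of a 1] in auto)
      moreover have pt: "poly p t = (t - a) * poly q t" unfolding pq by (simp add: algebra_simps)
      have "v (poly p t) = v (t - a) + v (poly q t)" unfolding pt using IH t(2) by (intro place_mult)
      moreover have "poly p t \<noteq> 0" unfolding pt using IH t(2) by simp
      ultimately show ?thesis using IH(2) by (simp add: algebra_simps)
    qed
  qed
  thus "poly p t \<noteq> 0" "v (poly p t) = v (t - a) * int (order a p)" by auto
qed

lemma place_poly_pole:
  assumes "v t < 0" and p: "p \<in> polys_over K" "p \<noteq> 0"
  shows "poly p t \<noteq> 0 \<and> v (poly p t) = v t * int (degree p)"
  using p
proof (induction p)
  case (pCons c q)
  have t0: "t \<noteq> 0" using assms(1) place_0 by auto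
  have c: "c \<in> K" "q \<in> polys_over K" using pCons.prems by (auto simp: polys_over_pCons)
  show ?case
  proof (cases "q = 0")
    case True
    thus ?thesis using pCons.prems c by (auto simp: place_const)
  next
    case False
    hence IH: "poly q t \<noteq> 0" "v (poly q t) = v t * int (degree q)" using pCons.IH c by auto
    have m: "t * poly q t \<noteq> 0" "v (t * poly q t) = v t * int (Suc (degree q))"
      using IH t0 by (auto simp: place_mult algebra_simps)
    have "v t * int (Suc (degree q)) < 0" using assms(1) by (intro mult_neg_pos) auto
    hence "val_ge v (v (t * poly q t) + 1) c" using m by (intro val_ge_mono[OF val_ge_const[OF c(1)]]) auto
    from place_add_eq[OF m(1) this] show ?thesis using m False by (simp add: add.commute)
  qed
qed simp

end

text \<open>The pulled-back values of nonzero elements form a subgroup of the integers, hence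
  consist of the multiples of the least positive one, \<open>d\<close>. Dividing by \<open>d\<close>
  gives the normalisation demanded of a place; \<open>z0\<close> excludes the trivial
  valuation.\<close>

lemma place_of_laurent_embedding:
  fixes \<phi> :: "'a::field \<Rightarrow> 'b::field fls"
  assumes \<phi>: "ring_map \<phi>" and K: "\<And>c. c \<in> K \<Longrightarrow> c \<noteq> 0 \<Longrightarrow> fls_subdegree (\<phi> c) = 0"
    and z0: "fls_subdegree (\<phi> z0) \<noteq> 0"
  obtains v d where "is_place K v" "d > 0" "\<And>z. fls_subdegree (\<phi> z) = d * v z"
proof -
  interpret ring_map \<phi> by fact
  define w where "w z = fls_subdegree (\<phi> z)" for z
  have nz: "\<phi> a = 0 \<longleftrightarrow> a = 0" for a by (rule ring_map_field_eq_0_iff[OF \<phi>])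
  have w0: "w 0 = 0" by (simp add: w_def)
  have w1: "w 1 = 0" by (simp add: w_def)
  have wm: "w (a * b) = w a + w b" if "a \<noteq> 0" "b \<noteq> 0" for a b
    using that nz by (simp add: w_def)
  have wa: "w (a + b) \<ge> min (w a) (w b)" if "a + b \<noteq> 0" for a b
    using that nz[of "a + b"] fls_plus_subdegree[of "\<phi> a" "\<phi> b"] by (simp add: w_def)
  have wi: "w (inverse a) = - w a" if "a \<noteq> 0" for a
    using wm[of a "inverse a"] that w1 by simp
  have z00: "z0 \<noteq> 0" using z0 w0 w_def by metis
  define P where "P = (\<lambda>n :: nat. n > 0 \<and> (\<exists>z. z \<noteq> 0 \<and> w z = int n))"
  have "P (nat \<bar>w z0\<bar>)"
  proof (cases "w z0 > 0")
    case True
    thus ?thesis unfolding P_def using z00 by (intro conjI exI[of _ z0]) auto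
  next
    case False
    thus ?thesis unfolding P_def using z00 z0 wi[OF z00]
      by (intro conjI exI[of _ "inverse z0"]) (auto simp: w_def)
  qed
  define d where "d = (LEAST n. P n)"
  have "P d" unfolding d_def by (rule LeastI) fact
  then obtain t where d: "d > 0" and t: "t \<noteq> 0" "w t = int d" by (auto simp: P_def)
  have least: "d \<le> n" if "P n" for n unfolding d_def using that by (rule Least_le)
  have tn: "w (t ^ n) = int n * int d" for n
    by (induction n) (use t w1 wm in \<open>auto simp: algebra_simps\<close>)
  have tk: "\<exists>s. s \<noteq> 0 \<and> w s = k * int d" for k
  proof (cases "k \<ge> 0")
    case True
    thus ?thesis using tn[of "nat k"] t by (intro exI[of _ "t ^ nat k"]) auto
  next
    case False
    thus ?thesis using tn[of "nat (- k)"] wi[of "t ^ nat (- k)"] t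
      by (intro exI[of _ "inverse (t ^ nat (- k))"]) auto
  qed
  have dvd: "int d dvd w z" if "z \<noteq> 0" for z
  proof -
    obtain s where s: "s \<noteq> 0" "w s = (- (w z div int d)) * int d" using tk by blast
    have zs: "w (z * s) = w z mod int d"
      using wm[OF that s(1)] s(2) by (simp add: minus_div_mult_eq_mod[symmetric])
    have rm: "0 \<le> w z mod int d" "w z mod int d < int d" using d by auto
    have "w z mod int d = 0"
    proof (rule ccontr)
      assume "w z mod int d \<noteq> 0"
      hence "P (nat (w z mod int d))"
        unfolding P_def using rm that s(1) zs by (intro conjI exI[of _ "z * s"]) auto
      from least[OF this] rm show False by linarith
    qed
    thus ?thesis by (simp add: dvd_eq_mod_eq_0)
  qed
  define v where "v z = w z div int d" for z
  have wv: "w z = int d * v z" for z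
    using dvd[of z] w0 by (cases "z = 0") (auto simp: v_def)
  have d': "int d > 0" using d by simp
  have "is_place K v"
    unfolding is_place_def
  proof (intro conjI allI impI ballI)
    show "v 0 = 0" by (simp add: v_def w0)
    fix a b :: 'a assume ab: "a \<noteq> 0" "b \<noteq> 0"
    show "v (a * b) = v a + v b"
      using wm[OF ab] d' by (simp add: wv flip: distrib_left)
    assume "a + b \<noteq> 0"
    hence "min (int d * v a) (int d * v b) \<le> int d * v (a + b)" using wa by (simp add: wv)
    thus "min (v a) (v b) \<le> v (a + b)" using d' by (simp add: min_le_iff_disj)
  next
    fix c assume "c \<in> K" "c \<noteq> 0"
    thus "v c = 0" using K[of c] by (simp add: v_def w_def)
  next
    show "\<exists>t. t \<noteq> 0 \<and> v t = 1" using t d by (intro exI[of _ t]) (simp add: v_def)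
  qed
  thus ?thesis using that d' wv w_def by metis
qed

text \<open>An index stands for a monomial with pole orders \<open>a i\<close> and
  \<open>b i\<close>. The last two assumptions say that for each function regular elsewhere, some
  monomial has the same order at one place and no larger pole at the other.\<close>

lemma weierstrass_semigroup2_iff:
  fixes a b :: "'i \<Rightarrow> int"
  assumes v: "is_place K v1" "is_place K v2"
    and ex: "\<And>i. i \<in> I \<Longrightarrow> \<exists>z. z \<noteq> 0 \<and> v1 z = - a i \<and> v2 z = - b i \<and>
        (\<forall>Q. is_place K Q \<and> Q \<noteq> v1 \<and> Q \<noteq> v2 \<longrightarrow> Q z \<ge> 0)"
    and least1: "\<And>z. z \<noteq> 0 \<Longrightarrow> \<forall>Q. is_place K Q \<and> Q \<noteq> v1 \<and> Q \<noteq> v2 \<longrightarrow> Q z \<ge> 0 \<Longrightarrow>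
        \<exists>i\<in>I. a i = - v1 z \<and> b i \<le> - v2 z"
    and least2: "\<And>z. z \<noteq> 0 \<Longrightarrow> \<forall>Q. is_place K Q \<and> Q \<noteq> v1 \<and> Q \<noteq> v2 \<longrightarrow> Q z \<ge> 0 \<Longrightarrow>
        \<exists>i\<in>I. b i = - v2 z \<and> a i \<le> - v1 z"
  shows "weierstrass_semigroup2 K v1 v2 = {(n1, n2).
      (n1 = 0 \<or> (\<exists>i\<in>I. a i = int n1 \<and> b i \<le> int n2)) \<and>
      (n2 = 0 \<or> (\<exists>i\<in>I. b i = int n2 \<and> a i \<le> int n1))}"
proof (intro equalityI subsetI)
  fix p assume "p \<in> weierstrass_semigroup2 K v1 v2"
  then obtain n1 n2 z where z: "p = (n1, n2)" "z \<noteq> 0" "int n1 = max 0 (- v1 z)" "int n2 = max 0 (- v2 z)"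
    "\<forall>Q. is_place K Q \<and> Q \<noteq> v1 \<and> Q \<noteq> v2 \<longrightarrow> Q z \<ge> 0"
    unfolding weierstrass_semigroup2_def by blast
  obtain i where i: "i \<in> I" "a i = - v1 z" "b i \<le> - v2 z" using least1[OF z(2,5)] by blast
  obtain j where j: "j \<in> I" "b j = - v2 z" "a j \<le> - v1 z" using least2[OF z(2,5)] by blast
  have "n1 = 0 \<or> (\<exists>i\<in>I. a i = int n1 \<and> b i \<le> int n2)"
  proof (cases "n1 = 0")
    case False
    hence "a i = int n1" "b i \<le> int n2" using z(3,4) i by auto
    thus ?thesis using i by blast
  qed simp
  moreover have "n2 = 0 \<or> (\<exists>i\<in>I. b i = int n2 \<and> a i \<le> int n1)"
  proof (cases "n2 = 0")
    case False
    hence "b j = int n2" "a j \<le> int n1" using z(3,4) j by auto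
    thus ?thesis using j by blast
  qed simp
  ultimately show "p \<in> {(n1, n2).
      (n1 = 0 \<or> (\<exists>i\<in>I. a i = int n1 \<and> b i \<le> int n2)) \<and>
      (n2 = 0 \<or> (\<exists>i\<in>I. b i = int n2 \<and> a i \<le> int n1))}" using z(1) by simp
next
  fix p assume "p \<in> {(n1, n2).
      (n1 = 0 \<or> (\<exists>i\<in>I. a i = int n1 \<and> b i \<le> int n2)) \<and>
      (n2 = 0 \<or> (\<exists>i\<in>I. b i = int n2 \<and> a i \<le> int n1))}"
  then obtain n1 n2 where p: "p = (n1, n2)"
    and n1: "n1 = 0 \<or> (\<exists>i\<in>I. a i = int n1 \<and> b i \<le> int n2)"
    and n2: "n2 = 0 \<or> (\<exists>i\<in>I. b i = int n2 \<and> a i \<le> int n1)" by blast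
  have W: "p \<in> weierstrass_semigroup2 K v1 v2"
    if "z \<noteq> 0" "int n1 = max 0 (- v1 z)" "int n2 = max 0 (- v2 z)"
      "\<forall>Q. is_place K Q \<and> Q \<noteq> v1 \<and> Q \<noteq> v2 \<longrightarrow> Q z \<ge> 0" for z
    unfolding weierstrass_semigroup2_def p using that by blast
  have Wi: "p \<in> weierstrass_semigroup2 K v1 v2"
    if i: "i \<in> I" "int n1 = max 0 (a i)" "int n2 = max 0 (b i)" for i
  proof -
    obtain z where "z \<noteq> 0" "v1 z = - a i" "v2 z = - b i"
      "\<forall>Q. is_place K Q \<and> Q \<noteq> v1 \<and> Q \<noteq> v2 \<longrightarrow> Q z \<ge> 0" using ex[OF i(1)] by blast
    thus ?thesis using W[of z] i by simp
  qed
  show "p \<in> weierstrass_semigroup2 K v1 v2"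
  proof (cases "n1 = 0 \<or> n2 = 0")
    case True
    consider "n1 = 0" "n2 = 0" | "n1 = 0" "n2 \<noteq> 0" | "n1 \<noteq> 0" "n2 = 0" using True by blast
    thus ?thesis
    proof cases
      case 1
      thus ?thesis using W[of 1] place_1 v by fastforce
    next
      case 2
      then obtain i where "i \<in> I" "b i = int n2" "a i \<le> 0" using n2 by auto
      thus ?thesis using Wi[of i] 2 by simp
    next
      case 3
      then obtain i where "i \<in> I" "a i = int n1" "b i \<le> 0" using n1 by auto
      thus ?thesis using Wi[of i] 3 by simp
    qed
  next
    case False
    obtain i where i: "i \<in> I" "a i = int n1" "b i \<le> int n2" using n1 False by auto
    obtain j where j: "j \<in> I" "b j = int n2" "a j \<le> int n1" using n2 False by auto
    consider "b i = int n2" | "a j = int n1" | "b i < int n2" "a j < int n1" using i j by linarith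
    thus ?thesis
    proof cases
      \<comment> \<open>Each of the two functions has the required pole at one place and a strictly
        smaller pole order at the other, so in their sum neither pole is cancelled or
        enlarged.\<close>
      case 3
      obtain z where z: "z \<noteq> 0" "v1 z = - a i" "v2 z = - b i"
        "\<forall>Q. is_place K Q \<and> Q \<noteq> v1 \<and> Q \<noteq> v2 \<longrightarrow> Q z \<ge> 0" using ex[OF i(1)] by blast
      obtain w where w: "w \<noteq> 0" "v1 w = - a j" "v2 w = - b j"
        "\<forall>Q. is_place K Q \<and> Q \<noteq> v1 \<and> Q \<noteq> v2 \<longrightarrow> Q w \<ge> 0" using ex[OF j(1)] by blast
      have zw: "z + w \<noteq> 0" "v1 (z + w) = v1 z"
        using place_add_eq[OF v(1) z(1), of w] z w i j 3 by (auto simp: val_ge_def)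
      have "v2 (w + z) = v2 w"
        using place_add_eq(2)[OF v(2) w(1), of z] z w i j 3 by (auto simp: val_ge_def)
      moreover have "Q (z + w) \<ge> 0" if "is_place K Q" "Q \<noteq> v1" "Q \<noteq> v2" for Q
      proof -
        have "val_ge Q 0 z" "val_ge Q 0 w" using z w that by (auto simp: val_ge_def)
        from val_ge_add[OF that(1) this] show ?thesis using zw by (simp add: val_ge_def)
      qed
      ultimately show ?thesis using W[of "z + w"] zw z w i j by (simp add: add.commute)
    qed (use Wi[of i] Wi[of j] i j in auto)
  qed
qed

lemma gaps2_count:
  fixes a b :: "'i \<Rightarrow> int" and e :: "nat \<times> nat \<times> nat \<Rightarrow> 'i"
  assumes W: "weierstrass_semigroup2 K v1 v2 = {(n1, n2).
      (n1 = 0 \<or> (\<exists>i\<in>I. a i = int n1 \<and> b i \<le> int n2)) \<and>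
      (n2 = 0 \<or> (\<exists>i\<in>I. b i = int n2 \<and> a i \<le> int n1))}"
    and inj: "inj_on a I" "inj_on b I"
    and surj: "\<And>n. n > 0 \<Longrightarrow> \<exists>i\<in>I. a i = n" "\<And>n. n > 0 \<Longrightarrow> \<exists>i\<in>I. b i = n"
    and T: "{i \<in> I. a i > 0 \<and> b i > 0} = e ` tri_index u r" "inj_on e (tri_index u r)"
    and ab: "\<And>t. t \<in> tri_index u r \<Longrightarrow> a (e t) = a' t" "\<And>t. t \<in> tri_index u r \<Longrightarrow> b (e t) = b' t"
  shows "finite (gaps2 K v1 v2)"
    and "int (card (gaps2 K v1 v2)) = (\<Sum>t\<in>tri_index u r. a' t + b' t) -
      int (card {(s, t) \<in> tri_index u r \<times> tri_index u r. b' t < b' s \<and> a' s < a' t})"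
proof -
  have fin: "finite {i \<in> I. a i > 0 \<and> b i > 0}" unfolding T by simp
  have G: "gaps2 K v1 v2 = {(n1, n2). \<not> ((n1 = 0 \<or> (\<exists>i\<in>I. a i = int n1 \<and> b i \<le> int n2)) \<and>
         (n2 = 0 \<or> (\<exists>i\<in>I. b i = int n2 \<and> a i \<le> int n1)))}"
    unfolding gaps2_def W by auto
  note gc = gap_count[OF inj surj fin, folded G]
  show "finite (gaps2 K v1 v2)" by (rule gc(1))
  have "{(s, t). s \<in> e ` tri_index u r \<and> t \<in> e ` tri_index u r \<and> b t < b s \<and> a s < a t} =
      map_prod e e ` {(s, t). s \<in> tri_index u r \<and> t \<in> tri_index u r \<and> b' t < b' s \<and> a' s < a' t}"
    using ab by (auto simp: image_iff split_beta)
  moreover have "inj_on (map_prod e e) {(s, t). s \<in> tri_index u r \<and> t \<in> tri_index u r \<and> b' t < b' s \<and> a' s < a' t}"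
    using T(2) by (auto simp: inj_on_def)
  ultimately have "card {(s, t). s \<in> e ` tri_index u r \<and> t \<in> e ` tri_index u r \<and> b t < b s \<and> a s < a t} =
      card {(s, t). s \<in> tri_index u r \<and> t \<in> tri_index u r \<and> b' t < b' s \<and> a' s < a' t}"
    by (simp add: card_image)
  moreover have "(\<Sum>i\<in>e ` tri_index u r. a i + b i) = (\<Sum>t\<in>tri_index u r. a' t + b' t)"
    by (subst sum.reindex[OF T(2)]) (simp add: ab)
  ultimately show "int (card (gaps2 K v1 v2)) = (\<Sum>t\<in>tri_index u r. a' t + b' t) -
      int (card {(s, t) \<in> tri_index u r \<times> tri_index u r. b' t < b' s \<and> a' s < a' t})"
    using gc(2) unfolding T(1) by simp
qed

text \<open>The count is carried out with the affine place first, whereas the theorem lists the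
  place at infinity first.\<close>

lemma gaps2_commute: "gaps2 K v2 v1 = prod.swap ` gaps2 K v1 v2"
proof -
  have "(n2, n1) \<in> weierstrass_semigroup2 K v2 v1 \<longleftrightarrow> (n1, n2) \<in> weierstrass_semigroup2 K v1 v2" for n1 n2
    unfolding weierstrass_semigroup2_def by auto
  thus ?thesis unfolding gaps2_def by auto
qed

section \<open>The function field\<close>

locale kummer_field =
  fixes K :: "'a::field set" and x y :: 'a and f :: "'a poly" and m r :: nat and Pinf :: "'a \<Rightarrow> int"
  assumes subfield: "is_subfield K"
    and char: "of_nat m \<noteq> (0::'a)"
    and m2: "m \<ge> 2"
    and f_over: "f \<in> polys_over K"
    and deg_f: "degree f = r"
    and separable: "coprime f (pderiv f)"
    and coprime_mr: "coprime m r"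
    and transcendental: "transcendental_over K x"
    and y_pow: "y ^ m = poly f x"
    and generated: "generated_field (K \<union> {x, y}) = UNIV"
    and Pinf: "is_place K Pinf" "Pinf x < 0"
begin

abbreviation KX :: "'a poly set" where "KX \<equiv> polys_over K"
abbreviation KXY :: "'a poly poly set" where "KXY \<equiv> polys_over KX"

definition ev :: "'a poly poly \<Rightarrow> 'a" where
  "ev N = eval_hom (\<lambda>p. poly p x) y N"

text \<open>Being monic in the outer variable, it permits reduction inside K[X][Y] without
  denominators.\<close>

definition kpoly :: "'a poly poly" where
  "kpoly = monom 1 m - [:f:]"

lemma subring_K: "is_subring K"
  by (rule is_subfield_imp_subring[OF subfield])

lemma subring_KX: "is_subring KX"
  by (rule is_subring_polys_over[OF subring_K])

lemma subring_KXY: "is_subring KXY"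
  by (rule is_subring_polys_over[OF subring_KX])

lemma ring_map_poly_x: "ring_map (\<lambda>p. poly p x)"
  by unfold_locales auto

interpretation px: ring_map "\<lambda>p. poly p x"
  by (rule ring_map_poly_x)

lemma ring_map_ev: "ring_map ev"
  unfolding ev_def by (rule px.ring_map_eval_hom)

interpretation ev: ring_map ev
  by (rule ring_map_ev)

lemma f_nz: "f \<noteq> 0"
  using separable by auto

lemma m_pos: "m > 0" using m2 by simp

lemma poly_x_nz: "p \<in> KX \<Longrightarrow> p \<noteq> 0 \<Longrightarrow> poly p x \<noteq> 0"
  using transcendental by (auto simp: transcendental_over_def poly_over_iff)

lemma fx_nz: "poly f x \<noteq> 0"
  using poly_x_nz f_over f_nz by blast

lemma y_nz: "y \<noteq> 0"
  using y_pow fx_nz m_pos by (auto simp: power_0_left)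

lemma x_diff_nz: "c \<in> K \<Longrightarrow> x - c \<noteq> 0"
  using poly_x_nz[of "[:-c, 1:]"] subring_K by (simp add: polys_over_pCons is_subringD is_subringD(1)[OF subring_KX])

lemma kpoly_over: "kpoly \<in> KXY"
  unfolding kpoly_def using f_over
  by (intro is_subring_diff[OF subring_KXY] polys_over_monom[OF subring_KX])
     (auto simp: polys_over_const[OF subring_KX] is_subringD[OF subring_KX])

lemma degree_kpoly: "degree kpoly = m"
  unfolding kpoly_def using m_pos
  by (subst diff_conv_add_uminus, subst degree_add_eq_left) (auto simp: degree_monom_eq)

lemma lead_coeff_kpoly: "lead_coeff kpoly = 1"
  using m_pos unfolding degree_kpoly by (simp add: kpoly_def coeff_pCons split: nat.split)

lemma kpoly_nz: "kpoly \<noteq> 0"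
  using lead_coeff_kpoly by auto

lemma ev_eq_sum: "degree N < m \<Longrightarrow> ev N = (\<Sum>j<m. poly (coeff N j) x * y ^ j)"
  unfolding ev_def by (rule px.eval_hom_eq_sum)

lemma ev_const: "ev [:p:] = poly p x"
  by (simp add: ev_def)

lemma ev_smult: "ev (smult p N) = poly p x * ev N"
  unfolding ev_def by (rule px.eval_hom_smult)

lemma reduce_mod_kpoly:
  assumes "N \<in> KXY"
  obtains q R where "q \<in> KXY" "R \<in> KXY" "degree R < m" "N = q * kpoly + R"
proof -
  obtain q R s where "q \<in> KXY" "R \<in> KXY" "smult (lead_coeff kpoly ^ s) N = q * kpoly + R"
      "R = 0 \<or> degree R < degree kpoly"
    using pseudo_division_over[OF subring_KX kpoly_over kpoly_nz assms] by blast
  hence "N = q * kpoly + R" "degree R < m" using m_pos lead_coeff_kpoly by (auto simp: degree_kpoly)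
  thus ?thesis using that \<open>q \<in> KXY\<close> \<open>R \<in> KXY\<close> by blast
qed

text \<open>The conditions ensure that nonzero terms \<open>a\<^sub>j(x) y\<^sup>j\<close> with different \<open>j < m\<close> have different values.\<close>
definition separating :: "('a \<Rightarrow> int) \<Rightarrow> int \<Rightarrow> int \<Rightarrow> bool" where
  "separating v s e \<longleftrightarrow> is_place K v \<and> s > 0 \<and> coprime (int m) e \<and> v y = s * e \<and>
     (\<forall>p\<in>KX. p \<noteq> 0 \<longrightarrow> (int m * s) dvd v (poly p x))"

lemma separating_ev:
  assumes sep: "separating v s e" and N: "N \<in> KXY" "N \<noteq> 0" "degree N < m"
  shows "ev N \<noteq> 0"
    and "\<And>j. coeff N j \<noteq> 0 \<Longrightarrow> v (ev N) \<le> v (poly (coeff N j) x) + int j * v y"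
    and "\<exists>j<m. coeff N j \<noteq> 0 \<and> v (ev N) = v (poly (coeff N j) x) + int j * v y"
    and "s dvd v (ev N)"
proof -
  have v: "is_place K v" using sep by (simp add: separating_def)
  define t where "t j = poly (coeff N j) x * y ^ j" for j
  define S where "S = {j. j < m \<and> coeff N j \<noteq> 0}"
  have fin: "finite S" by (simp add: S_def)
  have ne: "S \<noteq> {}" using N by (auto simp: S_def intro!: exI[of _ "degree N"])
  have px: "poly (coeff N j) x \<noteq> 0" if "coeff N j \<noteq> 0" for j
    using that N poly_x_nz polys_over_coeff by blast
  have vt: "v (t j) = v (poly (coeff N j) x) + int j * v y" if "coeff N j \<noteq> 0" for j
    using px[OF that] y_nz by (simp add: t_def place_mult[OF v] place_power[OF v])
  have inj: "inj_on (\<lambda>j. v (t j)) S"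
  proof (rule inj_onI)
    fix i j assume ij: "i \<in> S" "j \<in> S" "v (t i) = v (t j)"
    have nz: "coeff N i \<noteq> 0" "coeff N j \<noteq> 0" using ij by (auto simp: S_def)
    obtain a where a: "v (poly (coeff N i) x) = int m * s * a"
      using sep nz N polys_over_coeff unfolding separating_def by (metis dvdE)
    obtain b where b: "v (poly (coeff N j) x) = int m * s * b"
      using sep nz N polys_over_coeff unfolding separating_def by (metis dvdE)
    have s: "s \<noteq> 0" "v y = s * e" using sep by (auto simp: separating_def)
    have "s * (int m * a + int i * e) = s * (int m * b + int j * e)"
      using ij(3) vt nz a b s(2) by (simp add: algebra_simps)
    hence "int m * a + int i * e = int m * b + int j * e" using s by simp
    hence "e * (int i - int j) = int m * (b - a)" by (simp add: algebra_simps)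
    hence "int m dvd e * (int i - int j)" by simp
    hence "int m dvd int i - int j" using sep coprime_dvd_mult_right_iff unfolding separating_def by blast
    moreover have "\<bar>int i - int j\<bar> < \<bar>int m\<bar>" using ij by (auto simp: S_def)
    ultimately have "int i - int j = 0" by (meson dvd_imp_le_int linorder_not_less)
    thus "i = j" by simp
  qed
  have "ev N = sum t S"
    unfolding ev_eq_sum[OF N(3)] t_def S_def by (intro sum.mono_neutral_right) auto
  with place_sum_distinct[OF v fin ne _ inj] px y_nz
  have *: "ev N \<noteq> 0" "\<And>j. j \<in> S \<Longrightarrow> v (ev N) \<le> v (t j)" "\<exists>j\<in>S. v (ev N) = v (t j)"
    by (auto simp: t_def S_def)
  show "ev N \<noteq> 0" by fact
  show "v (ev N) \<le> v (poly (coeff N j) x) + int j * v y" if "coeff N j \<noteq> 0" for j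
  proof -
    have "j < m" using le_degree[OF that] N by simp
    thus ?thesis using *(2)[of j] vt that by (simp add: S_def)
  qed
  show ex: "\<exists>j<m. coeff N j \<noteq> 0 \<and> v (ev N) = v (poly (coeff N j) x) + int j * v y"
    using *(3) vt by (auto simp: S_def)
  then obtain j where j: "coeff N j \<noteq> 0" "v (ev N) = v (poly (coeff N j) x) + int j * v y" by blast
  have "int m * s dvd v (poly (coeff N j) x)"
    using sep j N polys_over_coeff unfolding separating_def by blast
  hence "s dvd v (poly (coeff N j) x)" by (rule dvd_mult_right)
  thus "s dvd v (ev N)" using sep j(2) by (simp add: separating_def)
qed

text \<open>From m v(y) = r v(x) and coprimality, \<open>m\<close> divides \<open>v x\<close>, and
  the value of a polynomial in \<open>x\<close> is a multiple of \<open>v x\<close>. Nothing about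
  the ramification index is presupposed; the scale \<open>s\<close> stays open for now.\<close>

lemma separating_infinity:
  assumes v: "is_place K v" "v x < 0"
  obtains s where "separating v s (- int r)" "v x = - (int m * s)" "v y = - (int r * s)"
proof -
  have p: "v (poly p x) = v x * int (degree p)" if "p \<in> KX" "p \<noteq> 0" for p
    using place_poly_pole[OF v that] by simp
  have "int m * v y = int r * v x"
    using p[OF f_over f_nz] place_power[OF v(1) y_nz, of m] by (simp add: y_pow deg_f mult.commute)
  moreover have cop: "coprime (int m) (int r)" using coprime_mr by simp
  ultimately have "int m dvd v x" using coprime_dvd_mult_right_iff[OF cop] by (metis dvd_triv_left)
  then obtain k where k: "v x = int m * k" by (elim dvdE)
  hence "v y = int r * k" using \<open>int m * v y = int r * v x\<close> m_pos by simp
  moreover have "k < 0" using k v(2) m_pos by (simp add: mult_less_0_iff)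
  moreover have "int m * - k dvd v (poly p x)" if "p \<in> KX" "p \<noteq> 0" for p
    using p[OF that] k by simp
  ultimately have "separating v (- k) (- int r)"
    using v cop unfolding separating_def by (auto simp: mult.commute)
  thus ?thesis using that[of "- k"] k \<open>v y = int r * k\<close> by simp
qed

text \<open>At infinity a nonzero combination of 1, y, ..., y^(m-1) over K[x] has terms of distinct
  values and cannot cancel. This is the step that gives the extension its degree
  \<open>m\<close>.\<close>

lemma ev_inj: "N \<in> KXY \<Longrightarrow> degree N < m \<Longrightarrow> ev N = 0 \<Longrightarrow> N = 0"
  using separating_infinity[OF Pinf] separating_ev(1) by metis

lemma ev_kpoly: "ev kpoly = 0"
  unfolding kpoly_def ev.map_diff ev_const by (simp add: ev_def px.eval_hom_monom y_pow)

text \<open>Euclidean algorithm for \<open>N\<close> and \<open>kpoly\<close>: pseudo-division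
  leaves a remainder of smaller degree, and an inverse of the remainder modulo \<open>kpoly\<close>,
  up to a factor in K[X], yields one for \<open>N\<close>.\<close>

lemma inverse_mod_kpoly:
  assumes "N \<in> KXY" "N \<noteq> 0" "degree N < m"
  shows "\<exists>E d q. E \<in> KXY \<and> d \<in> KX \<and> d \<noteq> 0 \<and> q \<in> KXY \<and> N * E = [:d:] + q * kpoly"
  using assms
proof (induction "degree N" arbitrary: N rule: less_induct)
  case less
  show ?case
  proof (cases "degree N = 0")
    case True
    then obtain c where c: "N = [:c:]" by (elim degree_eq_zeroE)
    thus ?thesis using less.prems is_subringD[OF subring_KXY] polys_over_const[OF subring_KX]
      by (intro exI[of _ 1] exI[of _ c] exI[of _ 0]) auto
  next
    case False
    obtain q R s where qR: "q \<in> KXY" "R \<in> KXY" "smult (lead_coeff N ^ s) kpoly = q * N + R"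
      "R = 0 \<or> degree R < degree N"
      using pseudo_division_over[OF subring_KX less.prems(1,2) kpoly_over] by blast
    define c where "c = lead_coeff N ^ s"
    have c0: "c \<noteq> 0" using less.prems by (simp add: c_def)
    have cX: "c \<in> KX" unfolding c_def
      using less.prems polys_over_coeff by (intro is_subring_power[OF subring_KX]) auto
    \<comment> \<open>A zero remainder would make a multiple of \<open>kpoly\<close> the product of
      two nonzero polynomials of degree below \<open>m\<close>. One of them would then vanish at
      \<open>x\<close> and \<open>y\<close>, against independence.\<close>
    have R0: "R \<noteq> 0"
    proof
      assume "R = 0"
      hence e: "smult c kpoly = q * N" using qR by (simp add: c_def)
      have q0: "q \<noteq> 0" using e c0 kpoly_nz by auto
      have "m = degree q + degree N"
        using arg_cong[OF e, of degree] c0 q0 less.prems by (simp add: degree_kpoly degree_mult_eq)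
      hence dq: "degree q < m" using False by simp
      have "ev q * ev N = 0"
        using arg_cong[OF e, of ev] by (simp add: ev_kpoly ev_smult)
      thus False using ev_inj[OF qR(1) dq] ev_inj[OF less.prems(1,3)] q0 less.prems by auto
    qed
    hence dR: "degree R < degree N" using qR by blast
    then obtain E d q' where E: "E \<in> KXY" "d \<in> KX" "d \<noteq> 0" "q' \<in> KXY" "R * E = [:d:] + q' * kpoly"
      using less.hyps[OF dR qR(2) R0] less.prems by auto
    have "N * (- (q * E)) = (R - smult c kpoly) * E"
      using qR(3) by (simp add: c_def algebra_simps)
    also have "\<dots> = [:d:] + (q' - smult c E) * kpoly"
      using E(5) by (simp add: algebra_simps)
    finally have "N * (- (q * E)) = [:d:] + (q' - smult c E) * kpoly" .
    moreover have "- (q * E) \<in> KXY" "q' - smult c E \<in> KXY"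
      using E qR cX is_subringD[OF subring_KXY] is_subring_diff[OF subring_KXY] polys_over_smult[OF subring_KX]
      by auto
    ultimately show ?thesis using E by blast
  qed
qed

definition represents :: "'a poly poly \<Rightarrow> 'a poly \<Rightarrow> 'a \<Rightarrow> bool" where
  "represents N D z \<longleftrightarrow> N \<in> KXY \<and> degree N < m \<and> D \<in> KX \<and> D \<noteq> 0 \<and> z * poly D x = ev N"

lemma representsI:
  assumes "N \<in> KXY" "D \<in> KX" "D \<noteq> 0" "z * poly D x = ev N"
  shows "\<exists>N D. represents N D z"
proof -
  obtain q R where "q \<in> KXY" "R \<in> KXY" "degree R < m" "N = q * kpoly + R"
    using reduce_mod_kpoly[OF assms(1)] .
  thus ?thesis using assms by (intro exI[of _ R] exI[of _ D]) (simp add: represents_def ev_kpoly)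
qed

text \<open>The elements so represented form a subfield containing \<open>K\<close>,
  \<open>x\<close> and \<open>y\<close>; closure under inverses is the point of the inverses modulo
  \<open>kpoly\<close>.\<close>

lemma represents_exists: "\<exists>N D. represents N D z"
proof -
  define L where "L = {z. \<exists>N D. represents N D z}"
  note S = is_subringD[OF subring_KX] is_subringD[OF subring_KXY] polys_over_const[OF subring_KX]
    is_subringD[OF subring_K] polys_over_smult[OF subring_KX]
  have Lc: "c \<in> L" if "c \<in> K" for c
    unfolding L_def mem_Collect_eq
    by (rule representsI[of "[:[:c:]:]" 1]) (use that S in \<open>auto simp: ev_const polys_over_const[OF subring_K]\<close>)
  have xL: "x \<in> L"
    unfolding L_def mem_Collect_eq
    by (rule representsI[of "[:[:0, 1:]:]" 1]) (use S in \<open>auto simp: ev_const polys_over_pCons\<close>)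
  have yL: "y \<in> L"
    unfolding L_def mem_Collect_eq
    by (rule representsI[of "[:0, 1:]" 1]) (use S in \<open>auto simp: ev_def polys_over_pCons\<close>)
  have "is_subfield L"
    unfolding is_subfield_def
  proof (intro conjI ballI)
    show "0 \<in> L" "1 \<in> L" using Lc S by auto
  next
    fix a b assume "a \<in> L" "b \<in> L"
    then obtain N D N' D' where N: "N \<in> KXY" "D \<in> KX" "D \<noteq> 0" "a * poly D x = ev N"
      and N': "N' \<in> KXY" "D' \<in> KX" "D' \<noteq> 0" "b * poly D' x = ev N'"
      by (auto simp: L_def represents_def)
    have "(a + b) * poly (D * D') x = (a * poly D x) * poly D' x + (b * poly D' x) * poly D x"
      by (simp add: algebra_simps)
    also have "\<dots> = ev (smult D' N + smult D N')" by (simp only: N N' ev.map_add ev_smult mult.commute)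
    finally show "a + b \<in> L" unfolding L_def mem_Collect_eq
      using N N' S by (intro representsI[of "smult D' N + smult D N'" "D * D'"]) auto
    have "(a * b) * poly (D * D') x = (a * poly D x) * (b * poly D' x)"
      by (simp add: algebra_simps)
    also have "\<dots> = ev (N * N')" by (simp only: N N' ev.map_mult)
    finally show "a * b \<in> L" unfolding L_def mem_Collect_eq
      using N N' S by (intro representsI[of "N * N'" "D * D'"]) auto
  next
    fix a assume "a \<in> L"
    then obtain N D where N: "N \<in> KXY" "degree N < m" "D \<in> KX" "D \<noteq> 0" "a * poly D x = ev N"
      by (auto simp: L_def represents_def)
    show "- a \<in> L" unfolding L_def mem_Collect_eq
      using N S by (intro representsI[of "- N" D]) auto
    show "inverse a \<in> L"
    proof (cases "a = 0")
      case True
      thus ?thesis using Lc S by auto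
    next
      case False
      hence "N \<noteq> 0" using N poly_x_nz by auto
      then obtain E d q where E: "E \<in> KXY" "d \<in> KX" "d \<noteq> 0" "q \<in> KXY" "N * E = [:d:] + q * kpoly"
        using inverse_mod_kpoly N by metis
      have "ev N * ev E = poly d x" using arg_cong[OF E(5), of ev] by (simp add: ev_kpoly ev_const)
      hence "a * (poly D x * ev E) = poly d x" using N(5) by (simp add: mult.assoc[symmetric])
      hence "inverse a * poly d x = poly D x * ev E" using False by (simp add: field_simps)
      thus ?thesis unfolding L_def mem_Collect_eq
        using E N S by (intro representsI[of "smult D E" d]) (auto simp: ev_smult)
    qed
  qed
  hence "generated_field (K \<union> {x, y}) \<subseteq> L"
    unfolding generated_field_def using Lc xL yL by auto
  thus ?thesis using generated by (auto simp: L_def)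
qed

lemma represents_nz: "represents N D z \<Longrightarrow> z \<noteq> 0 \<Longrightarrow> N \<noteq> 0"
  using poly_x_nz by (auto simp: represents_def)

lemma represents_val:
  assumes "is_place K v" "represents N D z" "z \<noteq> 0"
  shows "v z = v (ev N) - v (poly D x)"
  using assms place_mult[OF assms(1), of z "poly D x"] poly_x_nz[of D] by (simp add: represents_def)

text \<open>Every value is a multiple of \<open>s\<close>, and a normalised valuation attains 1.
  This fixes the ramification index at exactly \<open>m\<close>.\<close>

lemma separating_scale_1:
  assumes "separating v s e" shows "s = 1"
proof -
  have v: "is_place K v" using assms by (simp add: separating_def)
  then obtain t where t: "t \<noteq> 0" "v t = 1" by (auto simp: is_place_def)
  obtain N D where ND: "represents N D t" using represents_exists by blast
  have "s dvd v (ev N)" "int m * s dvd v (poly D x)"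
    using ND represents_nz[OF ND t(1)] assms separating_ev(4)[OF assms]
    by (auto simp: represents_def separating_def)
  hence "s dvd v (ev N) - v (poly D x)" using dvd_mult_right by (metis dvd_diff)
  hence "s dvd 1" using represents_val[OF v ND t(1)] t by simp
  thus ?thesis using assms by (simp add: separating_def)
qed

text \<open>The value of a sum is the minimum over its terms, so such a valuation is determined by
  its values on K[x] and at \<open>y\<close>. Uniqueness of the place above infinity and above each
  root follows.\<close>

lemma separating_eqI:
  assumes v: "separating v s e" and w: "separating w s' e'"
    and eq: "\<And>p. p \<in> KX \<Longrightarrow> p \<noteq> 0 \<Longrightarrow> v (poly p x) = w (poly p x)" "v y = w y"
  shows "v = w"
proof
  fix z
  have pl: "is_place K v" "is_place K w" using v w by (auto simp: separating_def)
  show "v z = w z"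
  proof (cases "z = 0")
    case True
    thus ?thesis using pl place_0 by metis
  next
    case False
    obtain N D where ND: "represents N D z" using represents_exists by blast
    have N: "N \<in> KXY" "N \<noteq> 0" "degree N < m" "D \<in> KX" "D \<noteq> 0"
      using ND represents_nz[OF ND False] by (auto simp: represents_def)
    have c: "v (poly (coeff N j) x) = w (poly (coeff N j) x)" if "coeff N j \<noteq> 0" for j
      using eq(1) that N polys_over_coeff by blast
    have "v (ev N) = w (ev N)"
    proof (rule antisym)
      show "v (ev N) \<le> w (ev N)"
        using separating_ev(2)[OF v N(1-3)] separating_ev(3)[OF w N(1-3)] c eq(2) by metis
      show "w (ev N) \<le> v (ev N)"
        using separating_ev(2)[OF w N(1-3)] separating_ev(3)[OF v N(1-3)] c eq(2) by metis
    qed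
    thus ?thesis using represents_val[OF pl(1) ND False] represents_val[OF pl(2) ND False] eq(1) N by simp
  qed
qed

lemma infinite_place:
  assumes v: "is_place K v" "v x < 0"
  shows "separating v 1 (- int r)" "v x = - int m" "v y = - int r"
    and "\<And>p. p \<in> KX \<Longrightarrow> p \<noteq> 0 \<Longrightarrow> v (poly p x) = - (int m * int (degree p))"
proof -
  obtain s where s: "separating v s (- int r)" "v x = - (int m * s)" "v y = - (int r * s)"
    using separating_infinity[OF v] .
  have "s = 1" using separating_scale_1[OF s(1)] .
  thus *: "separating v 1 (- int r)" "v x = - int m" "v y = - int r" using s by auto
  show "v (poly p x) = - (int m * int (degree p))" if "p \<in> KX" "p \<noteq> 0" for p
    using place_poly_pole[OF v that] * by simp
qed

lemma infinite_place_unique: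
  assumes v: "is_place K v" "v x < 0" shows "v = Pinf"
  using infinite_place[OF v] infinite_place[OF Pinf] by (intro separating_eqI) auto

text \<open>Since \<open>a\<close> is a simple root, m v(y) = v(x - a). The valuation is therefore
  separating with \<open>e = 1\<close> and scale \<open>v y\<close>, and the scale must be
  1.\<close>

lemma affine_place:
  assumes a: "a \<in> K" "poly f a = 0" and v: "is_place K v" "v (x - a) > 0"
  shows "separating v 1 1" "v (x - a) = int m" "v y = 1"
    and "\<And>p. p \<in> KX \<Longrightarrow> p \<noteq> 0 \<Longrightarrow> v (poly p x) = int m * int (order a p)"
proof -
  have p: "v (poly p x) = v (x - a) * int (order a p)" if "p \<in> KX" "p \<noteq> 0" for p
    using place_poly_order(2)[OF v(1) subring_K a(1) v(2) x_diff_nz[OF a(1)] that] .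
  have "order a f \<le> 1"
    using order_separable_le_1[OF ring_map_id separable, of a] by simp
  moreover have "order a f \<noteq> 0" using a f_nz by (simp add: order_root)
  ultimately have "order a f = 1" by simp
  hence my: "int m * v y = v (x - a)"
    using p[OF f_over f_nz] place_power[OF v(1) y_nz, of m] by (simp add: y_pow)
  hence "v y > 0" using v(2) m_pos by (simp add: zero_less_mult_iff flip: my)
  hence sep: "separating v (v y) 1" unfolding separating_def using v p my by auto
  from separating_scale_1[OF this] show y1: "v y = 1" .
  show "separating v 1 1" "v (x - a) = int m" using sep my y1 by auto
  thus "v (poly p x) = int m * int (order a p)" if "p \<in> KX" "p \<noteq> 0" for p using p[OF that] by simp
qed

lemma affine_place_unique:
  assumes a: "a \<in> K" "poly f a = 0" and v: "is_place K v" "v (x - a) > 0"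
    and w: "is_place K w" "w (x - a) > 0"
  shows "v = w"
  using affine_place[OF a v] affine_place[OF a w] by (intro separating_eqI) auto

text \<open>The field is the fraction field of K[X, T] modulo T^m - f(X), so the images of
  \<open>x\<close> and \<open>y\<close> may be chosen freely subject to this relation and to
  nonvanishing of denominators. Agreement of \<open>\<phi>\<close> with \<open>\<kappa>\<close> is
  asserted only on \<open>K\<close>.\<close>

lemma hom_extension:
  fixes \<kappa> :: "'a \<Rightarrow> 'b::field"
  assumes \<kappa>: "ring_map \<kappa>" and \<eta>: "\<eta> ^ m = eval_hom \<kappa> \<xi> f"
    and tr: "\<And>d. d \<in> KX \<Longrightarrow> d \<noteq> 0 \<Longrightarrow> eval_hom \<kappa> \<xi> d \<noteq> 0"
  obtains \<phi> where "ring_map \<phi>" "\<And>p. p \<in> KX \<Longrightarrow> \<phi> (poly p x) = eval_hom \<kappa> \<xi> p"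
    "\<And>N. N \<in> KXY \<Longrightarrow> \<phi> (ev N) = eval_hom (eval_hom \<kappa> \<xi>) \<eta> N"
proof -
  interpret k: ring_map \<kappa> by fact
  interpret e: ring_map "eval_hom \<kappa> \<xi>" by (rule k.ring_map_eval_hom)
  define \<psi> where "\<psi> = eval_hom (eval_hom \<kappa> \<xi>) \<eta>"
  interpret \<psi>: ring_map \<psi> unfolding \<psi>_def by (rule e.ring_map_eval_hom)
  have \<psi>_smult: "\<psi> (smult p N) = eval_hom \<kappa> \<xi> p * \<psi> N" for p N
    unfolding \<psi>_def by (rule e.eval_hom_smult)
  have \<psi>_const: "\<psi> [:p:] = eval_hom \<kappa> \<xi> p" for p by (simp add: \<psi>_def)
  have "\<psi> kpoly = 0"
    unfolding kpoly_def \<psi>.map_diff \<psi>_const by (simp add: \<psi>_def e.eval_hom_monom \<eta>)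
  hence ker: "\<psi> N = 0" if "N \<in> KXY" "ev N = 0" for N
    using that reduce_mod_kpoly[OF that(1)] ev_inj
    by (metis (no_types, lifting) add_0 ev.map_add ev.map_mult ev_kpoly mult_zero_right \<psi>.map_add \<psi>.map_mult \<psi>.map_zero)
  obtain Nf Df where rep: "\<And>z. represents (Nf z) (Df z) z"
    using represents_exists by metis
  define \<phi> where "\<phi> z = \<psi> (Nf z) / eval_hom \<kappa> \<xi> (Df z)" for z
  \<comment> \<open>Cross-multiplying two representations of \<open>z\<close> gives an element of
    the kernel of \<open>ev\<close>, which \<open>\<psi>\<close> annihilates; the quotient is thus
    independent of the chosen fraction.\<close>
  have key: "\<phi> z = \<psi> N / eval_hom \<kappa> \<xi> D"
    if "N \<in> KXY" "D \<in> KX" "D \<noteq> 0" "z * poly D x = ev N" for z N D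
  proof -
    have r: "Nf z \<in> KXY" "Df z \<in> KX" "Df z \<noteq> 0" "z * poly (Df z) x = ev (Nf z)"
      using rep[of z] by (auto simp: represents_def)
    have "ev (smult D (Nf z) - smult (Df z) N) = 0"
      by (simp add: ev_smult that(4)[symmetric] r(4)[symmetric])
    moreover have "smult D (Nf z) - smult (Df z) N \<in> KXY"
      using r that by (intro is_subring_diff[OF subring_KXY] polys_over_smult[OF subring_KX])
    ultimately have "\<psi> (smult D (Nf z) - smult (Df z) N) = 0" using ker by blast
    thus ?thesis using tr[OF that(2,3)] tr[OF r(2,3)] by (simp add: \<phi>_def \<psi>_smult field_simps)
  qed
  have N1: "1 \<in> KX" "(1 :: 'a poly) \<noteq> 0" using is_subringD[OF subring_KX] by auto
  have \<phi>N: "\<phi> (ev N) = \<psi> N" if "N \<in> KXY" for N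
    using key[OF that N1, of "ev N"] by simp
  have "ring_map \<phi>"
  proof
    show "\<phi> 1 = 1" using \<phi>N[of 1] is_subringD(2)[OF subring_KXY] by simp
    fix a b
    obtain N D N' D' where N: "N \<in> KXY" "D \<in> KX" "D \<noteq> 0" "a * poly D x = ev N"
      and N': "N' \<in> KXY" "D' \<in> KX" "D' \<noteq> 0" "b * poly D' x = ev N'"
      using rep[of a] rep[of b] by (auto simp: represents_def)
    have DD: "D * D' \<in> KX" "D * D' \<noteq> 0" using N N' is_subringD[OF subring_KX] by auto
    have dn: "eval_hom \<kappa> \<xi> D \<noteq> 0" "eval_hom \<kappa> \<xi> D' \<noteq> 0" using tr N N' by auto
    have "(a + b) * poly (D * D') x = (a * poly D x) * poly D' x + (b * poly D' x) * poly D x"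
      by (simp add: algebra_simps)
    also have "\<dots> = ev (smult D' N + smult D N')"
      by (simp only: N N' ev.map_add ev_smult mult.commute)
    finally have "\<phi> (a + b) = \<psi> (smult D' N + smult D N') / eval_hom \<kappa> \<xi> (D * D')"
      using N N' by (intro key DD is_subringD(3)[OF subring_KXY] polys_over_smult[OF subring_KX])
    thus "\<phi> (a + b) = \<phi> a + \<phi> b"
      unfolding key[OF N] key[OF N'] \<psi>.map_add \<psi>_smult e.map_mult using dn by (simp add: field_simps)
    have "(a * b) * poly (D * D') x = (a * poly D x) * (b * poly D' x)" by (simp add: algebra_simps)
    also have "\<dots> = ev (N * N')" by (simp only: N N' ev.map_mult)
    finally have "\<phi> (a * b) = \<psi> (N * N') / eval_hom \<kappa> \<xi> (D * D')"
      using N N' by (intro key DD is_subringD(4)[OF subring_KXY])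
    thus "\<phi> (a * b) = \<phi> a * \<phi> b"
      unfolding key[OF N] key[OF N'] by simp
  qed
  moreover have "\<phi> (poly p x) = eval_hom \<kappa> \<xi> p" if "p \<in> KX" for p
    using \<phi>N[of "[:p:]"] that by (simp add: polys_over_const[OF subring_KX] ev_const \<psi>_const)
  ultimately show ?thesis using that \<phi>N unfolding \<psi>_def by blast
qed

lemma X_minus_in_KX: "c \<in> K \<Longrightarrow> [:-c, 1:] \<in> KX"
  by (simp add: polys_over_pCons is_subringD[OF subring_K] is_subringD(1)[OF subring_KX])

lemma X_in_KX: "[:0, 1:] \<in> KX"
  using X_minus_in_KX[OF is_subringD(1)[OF subring_K]] by simp

lemma const_in_KX: "c \<in> K \<Longrightarrow> [:c:] \<in> KX"
  by (simp add: polys_over_const[OF subring_K])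

text \<open>The place pulled back from this expansion is finite and can be centred only at a
  constant that maps to \<alpha>, so \<open>regular\<close> applies to it and the expansion of
  \<open>z\<close> has no pole. The root \<open>\<eta>\<close> is arbitrary, in preparation for
  averaging.\<close>

lemma branch_value:
  fixes \<alpha> :: "'a alg_closure"
  defines "\<xi> \<equiv> branch_point m \<alpha>"
  assumes rep: "represents N D z" and \<eta>: "\<eta> ^ m = eval_hom fls_const \<xi> (map_poly to_ac f)"
    and regular: "\<And>Q. is_place K Q \<Longrightarrow> Q x \<ge> 0 \<Longrightarrow>
      (\<And>c. c \<in> K \<Longrightarrow> Q (x - c) > 0 \<Longrightarrow> to_ac c = \<alpha>) \<Longrightarrow> Q z \<ge> 0"
    and D: "poly (map_poly to_ac D) \<alpha> = 0"
  shows "\<exists>Z. fls_subdegree Z \<ge> 0 \<and> Z * eval_hom fls_const \<xi> (map_poly to_ac D) =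
      (\<Sum>i<m. eval_hom fls_const \<xi> (map_poly to_ac (coeff N i)) * \<eta> ^ i)"
proof -
  define \<kappa> where "\<kappa> = (\<lambda>c :: 'a. fls_const (to_ac c))"
  have \<kappa>: "ring_map \<kappa>" unfolding \<kappa>_def by (rule ring_map_comp[OF ring_map_fls_const ring_map_to_ac])
  interpret k: ring_map \<kappa> by fact
  interpret e: ring_map "eval_hom \<kappa> \<xi>" by (rule k.ring_map_eval_hom)
  have ek: "eval_hom \<kappa> \<xi> p = eval_hom fls_const \<xi> (map_poly to_ac p)" for p
    unfolding \<kappa>_def by (rule eval_hom_comp[OF ring_map_fls_const ring_map_to_ac])
  have mp_nz: "map_poly to_ac p \<noteq> 0" if "p \<noteq> 0" for p :: "'a poly"
    using that by (simp add: map_poly_eq_0_iff)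
  have tr: "eval_hom \<kappa> \<xi> d \<noteq> 0"
    "fls_subdegree (eval_hom \<kappa> \<xi> d) = int m * int (order \<alpha> (map_poly to_ac d))" if "d \<noteq> 0" for d
    using eval_branch_point[OF m_pos mp_nz[OF that], of \<alpha>] by (simp_all add: ek, simp_all add: \<xi>_def)
  obtain \<phi> where \<phi>: "ring_map \<phi>" "\<And>p. p \<in> KX \<Longrightarrow> \<phi> (poly p x) = eval_hom \<kappa> \<xi> p"
    "\<And>N. N \<in> KXY \<Longrightarrow> \<phi> (ev N) = eval_hom (eval_hom \<kappa> \<xi>) \<eta> N"
    using hom_extension[OF \<kappa>, of \<eta> \<xi>] \<eta> tr(1) unfolding ek by metis
  have ND: "N \<in> KXY" "degree N < m" "D \<in> KX" "D \<noteq> 0" "z * poly D x = ev N"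
    using rep by (auto simp: represents_def)
  have const: "fls_subdegree (\<phi> c) = 0" if "c \<in> K" for c
  proof -
    have "\<phi> c = \<kappa> c" using \<phi>(2)[OF const_in_KX[OF that]] by simp
    thus ?thesis by (simp add: \<kappa>_def)
  qed
  \<comment> \<open>This is where vanishing of \<open>D\<close> at \<alpha> enters: the image of
    D(x) has nonzero subdegree, so the pulled-back valuation is not trivial.\<close>
  have "order \<alpha> (map_poly to_ac D) \<noteq> 0" using D mp_nz[OF ND(4)] by (simp add: order_root)
  hence "fls_subdegree (\<phi> (poly D x)) \<noteq> 0"
    unfolding \<phi>(2)[OF ND(3)] tr(2)[OF ND(4)] using m_pos by simp
  then obtain Q d where Q: "is_place K Q" "d > 0" "\<And>z. fls_subdegree (\<phi> z) = d * Q z"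
    using place_of_laurent_embedding[OF \<phi>(1), of K "poly D x"] const by metis
  have "\<phi> x = \<xi>" using \<phi>(2)[OF X_in_KX] by simp
  also obtain g where "\<xi> = fps_to_fls g"
    using eval_branch_point_fps[OF m_pos, of \<alpha> "[:0, 1:]"] ring_map.eval_hom_pCons[OF ring_map_fls_const]
    by (metis \<xi>_def add_0 fls_const_0 fls_const_1 mult.right_neutral mult_zero_right add_0_right ring_map.eval_hom_0[OF ring_map_fls_const])
  finally have "d * Q x \<ge> 0" using Q(3)[of x] fls_subdegree_fls_to_fps_gt0 by metis
  hence Qx: "Q x \<ge> 0" using Q(2) by (simp add: zero_le_mult_iff)
  have Qc: "to_ac c = \<alpha>" if "c \<in> K" "Q (x - c) > 0" for c
  proof (rule ccontr)
    assume ne: "to_ac c \<noteq> \<alpha>"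
    have "order \<alpha> (map_poly to_ac [:-c, 1:]) = 0"
      using ne by (intro order_0I) (simp add: map_poly_pCons)
    hence "fls_subdegree (\<phi> (poly [:-c, 1:] x)) = 0"
      unfolding \<phi>(2)[OF X_minus_in_KX[OF that(1)]] by (subst tr(2)) auto
    hence "fls_subdegree (\<phi> (x - c)) = 0" by simp
    thus False using that(2) Q(2) Q(3)[of "x - c"] by simp
  qed
  have "Q z \<ge> 0" using regular[OF Q(1) Qx Qc] .
  hence "fls_subdegree (\<phi> z) \<ge> 0" using Q(2,3) by simp
  moreover have "\<phi> z * eval_hom \<kappa> \<xi> D = (\<Sum>i<m. eval_hom \<kappa> \<xi> (coeff N i) * \<eta> ^ i)"
  proof -
    have "\<phi> z * eval_hom \<kappa> \<xi> D = \<phi> (z * poly D x)"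
      using ring_map.map_mult[OF \<phi>(1)] \<phi>(2)[OF ND(3)] by simp
    also have "\<dots> = eval_hom (eval_hom \<kappa> \<xi>) \<eta> N" unfolding ND(5) \<phi>(3)[OF ND(1)] ..
    also have "\<dots> = (\<Sum>i<m. eval_hom \<kappa> \<xi> (coeff N i) * \<eta> ^ i)" by (rule e.eval_hom_eq_sum[OF ND(2)])
    finally show ?thesis .
  qed
  ultimately show ?thesis unfolding ek by blast
qed

text \<open>Replacing the chosen root \<open>\<eta>\<close> by \<open>w * \<eta>\<close> with \<open>w ^ m = 1\<close> gives \<open>m\<close> embeddings, whose
  weighted average isolates the \<open>j\<close>-th coefficient.\<close>
lemma pole_order_bound:
  fixes \<alpha> :: "'a alg_closure"
  assumes rep: "represents N D z"
    and regular: "\<And>Q. is_place K Q \<Longrightarrow> Q x \<ge> 0 \<Longrightarrow>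
      (\<And>c. c \<in> K \<Longrightarrow> Q (x - c) > 0 \<Longrightarrow> to_ac c = \<alpha>) \<Longrightarrow> Q z \<ge> 0"
    and j: "coeff N j \<noteq> 0"
  shows "order \<alpha> (map_poly to_ac D) \<le> order \<alpha> (map_poly to_ac (coeff N j))"
proof (cases "poly (map_poly to_ac D) \<alpha> = 0")
  case False
  thus ?thesis by (simp add: order_0I)
next
  case True
  define \<xi> where "\<xi> = branch_point m \<alpha>"
  define E where "E p = eval_hom fls_const \<xi> (map_poly to_ac p)" for p :: "'a poly"
  define U where "U = {w :: 'a alg_closure. w ^ m = 1}"
  have mp_nz: "map_poly to_ac p \<noteq> 0" if "p \<noteq> 0" for p :: "'a poly"
    using that by (simp add: map_poly_eq_0_iff)
  have E: "E p \<noteq> 0" "fls_subdegree (E p) = int m * int (order \<alpha> (map_poly to_ac p))" if "p \<noteq> 0" for p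
    unfolding E_def \<xi>_def using eval_branch_point[OF m_pos mp_nz[OF that]] by auto
  have m: "of_nat m \<noteq> (0 :: 'a alg_closure)"
    using char by (metis to_ac_eq_0_iff to_ac_of_nat)
  obtain \<eta> where \<eta>: "\<eta> \<noteq> 0" "\<eta> ^ m = E f" "fls_subdegree \<eta> = int (order \<alpha> (map_poly to_ac f))"
    using branch_root_exists[OF m mp_nz[OF f_nz], of \<alpha>] unfolding E_def \<xi>_def by blast
  have "\<exists>Z. fls_subdegree Z \<ge> 0 \<and> Z * E D = (\<Sum>i<m. E (coeff N i) * (fls_const w * \<eta>) ^ i)"
    if "w \<in> U" for w
  proof -
    have "(fls_const w * \<eta>) ^ m = eval_hom fls_const (branch_point m \<alpha>) (map_poly to_ac f)"
      using that \<eta>(2) by (simp add: U_def power_mult_distrib E_def \<xi>_def fls_const_power flip: fls_const_power)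
    note pw = this
    show ?thesis unfolding E_def \<xi>_def
    proof (rule branch_value[where z = z])
      show "Q z \<ge> 0" if "is_place K Q" "Q x \<ge> 0" "\<And>c. c \<in> K \<Longrightarrow> Q (x - c) > 0 \<Longrightarrow> to_ac c = \<alpha>" for Q
        using regular[OF that] .
    qed fact+
  qed
  then obtain Z where Z: "\<And>w. w \<in> U \<Longrightarrow> fls_subdegree (Z w) \<ge> 0"
    "\<And>w. w \<in> U \<Longrightarrow> Z w * E D = (\<Sum>i<m. E (coeff N i) * (fls_const w * \<eta>) ^ i)" by metis
  have jm: "j < m" using le_degree[OF j] rep by (simp add: represents_def)
  interpret c: ring_map "fls_const :: 'a alg_closure \<Rightarrow> _" by (rule ring_map_fls_const)
  \<comment> \<open>The factor \<open>w ^ (m - j)\<close> stands for the inverse of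
    \<open>w ^ j\<close>: term \<open>i\<close> then carries \<open>w ^ (m - j + i)\<close>, whose
    sum over the roots of unity vanishes unless \<open>i = j\<close>.\<close>
  define W where "W = (\<Sum>w\<in>U. fls_const (w ^ (m - j)) * Z w)"
  have "W * E D = (\<Sum>w\<in>U. fls_const (w ^ (m - j)) * (\<Sum>i<m. E (coeff N i) * (fls_const w * \<eta>) ^ i))"
    unfolding W_def sum_distrib_right by (intro sum.cong refl) (simp add: Z(2) mult.assoc)
  also have "\<dots> = (\<Sum>w\<in>U. \<Sum>i<m. E (coeff N i) * \<eta> ^ i * fls_const (w ^ (m - j + i)))"
    unfolding sum_distrib_left
    by (intro sum.cong refl) (simp add: power_mult_distrib power_add mult_ac)
  also have "\<dots> = (\<Sum>i<m. E (coeff N i) * \<eta> ^ i * fls_const (\<Sum>w\<in>U. w ^ (m - j + i)))"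
    by (subst sum.swap) (simp add: sum_distrib_left c.map_sum)
  also have "\<dots> = (\<Sum>i<m. if i = j then E (coeff N i) * \<eta> ^ i * of_nat m else 0)"
  proof (intro sum.cong refl)
    fix i assume i: "i \<in> {..<m}"
    have "m dvd m - j + i \<longleftrightarrow> i = j"
    proof
      assume "m dvd m - j + i"
      then obtain k where k: "m - j + i = m * k" by (elim dvdE)
      have "m - j + i < m * 2" "0 < m - j + i" using i jm by auto
      hence "m * k < m * 2" "0 < m * k" by (simp_all only: k)
      hence "k < 2" "0 < k" by (metis mult_less_cancel1, simp)
      hence "k = 1" by simp
      thus "i = j" using k jm by simp
    qed (use jm in auto)
    thus "E (coeff N i) * \<eta> ^ i * fls_const (\<Sum>w\<in>U. w ^ (m - j + i)) =
        (if i = j then E (coeff N i) * \<eta> ^ i * of_nat m else 0)"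
      unfolding U_def sum_roots_of_unity_power[OF m] by simp
  qed
  also have "\<dots> = E (coeff N j) * \<eta> ^ j * of_nat m" using jm by simp
  finally have eq: "W * E D = E (coeff N j) * \<eta> ^ j * of_nat m" .
  have D0: "D \<noteq> 0" using rep by (simp add: represents_def)
  have mf: "(of_nat m :: 'a alg_closure fls) \<noteq> 0" using m c.map_of_nat[of m] by (metis fls_const_nonzero)
  hence "W * E D \<noteq> 0" unfolding eq using E(1)[OF j] \<eta>(1) by simp
  hence W0: "W \<noteq> 0" by auto
  have "fls_subdegree W \<ge> 0" unfolding W_def using Z(1) by (rule fls_subdegree_nonneg_sum)
  moreover have "fls_subdegree (W * E D) = fls_subdegree W + int m * int (order \<alpha> (map_poly to_ac D))"
    using W0 E[OF D0] by simp
  moreover have "fls_subdegree (W * E D) =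
      int m * int (order \<alpha> (map_poly to_ac (coeff N j))) + int j * int (order \<alpha> (map_poly to_ac f))"
    unfolding eq using E[OF j] \<eta> mf by (simp add: fls_subdegree_pow)
  \<comment> \<open>Roots of \<open>f\<close> are simple, so \<open>\<eta> ^ j\<close> contributes
    at most \<open>j < m\<close> to a comparison of multiples of \<open>m\<close> and disappears in
    the rounding.\<close>
  moreover have "int j * int (order \<alpha> (map_poly to_ac f)) \<le> int j * 1"
    using order_separable_le_1[OF ring_map_to_ac separable, of \<alpha>] by (intro mult_left_mono) auto
  ultimately have "int m * int (order \<alpha> (map_poly to_ac D)) <
      int m * (int (order \<alpha> (map_poly to_ac (coeff N j))) + 1)"
    using jm by (simp add: distrib_left)
  thus ?thesis using m_pos by simp
qed

section \<open>Centres of rational totally ramified places\<close>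

lemma ev_in_subring:
  assumes A: "is_subring A" and "K \<subseteq> A" "x \<in> A" "y \<in> A" and N: "N \<in> KXY"
  shows "ev N \<in> A"
proof -
  have px: "poly p x \<in> A" if "p \<in> KX" for p
    by (rule poly_in_subring[OF A]) (use that assms in \<open>auto simp: polys_over_def\<close>)
  have "map_poly (\<lambda>p. poly p x) N \<in> polys_over A"
    using N px by (auto simp: polys_over_def coeff_map_poly)
  thus ?thesis unfolding ev_def eval_hom_def by (intro poly_in_subring[OF A] assms)
qed

text \<open>At a rational place centred at \<open>(c, d)\<close> with \<open>f(c) \<noteq> 0\<close> the function \<open>x - c\<close> generates the
  maximal ideal of the local ring of the point, so that its value divides every other value.\<close>
lemma unramified_value_dvd:
  assumes v: "is_place K v" and c: "c \<in> K" "v (x - c) > 0" and d: "d \<in> K" "val_ge v 1 (y - d)"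
    and fc: "poly f c \<noteq> 0" and z: "z \<noteq> 0"
  shows "v (x - c) dvd v z"
proof -
  have s0: "x - c \<noteq> 0" using x_diff_nz[OF c(1)] .
  have xc: "val_ge v 1 (x - c)" using c by (simp add: val_ge_def)
  have Kr: "\<And>a b. a \<in> K \<Longrightarrow> b \<in> K \<Longrightarrow> a + b \<in> K" "\<And>a b. a \<in> K \<Longrightarrow> b \<in> K \<Longrightarrow> a * b \<in> K"
    "\<And>a. a \<in> K \<Longrightarrow> - a \<in> K" "0 \<in> K" "1 \<in> K"
    using is_subringD[OF subring_K] by auto
  define M where "M = (monom 1 m :: 'a poly)"
  have M: "M \<in> KX" unfolding M_def by (rule polys_over_monom[OF subring_K Kr(5)])
  have fcK: "poly f c \<in> K" using poly_in_subring[OF subring_K f_over c(1)] .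
  \<comment> \<open>The two sides of y^m = f(x) have residues d^m and f(c), and congruent constants
    are equal.\<close>
  have dm: "d ^ m = poly f c"
  proof -
    have "val_ge v 1 ((poly f x - poly f c) - (poly M y - poly M d))"
      by (intro val_ge_diff[OF v] place_poly_residue[OF v subring_K] f_over M c(1) d xc)
    hence "val_ge v 1 (d ^ m - poly f c)" by (simp add: M_def poly_monom y_pow)
    hence "d ^ m - poly f c = 0"
      by (rule val_ge_const_pos[OF v is_subring_diff[OF subring_K is_subring_power[OF subring_K d(1)] fcK]])
    thus ?thesis by simp
  qed
  hence d0: "d \<noteq> 0" using fc m_pos by (auto simp: power_0_left)
  define W where "W = synthetic_div M d"
  have Wp: "M = [:-d, 1:] * W + [:poly M d:]" unfolding W_def by (rule synthetic_div_correct'[symmetric])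
  have WX: "W \<in> KX" unfolding W_def by (rule synthetic_div_polys_over[OF subring_K M d(1)])
  have "poly (pderiv M) d = poly W d"
    by (subst Wp) (simp add: pderiv_add pderiv_mult pderiv_pCons del: mult_pCons_left)
  hence "poly W d = of_nat m * d ^ (m - 1)" by (simp add: M_def pderiv_monom poly_monom)
  hence Wd: "poly W d \<noteq> 0" using char d0 by simp
  have W: "poly W y \<noteq> 0" "v (poly W y) = 0"
    using place_poly_unit[OF v subring_K WX d Wd] by auto
  define S where "S = synthetic_div f c"
  have SX: "S \<in> KX" unfolding S_def by (rule synthetic_div_polys_over[OF subring_K f_over c(1)])
  have "f = [:-c, 1:] * S + [:poly f c:]" unfolding S_def by (rule synthetic_div_correct'[symmetric])
  from arg_cong[OF this, of "\<lambda>p. poly p x"] have "poly f x = (x - c) * poly S x + poly f c"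
    by (simp add: algebra_simps)
  moreover from arg_cong[OF Wp, of "\<lambda>p. poly p y"] have "poly f x = (y - d) * poly W y + poly f c"
    by (simp add: algebra_simps M_def poly_monom y_pow dm)
  \<comment> \<open>Both sides of y^m = f(x) are expanded at (c, d). The cofactor
    \<open>poly W y\<close> has the residue m d^(m-1) and is a unit: the curve is smooth there, and
    \<open>y - d\<close> is a multiple of \<open>x - c\<close> in the local ring.\<close>
  ultimately have rel: "(y - d) * poly W y = (x - c) * poly S x" by simp

  define R where "R = ev ` KXY"
  have R: "is_subring R"
    unfolding is_subring_def R_def
  proof (intro conjI ballI)
    show "0 \<in> ev ` KXY" "1 \<in> ev ` KXY"
      using is_subringD(1,2)[OF subring_KXY] ev.map_zero ev.map_one by (metis imageI)+
    fix a b assume "a \<in> ev ` KXY" "b \<in> ev ` KXY"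
    thus "a + b \<in> ev ` KXY" "a * b \<in> ev ` KXY"
      using is_subringD(3,4)[OF subring_KXY] by (auto simp flip: ev.map_add ev.map_mult)
  next
    fix a assume "a \<in> ev ` KXY"
    thus "- a \<in> ev ` KXY" using is_subringD(5)[OF subring_KXY] by (auto simp flip: ev.map_uminus)
  qed
  have RX: "poly p x \<in> R" if "p \<in> KX" for p
    unfolding R_def using that by (intro image_eqI[of _ _ "[:p:]"]) (auto simp: ev_const polys_over_const[OF subring_KX])
  have RK: "K \<subseteq> R" using RX[OF const_in_KX] by auto
  have Rx: "x \<in> R" using RX[OF X_in_KX] by simp
  have Ry: "y \<in> R"
    unfolding R_def by (intro image_eqI[of _ _ "[:0, 1:]"])
      (auto simp: ev_def polys_over_pCons is_subringD[OF subring_KX] is_subringD[OF subring_KXY] eval_hom_def map_poly_pCons)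
  have RY: "poly p y \<in> R" if "p \<in> KX" for p
    by (rule poly_in_subring[OF R]) (use that RK Ry in \<open>auto simp: polys_over_def\<close>)
  have Rge: "val_ge v 0 a" if "a \<in> R" for a
  proof -
    have "val_ge v 0 x" using val_ge_add[OF v val_ge_mono[OF v xc, of 0] val_ge_const[OF v c(1)]] by simp
    moreover have "val_ge v 0 y" using val_ge_add[OF v val_ge_mono[OF v d(2), of 0] val_ge_const[OF v d(1)]] by simp
    ultimately show ?thesis
      using that ev_in_subring[OF is_subring_valuation_ring[OF v]] val_ge_const[OF v] unfolding R_def by blast
  qed
  \<comment> \<open>The local ring of the point: fractions of elements of K[x, y] with denominators
    of value 0.\<close>
  define O' where "O' = {z. \<exists>a b. a \<in> R \<and> b \<in> R \<and> b \<noteq> 0 \<and> v b = 0 \<and> z * b = a}"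
  have RO: "a \<in> O'" if "a \<in> R" for a
    unfolding O'_def using that is_subringD(2)[OF R] place_1[OF v] by force
  have "is_subring O'"
    unfolding is_subring_def
  proof (intro conjI ballI)
    show "0 \<in> O'" "1 \<in> O'" using RO is_subringD[OF R] by auto
  next
    fix a b assume "a \<in> O'" "b \<in> O'"
    then obtain a1 a2 b1 b2 where a: "a1 \<in> R" "a2 \<in> R" "a2 \<noteq> 0" "v a2 = 0" "a * a2 = a1"
      and b: "b1 \<in> R" "b2 \<in> R" "b2 \<noteq> 0" "v b2 = 0" "b * b2 = b1" unfolding O'_def by blast
    have den: "a2 * b2 \<in> R" "a2 * b2 \<noteq> 0" "v (a2 * b2) = 0"
      using a b is_subringD(4)[OF R] place_mult[OF v] by auto
    have "(a + b) * (a2 * b2) = a1 * b2 + b1 * a2" "(a * b) * (a2 * b2) = a1 * b1"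
      using a(5)[symmetric] b(5)[symmetric] by (simp_all add: algebra_simps)
    moreover have "a1 * b2 + b1 * a2 \<in> R" "a1 * b1 \<in> R" using a b is_subringD(3,4)[OF R] by auto
    ultimately show "a + b \<in> O'" "a * b \<in> O'" unfolding O'_def using den by blast+
  next
    fix a assume "a \<in> O'"
    then obtain a1 a2 where a: "a1 \<in> R" "a2 \<in> R" "a2 \<noteq> 0" "v a2 = 0" "a * a2 = a1" unfolding O'_def by blast
    hence "- a * a2 = - a1" "- a1 \<in> R" using is_subringD(5)[OF R] by auto
    thus "- a \<in> O'" unfolding O'_def using a by blast
  qed
  note OD = is_subringD[OF this]
  \<comment> \<open>This ring contains \<open>K\<close>, \<open>x\<close> and \<open>y\<close>,
    hence all of \<open>R\<close>: every element of \<open>R\<close> is a constant plus a multiple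
    of \<open>x - c\<close> in the local ring.\<close>
  define G where "G = {z. \<exists>k\<in>K. \<exists>b\<in>O'. z = k + (x - c) * b}"
  have GI: "k + (x - c) * b \<in> G" if "k \<in> K" "b \<in> O'" for k b using that by (auto simp: G_def)
  have KO: "k \<in> O'" if "k \<in> K" for k using that RK RO by blast
  have sO: "x - c \<in> O'" using RO[OF is_subring_diff[OF R Rx]] RK c by blast
  have "is_subring G"
    unfolding is_subring_def
  proof (intro conjI ballI)
    show "0 \<in> G" "1 \<in> G" using GI[of 0 0] GI[of 1 0] Kr OD by auto
  next
    fix a b assume "a \<in> G" "b \<in> G"
    then obtain k l a' b' where a: "k \<in> K" "a' \<in> O'" "a = k + (x - c) * a'"
      and b: "l \<in> K" "b' \<in> O'" "b = l + (x - c) * b'" by (auto simp: G_def)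
    have "a + b = (k + l) + (x - c) * (a' + b')" by (simp add: a b algebra_simps)
    thus "a + b \<in> G" using GI[OF Kr(1)[OF a(1) b(1)] OD(3)[OF a(2) b(2)]] by (simp only:)
    have "a * b = (k * l) + (x - c) * (k * b' + l * a' + (x - c) * (a' * b'))" by (simp add: a b algebra_simps)
    moreover have "k * b' + l * a' + (x - c) * (a' * b') \<in> O'" using a b KO sO OD by auto
    ultimately show "a * b \<in> G" using GI[of "k * l"] a b Kr by simp
  next
    fix a assume "a \<in> G"
    then obtain k a' where a: "k \<in> K" "a' \<in> O'" "a = k + (x - c) * a'" by (auto simp: G_def)
    have "- a = - k + (x - c) * (- a')" by (simp add: a algebra_simps)
    thus "- a \<in> G" using GI[of "- k" "- a'"] a Kr OD by simp
  qed
  moreover have "K \<subseteq> G" using GI[of _ 0] OD by auto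
  moreover have "x \<in> G" using GI[OF c(1) OD(2)] by simp
  moreover have "y \<in> G"
  proof -
    have "(poly S x / poly W y) * poly W y = poly S x" using W by simp
    hence "poly S x / poly W y \<in> O'" unfolding O'_def using RX[OF SX] RY[OF WX] W by blast
    moreover have "y = d + (x - c) * (poly S x / poly W y)" using rel W by (simp add: field_simps)
    ultimately show ?thesis using GI[OF d(1)] by metis
  qed
  ultimately have RG: "a \<in> G" if "a \<in> R" for a using ev_in_subring that unfolding R_def by blast
  \<comment> \<open>As long as the value is positive, the constant part of the numerator vanishes
    and \<open>x - c\<close> can be split off, which lowers the value. The descent ends at value
    0.\<close>
  have main: "v (x - c) dvd v b" if "b \<in> O'" "b \<noteq> 0" for b
    using that
  proof (induction "nat (v b)" arbitrary: b rule: less_induct)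
    case less
    obtain b1 b2 where b: "b1 \<in> R" "b2 \<in> R" "b2 \<noteq> 0" "v b2 = 0" "b * b2 = b1"
      using less.prems unfolding O'_def by blast
    have b10: "b1 \<noteq> 0" using b less.prems by auto
    have vb: "v b1 = v b" using place_mult[OF v less.prems(2) b(3)] b by simp
    have ge: "v b1 \<ge> 0" using Rge[OF b(1)] b10 by (simp add: val_ge_def)
    show ?case
    proof (cases "v b = 0")
      case False
      obtain k b' where kb: "k \<in> K" "b' \<in> O'" "b1 = k + (x - c) * b'" using RG[OF b(1)] by (auto simp: G_def)
      have b'ge: "val_ge v 0 b'"
      proof -
        obtain e1 e2 where e: "e1 \<in> R" "e2 \<noteq> 0" "v e2 = 0" "b' * e2 = e1"
          using kb(2) unfolding O'_def by blast
        thus ?thesis using Rge[OF e(1)] place_mult[OF v, of b' e2] by (cases "b' = 0") (auto simp: val_ge_def)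
      qed
      have "val_ge v 1 ((x - c) * b')" using val_ge_mult[OF v xc b'ge] by simp
      moreover have "val_ge v 1 b1" using ge vb False by (simp add: val_ge_def)
      ultimately have "val_ge v 1 k" using val_ge_diff[OF v, of 1 b1 "(x - c) * b'"] kb(3) by simp
      hence "k = 0" by (rule val_ge_const_pos[OF v kb(1)])
      hence b1: "b1 = (x - c) * b'" using kb by simp
      hence b'0: "b' \<noteq> 0" using b10 by auto
      have vv: "v b = v (x - c) + v b'" using place_mult[OF v s0 b'0] b1 vb by simp
      moreover have "v b' \<ge> 0" using b'ge b'0 by (simp add: val_ge_def)
      ultimately have "v (x - c) dvd v b'" using less.hyps[of b'] kb(2) b'0 c(2) by simp
      thus ?thesis unfolding vv by simp
    qed simp
  qed
  obtain N D where ND: "represents N D z" using represents_exists by blast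
  have e0: "ev N \<noteq> 0" using ND z poly_x_nz[of D] by (auto simp: represents_def)
  have "ev N \<in> R" "poly D x \<in> R" using ND RX by (auto simp: represents_def R_def)
  hence "v (x - c) dvd v (ev N)" "v (x - c) dvd v (poly D x)"
    using main RO e0 poly_x_nz[of D] ND by (auto simp: represents_def)
  thus ?thesis unfolding represents_val[OF v ND z] by (rule dvd_diff)
qed

text \<open>Rationality gives \<open>x\<close> a residue \<open>c\<close>. If f(c) were nonzero,
  \<open>y\<close> would have a residue too, and \<open>v (x - c)\<close> would divide the value 1,
  whereas total ramification makes it a multiple of \<open>m \<ge> 2\<close>.\<close>

lemma rational_ramified_centre:
  assumes v: "rational_place K v" "totally_ramified K x m v" "v \<noteq> Pinf"
  obtains a where "a \<in> K" "poly f a = 0" "v (x - a) > 0"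
proof -
  have pl: "is_place K v" using v by (simp add: rational_place_def)
  have res: "\<exists>c\<in>K. val_ge v 1 (z - c)" if "z \<noteq> 0" "v z \<ge> 0" for z
  proof -
    have "\<forall>z. z \<noteq> 0 \<longrightarrow> v z \<ge> 0 \<longrightarrow> (\<exists>c\<in>K. z = c \<or> v (z - c) > 0)"
      using v(1) unfolding rational_place_def by (rule conjunct2)
    from this[rule_format, OF that] obtain c where "c \<in> K" "z = c \<or> v (z - c) > 0" by (elim bexE)
    thus ?thesis by (intro bexI[of _ c]) (auto simp: val_ge_def)
  qed
  have x0: "x \<noteq> 0" using x_diff_nz[OF is_subringD(1)[OF subring_K]] by simp
  have "v x \<ge> 0" using infinite_place_unique[OF pl] v(3) by (meson linorder_not_less)
  then obtain c where c: "c \<in> K" "val_ge v 1 (x - c)" using res[OF x0] by blast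
  hence vc: "v (x - c) > 0" using x_diff_nz by (auto simp: val_ge_def)
  have "poly f c = 0"
  proof (rule ccontr)
    assume fc: "poly f c \<noteq> 0"
    have "int m * v y = 0"
      using place_poly_unit(2)[OF pl subring_K f_over c fc] place_power[OF pl y_nz, of m] y_pow by simp
    hence "v y = 0" using m_pos by simp
    then obtain d where d: "d \<in> K" "val_ge v 1 (y - d)" using res[OF y_nz] by auto
    obtain t where t: "t \<noteq> 0" "v t = 1" using pl by (auto simp: is_place_def)
    have "v (x - c) dvd 1" using unramified_value_dvd[OF pl c(1) vc d fc t(1)] t(2) by simp
    moreover have "x - c \<in> rat_fun_field K x - {0}"
    proof -
      have "x - c = poly [:-c, 1:] x / poly 1 x" by simp
      moreover have "(1 :: 'a poly) \<noteq> 0" by simp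
      ultimately show ?thesis using x_diff_nz[OF c(1)] X_minus_in_KX[OF c(1)] is_subringD(2)[OF subring_KX]
        unfolding rat_fun_field_def poly_over_iff by blast
    qed
    hence "v (x - c) \<in> {int m * k | k. True}" using v(2) unfolding totally_ramified_def by blast
    hence "int m dvd v (x - c)" by auto
    ultimately have "int m dvd 1" by (rule dvd_trans[rotated])
    thus False using m2 by simp
  qed
  thus ?thesis using that c vc by blast
qed

end

section \<open>The semigroups\<close>

definition index_set :: "nat \<Rightarrow> (int \<times> int) set" where
  "index_set m = UNIV \<times> {0..<int m}"

text \<open>The shifts by one reflect that a pole at the first place needs an exponent of at least
  1, and that \<open>j = 0\<close> gives no common pole.\<close>

definition tri_embed :: "nat \<Rightarrow> nat \<times> nat \<times> nat \<Rightarrow> int \<times> int" where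
  "tri_embed u = (\<lambda>(k, q, A). (int A + 1, int k * int u + int q + 1))"

definition block :: "nat \<Rightarrow> int \<Rightarrow> int" where
  "block u j = (j + int u - 1) div int u"

text \<open>Pole orders at \<open>a\<^sub>1\<close> and \<open>a\<^sub>2\<close> of \<open>(x - a\<^sub>1) powi (- A) * (x - a\<^sub>2) powi (A - block u j) * y ^ j\<close>,
  and at infinity of \<open>(x - a\<^sub>1) powi (- A) * y ^ j\<close>.\<close>
definition pole1 :: "nat \<Rightarrow> int \<times> int \<Rightarrow> int" where
  "pole1 m = (\<lambda>(A, j). int m * A - j)"

definition pole2 :: "nat \<Rightarrow> nat \<Rightarrow> int \<times> int \<Rightarrow> int" where
  "pole2 u m = (\<lambda>(A, j). int m * (block u j - A) - j)"

definition pole_inf :: "nat \<Rightarrow> nat \<Rightarrow> int \<times> int \<Rightarrow> int" where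
  "pole_inf r m = (\<lambda>(A, j). int r * j - int m * A)"

lemma block_le_iff: "u > 0 \<Longrightarrow> block u j \<le> B \<longleftrightarrow> j \<le> int u * B"
proof -
  assume u: "u > 0"
  define d e where "d = block u j" and "e = (j + int u - 1) mod int u"
  have e: "0 \<le> e" "e < int u" using u by (auto simp: e_def)
  have j: "j + int u - 1 = int u * d + e" by (simp add: d_def e_def block_def)
  show "block u j \<le> B \<longleftrightarrow> j \<le> int u * B"
  proof
    assume "block u j \<le> B"
    hence "int u * d \<le> int u * B" by (simp add: d_def mult_left_mono)
    thus "j \<le> int u * B" using e j by linarith
  next
    assume jB: "j \<le> int u * B"
    show "block u j \<le> B"
    proof (rule ccontr)
      assume "\<not> block u j \<le> B"
      hence "int u * (B + 1) \<le> int u * d" by (intro mult_left_mono) (auto simp: d_def)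
      thus False using e j jB by (simp add: distrib_left)
    qed
  qed
qed

text \<open>The left side is regularity at infinity. If it held with \<open>j > u * B\<close>, then
  \<open>m = u * r + 1\<close> would force \<open>B \<ge> r\<close> and so \<open>j > u * r\<close>,
  outside the range of \<open>j\<close>.\<close>

lemma le_mult_iff_block:
  assumes "u > 0" "m = u * r + 1" "0 \<le> j" "j < int m"
  shows "int r * j \<le> int m * B \<longleftrightarrow> block u j \<le> B"
  unfolding block_le_iff[OF assms(1)]
proof
  assume j: "j \<le> int u * B"
  have B: "B \<ge> 0" using j assms(1,3) by (smt (verit) of_nat_0_less_iff zero_le_mult_iff)
  have "int r * j \<le> int r * (int u * B)" using j by (intro mult_left_mono) auto
  also have "\<dots> \<le> int m * B" using B by (simp add: assms(2) algebra_simps)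
  finally show "int r * j \<le> int m * B" .
next
  assume L: "int r * j \<le> int m * B"
  show "j \<le> int u * B"
  proof (rule ccontr)
    assume "\<not> j \<le> int u * B"
    hence j: "int u * B + 1 \<le> j" by simp
    have "int r * (int u * B + 1) \<le> int r * j" using j by (intro mult_left_mono) auto
    hence "int r \<le> B" using L by (simp add: assms(2) algebra_simps)
    hence "int u * int r \<le> int u * B" by (intro mult_left_mono) auto
    thus False using j assms(2,4) by simp
  qed
qed

lemma block_tri: "q < u \<Longrightarrow> block u (int k * int u + int q + 1) = int k + 1"
proof -
  assume q: "q < u"
  have "int k * int u + int q + 1 + int u - 1 = int q + (int k + 1) * int u" by (simp add: algebra_simps)
  thus ?thesis unfolding block_def using q by (simp only: div_mult_self1) simp
qed

lemma less_mult_iff_pos: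
  fixes A j m :: int
  assumes "0 \<le> j" "j < m"
  shows "j < m * A \<longleftrightarrow> A \<ge> 1"
proof -
  consider "A \<le> 0" | "A \<ge> 1" by linarith
  thus ?thesis
  proof cases
    case 1
    hence "m * A \<le> m * 0" using assms by (intro mult_left_mono) auto
    thus ?thesis using 1 assms by simp
  next
    case 2
    hence "m * 1 \<le> m * A" using assms by (intro mult_left_mono) auto
    thus ?thesis using 2 assms by linarith
  qed
qed

lemma inj_tri_embed: "inj_on (tri_embed u) (tri_index u r)"
proof (rule inj_onI)
  fix s t assume st: "s \<in> tri_index u r" "t \<in> tri_index u r" "tri_embed u s = tri_embed u t"
  obtain k q A l p B where e: "s = (k, q, A)" "t = (l, p, B)" by (metis prod_cases3)
  have "q < u" "p < u" "A = B" "k * u + q = l * u + p"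
    using st by (auto simp: e tri_index_def tri_embed_def simp flip: of_nat_mult of_nat_add)
  moreover from this have "k = l" by (metis div_mult_self3 div_less add.commute add_0 less_nat_zero_code)
  ultimately show "s = t" by (simp add: e)
qed

lemma tri_embed_image:
  assumes "u > 0" "m = u * r + 1"
  shows "{(A, j) \<in> index_set m. A \<ge> 1 \<and> A < block u j} = tri_embed u ` tri_index u r"
proof (intro equalityI subsetI)
  fix z assume "z \<in> {(A, j) \<in> index_set m. A \<ge> 1 \<and> A < block u j}"
  then obtain A j where z: "z = (A, j)" "0 \<le> j" "j < int m" "A \<ge> 1" "A < block u j"
    by (auto simp: index_set_def)
  have "\<not> block u j \<le> 0" using z by simp
  hence j0: "j > 0" using block_le_iff[OF assms(1), of j 0] by simp
  define n where "n = nat (j - 1)"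
  have n: "j = int n + 1" using j0 by (simp add: n_def)
  define k q where "k = n div u" and "q = n mod u"
  have nk: "n = k * u + q" "q < u" using assms(1) by (auto simp: k_def q_def)
  have "n < u * r" using z(3) assms(2) n by (simp flip: of_nat_mult)
  hence kr: "k < r" unfolding k_def using assms(1) by (simp add: div_less_iff_less_mult mult.commute)
  have bl: "block u j = int k + 1" using block_tri[OF nk(2), of k] by (simp add: n nk(1))
  hence "(k, q, nat (A - 1)) \<in> tri_index u r" using z kr nk by (auto simp: tri_index_def)
  moreover have "z = tri_embed u (k, q, nat (A - 1))" using z n nk by (simp add: tri_embed_def)
  ultimately show "z \<in> tri_embed u ` tri_index u r" by blast
next
  fix z assume "z \<in> tri_embed u ` tri_index u r"
  then obtain k q A where z: "z = (int A + 1, int k * int u + int q + 1)" "k < r" "q < u" "A < k"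
    by (auto simp: tri_embed_def tri_index_def)
  have "Suc k * u \<le> r * u" using z by (intro mult_right_mono) auto
  hence "int k * int u + int q + 1 < int m" using z(3) assms(2)
    by (simp add: algebra_simps flip: of_nat_mult of_nat_add)
  thus "z \<in> {(A, j) \<in> index_set m. A \<ge> 1 \<and> A < block u j}"
    using z block_tri[OF z(3), of k] by (auto simp: index_set_def)
qed

text \<open>The exponent \<open>j\<close> is the residue of the negated pole order modulo
  \<open>m\<close>, and \<open>A\<close> is then determined by division.\<close>

lemma pole1_bij:
  assumes "m > 0"
  shows "inj_on (pole1 m) (index_set m)" "\<exists>i\<in>index_set m. pole1 m i = n"
proof -
  have j: "j = (- (int m * A - j)) mod int m" if "0 \<le> j" "j < int m" for A j
  proof -
    have "(- (int m * A - j)) mod int m = (j + int m * (- A)) mod int m" by (simp add: algebra_simps)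
    thus ?thesis using that by (simp only: mod_mult_self2 mod_pos_pos_trivial)
  qed
  show "inj_on (pole1 m) (index_set m)"
  proof (rule inj_onI)
    fix s t assume st: "s \<in> index_set m" "t \<in> index_set m" "pole1 m s = pole1 m t"
    obtain A i B l where e: "s = (A, i)" "t = (B, l)" by (metis prod.exhaust)
    have il: "0 \<le> i" "i < int m" "0 \<le> l" "l < int m" "int m * A - i = int m * B - l"
      using st by (auto simp: e index_set_def pole1_def)
    have "i = l" using j[OF il(1,2), of A] j[OF il(3,4), of B] unfolding il(5) by simp
    thus "s = t" using st assms by (simp add: e pole1_def)
  qed
  have "int m * ((n + (- n) mod int m) div int m) = n + (- n) mod int m"
    by (intro dvd_mult_div_cancel) (simp add: mod_eq_0_iff_dvd[symmetric] mod_add_right_eq)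
  thus "\<exists>i\<in>index_set m. pole1 m i = n" using assms
    by (intro bexI[of _ "((n + (- n) mod int m) div int m, (- n) mod int m)"])
       (auto simp: pole1_def index_set_def)
qed

text \<open>The map (A, j) to (block u j - A, j) is an involution of the index set that exchanges
  the two affine places.\<close>

lemma pole2_bij:
  assumes "m > 0"
  shows "inj_on (pole2 u m) (index_set m)" "\<exists>i\<in>index_set m. pole2 u m i = n"
proof -
  define s where "s = (\<lambda>(A, j). (block u j - A, j))"
  have eq: "pole2 u m i = pole1 m (s i)" for i by (cases i) (simp add: pole2_def pole1_def s_def)
  have s: "s i \<in> index_set m \<longleftrightarrow> i \<in> index_set m" "s (s i) = i" for i
    by (cases i; simp add: s_def index_set_def)+
  show "inj_on (pole2 u m) (index_set m)"
    using pole1_bij(1)[OF assms] s unfolding inj_on_def eq by metis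
  show "\<exists>i\<in>index_set m. pole2 u m i = n"
    using pole1_bij(2)[OF assms, of n] s unfolding eq by metis
qed

text \<open>Since u r = m - 1, the number \<open>- u\<close> is inverse to \<open>r\<close> modulo
  \<open>m\<close>, so multiplying the pole order by it recovers \<open>j\<close>.\<close>

lemma pole_inf_bij:
  assumes "m = u * r + 1"
  shows "inj_on (pole_inf r m) (index_set m)" "\<exists>i\<in>index_set m. pole_inf r m i = n"
proof -
  have m0: "m > 0" using assms by simp
  have ur: "int u * int r = int m - 1" using assms by simp
  have j: "j = (- (int u * (int r * j - int m * A))) mod int m" if "0 \<le> j" "j < int m" for A j
  proof -
    have "- (int u * (int r * j - int m * A)) = - ((int u * int r) * j) + int m * (int u * A)"
      by (simp add: algebra_simps)
    also have "\<dots> = j + int m * (int u * A - j)" unfolding ur by (simp add: algebra_simps)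
    finally show ?thesis using that by (simp only: mod_mult_self2 mod_pos_pos_trivial)
  qed
  show "inj_on (pole_inf r m) (index_set m)"
  proof (rule inj_onI)
    fix s t assume st: "s \<in> index_set m" "t \<in> index_set m" "pole_inf r m s = pole_inf r m t"
    obtain A i B l where e: "s = (A, i)" "t = (B, l)" by (metis prod.exhaust)
    have il: "0 \<le> i" "i < int m" "0 \<le> l" "l < int m" "int r * i - int m * A = int r * l - int m * B"
      using st by (auto simp: e index_set_def pole_inf_def)
    have "i = l" using j[OF il(1,2), of A] j[OF il(3,4), of B] unfolding il(5) by simp
    thus "s = t" using st m0 by (simp add: e pole_inf_def)
  qed
  define l where "l = (- (int u * n)) mod int m"
  have l: "0 \<le> l" "l < int m" using m0 by (auto simp: l_def)
  have "int r * l - n = int r * (- (int u * n) - int m * ((- (int u * n)) div int m)) - n"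
    by (simp add: l_def minus_mult_div_eq_mod)
  also have "\<dots> = - ((int u * int r) * n) - n - int m * (int r * ((- (int u * n)) div int m))"
    by (simp add: algebra_simps)
  also have "\<dots> = int m * (- n - int r * ((- (int u * n)) div int m))"
    unfolding ur by (simp add: algebra_simps)
  finally have "pole_inf r m (- n - int r * ((- (int u * n)) div int m), l) = n"
    by (simp add: pole_inf_def)
  thus "\<exists>i\<in>index_set m. pole_inf r m i = n"
    using l by (intro bexI[of _ "(- n - int r * ((- (int u * n)) div int m), l)"]) (auto simp: index_set_def)
qed

lemma positive_poles2:
  assumes "u > 0" "m = u * r + 1"
  shows "{i \<in> index_set m. pole1 m i > 0 \<and> pole2 u m i > 0} = tri_embed u ` tri_index u r"
  unfolding tri_embed_image[OF assms, symmetric]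
  by (auto simp: index_set_def pole1_def pole2_def less_mult_iff_pos)

lemma positive_poles_inf:
  assumes "u > 0" "m = u * r + 1"
  shows "{i \<in> index_set m. pole1 m i > 0 \<and> pole_inf r m i > 0} = tri_embed u ` tri_index u r"
proof -
  have "int m * A < int r * j \<longleftrightarrow> A < block u j" if "0 \<le> j" "j < int m" for A j
    using le_mult_iff_block[OF assms that, of A] by (simp only: not_le[symmetric])
  thus ?thesis unfolding tri_embed_image[OF assms, symmetric]
    by (auto simp: index_set_def pole1_def pole_inf_def less_mult_iff_pos)
qed

section \<open>Semigroups at two totally ramified places\<close>

context kummer_field
begin

lemma affine_val:
  assumes a: "a \<in> K" "poly f a = 0" and v: "is_place K v" "v (x - a) > 0"
    and rep: "represents N D z" "z \<noteq> 0"
  shows "\<And>j. coeff N j \<noteq> 0 \<Longrightarrow> v z \<le> int m * (int (order a (coeff N j)) - int (order a D)) + int j"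
    and "\<exists>j<m. coeff N j \<noteq> 0 \<and> v z = int m * (int (order a (coeff N j)) - int (order a D)) + int j"
proof -
  have N: "N \<in> KXY" "N \<noteq> 0" "degree N < m" "D \<in> KX" "D \<noteq> 0"
    using rep represents_nz by (auto simp: represents_def)
  note af = affine_place[OF a v]
  have P: "v (poly (coeff N j) x) = int m * int (order a (coeff N j))" if "coeff N j \<noteq> 0" for j
    using af(4) polys_over_coeff[OF N(1)] that by blast
  note D = af(4)[OF N(4,5)] and z = represents_val[OF v(1) rep]
  show "v z \<le> int m * (int (order a (coeff N j)) - int (order a D)) + int j" if "coeff N j \<noteq> 0" for j
    using separating_ev(2)[OF af(1) N(1-3) that] P[OF that] D z af(3) by (simp add: algebra_simps)
  obtain j where "j < m" "coeff N j \<noteq> 0" "v (ev N) = v (poly (coeff N j) x) + int j * v y"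
    using separating_ev(3)[OF af(1) N(1-3)] by blast
  thus "\<exists>j<m. coeff N j \<noteq> 0 \<and> v z = int m * (int (order a (coeff N j)) - int (order a D)) + int j"
    using P[of j] D z af(3) by (intro exI[of _ j]) (simp add: algebra_simps)
qed

lemma infinite_val:
  assumes rep: "represents N D z" "z \<noteq> 0"
  shows "\<And>j. coeff N j \<noteq> 0 \<Longrightarrow>
      Pinf z \<le> int m * (int (degree D) - int (degree (coeff N j))) - int r * int j"
    and "\<exists>j<m. coeff N j \<noteq> 0 \<and>
      Pinf z = int m * (int (degree D) - int (degree (coeff N j))) - int r * int j"
proof -
  have N: "N \<in> KXY" "N \<noteq> 0" "degree N < m" "D \<in> KX" "D \<noteq> 0"
    using rep represents_nz by (auto simp: represents_def)
  note af = infinite_place[OF Pinf]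
  have P: "Pinf (poly (coeff N j) x) = - (int m * int (degree (coeff N j)))" if "coeff N j \<noteq> 0" for j
    using af(4) polys_over_coeff[OF N(1)] that by blast
  note D = af(4)[OF N(4,5)] and z = represents_val[OF Pinf(1) rep]
  show "Pinf z \<le> int m * (int (degree D) - int (degree (coeff N j))) - int r * int j" if "coeff N j \<noteq> 0" for j
    using separating_ev(2)[OF af(1) N(1-3) that] P[OF that] D z af(3) by (simp add: algebra_simps)
  obtain j where "j < m" "coeff N j \<noteq> 0" "Pinf (ev N) = Pinf (poly (coeff N j) x) + int j * Pinf y"
    using separating_ev(3)[OF af(1) N(1-3)] by blast
  thus "\<exists>j<m. coeff N j \<noteq> 0 \<and>
      Pinf z = int m * (int (degree D) - int (degree (coeff N j))) - int r * int j"
    using P[of j] D z af(3) by (intro exI[of _ j]) (simp add: algebra_simps)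
qed

text \<open>Regularity of \<open>z\<close> passes to each quotient \<open>coeff N j / D\<close> at
  all points of the closure outside \<open>A\<close>, and the degree of this quotient is the sum of
  its orders.\<close>

lemma coefficient_degree_bound:
  assumes rep: "represents N D z" and A: "finite A" "A \<subseteq> K"
    and regular: "\<And>Q. is_place K Q \<Longrightarrow> Q x \<ge> 0 \<Longrightarrow> (\<And>a. a \<in> A \<Longrightarrow> \<not> Q (x - a) > 0) \<Longrightarrow> Q z \<ge> 0"
    and j: "coeff N j \<noteq> 0"
  shows "(\<Sum>a\<in>A. int (order a (coeff N j)) - int (order a D)) \<le> int (degree (coeff N j)) - int (degree D)"
proof (rule degree_diff_ge_order_diff[OF j _ A(1)])
  show "D \<noteq> 0" using rep by (simp add: represents_def)
  fix \<alpha> assume \<alpha>: "\<alpha> \<notin> to_ac ` A"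
  show "order \<alpha> (map_poly to_ac D) \<le> order \<alpha> (map_poly to_ac (coeff N j))"
  proof (rule pole_order_bound[OF rep _ j])
    fix Q assume Q: "is_place K Q" "Q x \<ge> 0" "\<And>c. c \<in> K \<Longrightarrow> Q (x - c) > 0 \<Longrightarrow> to_ac c = \<alpha>"
    show "Q z \<ge> 0" using regular[OF Q(1,2)] Q(3) A(2) \<alpha> by blast
  qed
qed

lemma affine_place_other:
  assumes a: "a \<in> K" "poly f a = 0" and v: "is_place K v" "v (x - a) > 0" and b: "b \<in> K" "b \<noteq> a"
  shows "v (x - b) = 0"
proof -
  have "order a [:-b, 1:] = 0" using b by (intro order_0I) simp
  thus ?thesis using affine_place(4)[OF a v X_minus_in_KX[OF b(1)]] by simp
qed

lemma infinite_place_linear: "b \<in> K \<Longrightarrow> Pinf (x - b) = - int m"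
  using infinite_place(4)[OF Pinf X_minus_in_KX[of b]] by simp

lemma affine_ne_infinite: "b \<in> K \<Longrightarrow> v (x - b) > 0 \<Longrightarrow> v \<noteq> Pinf"
  using infinite_place_linear[of b] by auto

lemma finite_place_ge_0:
  assumes Q: "is_place K Q" "Q \<noteq> Pinf"
  shows "Q x \<ge> 0" "Q y \<ge> 0" "b \<in> K \<Longrightarrow> Q (x - b) \<ge> 0"
proof -
  show x: "Q x \<ge> 0" using infinite_place_unique[OF Q(1)] Q(2) by (meson linorder_not_less)
  have p: "val_ge Q 0 (poly p x)" if "p \<in> KX" for p
    using poly_in_subring[OF is_subring_valuation_ring[OF Q(1)], of p x] that x val_ge_const[OF Q(1)]
    by (auto simp: polys_over_def val_ge_def[of Q 0 x])
  have "int m * Q y \<ge> 0"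
    using p[OF f_over] fx_nz place_power[OF Q(1) y_nz, of m] by (simp add: val_ge_def y_pow)
  thus "Q y \<ge> 0" using m_pos by (simp add: zero_le_mult_iff)
  show "Q (x - b) \<ge> 0" if "b \<in> K"
    using p[OF X_minus_in_KX[OF that]] x_diff_nz[OF that] by (simp add: val_ge_def)
qed

lemma semigroup_affine_affine:
  assumes u: "u > 0" "m = u * r + 1"
    and a1: "a1 \<in> K" "poly f a1 = 0" and v1: "is_place K v1" "v1 (x - a1) > 0"
    and a2: "a2 \<in> K" "poly f a2 = 0" and v2: "is_place K v2" "v2 (x - a2) > 0"
    and ne: "a1 \<noteq> a2"
  shows "weierstrass_semigroup2 K v1 v2 = {(n1, n2).
      (n1 = 0 \<or> (\<exists>i\<in>index_set m. pole1 m i = int n1 \<and> pole2 u m i \<le> int n2)) \<and>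
      (n2 = 0 \<or> (\<exists>i\<in>index_set m. pole2 u m i = int n2 \<and> pole1 m i \<le> int n1))}"
proof (rule weierstrass_semigroup2_iff[OF v1(1) v2(1)])
  have nz: "x - a1 \<noteq> 0" "x - a2 \<noteq> 0" using x_diff_nz a1 a2 by auto
  fix i assume "i \<in> index_set m"
  then obtain A j where i: "i = (A, j)" "0 \<le> j" "j < int m" by (auto simp: index_set_def)
  define z where "z = (x - a1) powi (- A) * (x - a2) powi (A - block u j) * y ^ nat j"
  have z0: "z \<noteq> 0" using nz y_nz by (simp add: z_def)
  have val: "v z = - A * v (x - a1) + (A - block u j) * v (x - a2) + j * v y" if "is_place K v" for v
    unfolding z_def using nz y_nz i(2) place_mult[OF that] place_power_int[OF that] place_power[OF that] by simp
  have "v1 z = - pole1 m i"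
    using val[OF v1(1)] affine_place(2,3)[OF a1 v1] affine_place_other[OF a1 v1 a2(1)] ne
    by (simp add: i pole1_def algebra_simps)
  moreover have "v2 z = - pole2 u m i"
    using val[OF v2(1)] affine_place(2,3)[OF a2 v2] affine_place_other[OF a2 v2 a1(1)] ne
    by (simp add: i pole2_def algebra_simps)
  moreover have "Q z \<ge> 0" if Q: "is_place K Q" "Q \<noteq> v1" "Q \<noteq> v2" for Q
  proof (cases "Q = Pinf")
    case True
    have "Pinf z = int m * block u j - int r * j"
      using val[OF Pinf(1)] infinite_place_linear a1 a2 infinite_place(3)[OF Pinf] by (simp add: algebra_simps)
    thus ?thesis using True le_mult_iff_block[OF u i(2,3), of "block u j"] by simp
  next
    case False
    have "Q (x - a1) = 0" "Q (x - a2) = 0"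
      using finite_place_ge_0(3)[OF Q(1) False] a1(1) a2(1)
        affine_place_unique[OF a1 v1 Q(1)] affine_place_unique[OF a2 v2 Q(1)] Q(2,3) by force+
    thus ?thesis using val[OF Q(1)] finite_place_ge_0(2)[OF Q(1) False] i(2) by simp
  qed
  ultimately show "\<exists>z. z \<noteq> 0 \<and> v1 z = - pole1 m i \<and> v2 z = - pole2 u m i \<and>
      (\<forall>Q. is_place K Q \<and> Q \<noteq> v1 \<and> Q \<noteq> v2 \<longrightarrow> Q z \<ge> 0)" using z0 by blast
next
  fix z assume z: "z \<noteq> 0" "\<forall>Q. is_place K Q \<and> Q \<noteq> v1 \<and> Q \<noteq> v2 \<longrightarrow> Q z \<ge> 0"
  obtain N D where rep: "represents N D z" using represents_exists by blast
  define o1 o2 where "o1 j = int (order a1 (coeff N j)) - int (order a1 D)"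
    and "o2 j = int (order a2 (coeff N j)) - int (order a2 D)" for j
  \<comment> \<open>The orders of the j-th coefficient quotient at the two roots add up to at most
    its degree, and regularity at infinity forces that degree to be at most
    \<open>- block u j\<close>.\<close>
  have c: "block u (int j) \<le> - o1 j - o2 j" if j: "coeff N j \<noteq> 0" "j < m" for j
  proof -
    have "(\<Sum>a\<in>{a1, a2}. int (order a (coeff N j)) - int (order a D)) \<le>
        int (degree (coeff N j)) - int (degree D)"
      by (rule coefficient_degree_bound[OF rep _ _ _ j(1)]) (use a1 a2 v1 v2 z(2) in auto)
    hence 1: "o1 j + o2 j \<le> int (degree (coeff N j)) - int (degree D)"
      using ne by (simp add: o1_def o2_def)
    have "0 \<le> Pinf z" using z(2) Pinf(1) affine_ne_infinite a1 v1 a2 v2 by metis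
    hence "int r * int j \<le> int m * (int (degree D) - int (degree (coeff N j)))"
      using infinite_val(1)[OF rep z(1) j(1)] by simp
    hence "block u (int j) \<le> int (degree D) - int (degree (coeff N j))"
      using le_mult_iff_block[OF u, of "int j"] j by simp
    thus ?thesis using 1 by simp
  qed
  have mc: "int m * block u (int j) \<le> int m * (- o1 j - o2 j)" if "coeff N j \<noteq> 0" "j < m" for j
    using c[OF that] by (intro mult_left_mono) auto
  note w1 = affine_val[OF a1 v1 rep z(1), folded o1_def] and w2 = affine_val[OF a2 v2 rep z(1), folded o2_def]
  \<comment> \<open>The term that attains \<open>v1 z\<close> fixes \<open>j\<close>, and the
    exponent \<open>- o1 j\<close> reproduces its pole at the first place. By \<open>c\<close>, the
    monomial has at the second place no larger pole order than this term, hence none larger than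
    \<open>z\<close>.\<close>
  obtain j where j: "j < m" "coeff N j \<noteq> 0" "v1 z = int m * o1 j + int j" using w1(2) by blast
  have "pole1 m (- o1 j, int j) = - v1 z" "pole2 u m (- o1 j, int j) \<le> - v2 z"
    using j w2(1)[OF j(2)] mc[OF j(2,1)] by (auto simp: pole1_def pole2_def algebra_simps)
  thus "\<exists>i\<in>index_set m. pole1 m i = - v1 z \<and> pole2 u m i \<le> - v2 z"
    using j by (intro bexI[of _ "(- o1 j, int j)"]) (auto simp: index_set_def)
  \<comment> \<open>Now the exponent is solved for from the second place, where
    \<open>block u k - A\<close> has to equal \<open>- o2 k\<close>.\<close>
  obtain k where k: "k < m" "coeff N k \<noteq> 0" "v2 z = int m * o2 k + int k" using w2(2) by blast
  have "pole2 u m (block u (int k) + o2 k, int k) = - v2 z" "pole1 m (block u (int k) + o2 k, int k) \<le> - v1 z"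
    using k w1(1)[OF k(2)] mc[OF k(2,1)] by (auto simp: pole1_def pole2_def algebra_simps)
  thus "\<exists>i\<in>index_set m. pole2 u m i = - v2 z \<and> pole1 m i \<le> - v1 z"
    using k by (intro bexI[of _ "(block u (int k) + o2 k, int k)"]) (auto simp: index_set_def)
qed

lemma semigroup_affine_infinite:
  assumes a: "a \<in> K" "poly f a = 0" and v: "is_place K v" "v (x - a) > 0"
  shows "weierstrass_semigroup2 K v Pinf = {(n1, n2).
      (n1 = 0 \<or> (\<exists>i\<in>index_set m. pole1 m i = int n1 \<and> pole_inf r m i \<le> int n2)) \<and>
      (n2 = 0 \<or> (\<exists>i\<in>index_set m. pole_inf r m i = int n2 \<and> pole1 m i \<le> int n1))}"
proof (rule weierstrass_semigroup2_iff[OF v(1) Pinf(1)])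
  have nz: "x - a \<noteq> 0" using x_diff_nz a by auto
  fix i assume "i \<in> index_set m"
  then obtain A j where i: "i = (A, j)" "0 \<le> j" "j < int m" by (auto simp: index_set_def)
  define z where "z = (x - a) powi (- A) * y ^ nat j"
  have z0: "z \<noteq> 0" using nz y_nz by (simp add: z_def)
  have val: "w z = - A * w (x - a) + j * w y" if "is_place K w" for w
    unfolding z_def using nz y_nz i(2) place_mult[OF that] place_power_int[OF that] place_power[OF that] by simp
  have "v z = - pole1 m i"
    using val[OF v(1)] affine_place(2,3)[OF a v] by (simp add: i pole1_def algebra_simps)
  moreover have "Pinf z = - pole_inf r m i"
    using val[OF Pinf(1)] infinite_place_linear[OF a(1)] infinite_place(3)[OF Pinf]
    by (simp add: i pole_inf_def algebra_simps)
  moreover have "Q z \<ge> 0" if Q: "is_place K Q" "Q \<noteq> v" "Q \<noteq> Pinf" for Q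
  proof -
    have "Q (x - a) = 0"
      using finite_place_ge_0(3)[OF Q(1,3) a(1)] affine_place_unique[OF a v Q(1)] Q(2) by force
    thus ?thesis using val[OF Q(1)] finite_place_ge_0(2)[OF Q(1,3)] i(2) by simp
  qed
  ultimately show "\<exists>z. z \<noteq> 0 \<and> v z = - pole1 m i \<and> Pinf z = - pole_inf r m i \<and>
      (\<forall>Q. is_place K Q \<and> Q \<noteq> v \<and> Q \<noteq> Pinf \<longrightarrow> Q z \<ge> 0)" using z0 by blast
next
  fix z assume z: "z \<noteq> 0" "\<forall>Q. is_place K Q \<and> Q \<noteq> v \<and> Q \<noteq> Pinf \<longrightarrow> Q z \<ge> 0"
  obtain N D where rep: "represents N D z" using represents_exists by blast
  define o1 d where "o1 j = int (order a (coeff N j)) - int (order a D)"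
    and "d j = int (degree (coeff N j)) - int (degree D)" for j
  \<comment> \<open>With a single finite pole allowed, the order at \<open>a\<close> is bounded by
    the degree. Matching the pole at \<open>a\<close> then uses the exponent \<open>- o1 j\<close>,
    and matching the pole at infinity uses \<open>- d k\<close>.\<close>
  have c: "int m * o1 j \<le> int m * d j" if j: "coeff N j \<noteq> 0" for j
  proof -
    have "Q z \<ge> 0" if "is_place K Q" "Q x \<ge> 0" "\<And>b. b \<in> {a} \<Longrightarrow> \<not> Q (x - b) > 0" for Q
      using z(2) that v(2) Pinf(2) by fastforce
    hence "(\<Sum>a\<in>{a}. int (order a (coeff N j)) - int (order a D)) \<le>
        int (degree (coeff N j)) - int (degree D)"
      using a(1) by (intro coefficient_degree_bound[OF rep _ _ _ j]) auto
    thus ?thesis by (intro mult_left_mono) (auto simp: o1_def d_def)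
  qed
  note w1 = affine_val[OF a v rep z(1), folded o1_def]
  have w2: "Pinf z \<le> - (int m * d j) - int r * int j" if "coeff N j \<noteq> 0" for j
    using infinite_val(1)[OF rep z(1) that] by (simp add: d_def algebra_simps)
  obtain j where j: "j < m" "coeff N j \<noteq> 0" "v z = int m * o1 j + int j" using w1(2) by blast
  have "pole1 m (- o1 j, int j) = - v z" "pole_inf r m (- o1 j, int j) \<le> - Pinf z"
    using j(3) w2[OF j(2)] c[OF j(2)] unfolding pole1_def pole_inf_def prod.case mult_minus_right
    by linarith+
  thus "\<exists>i\<in>index_set m. pole1 m i = - v z \<and> pole_inf r m i \<le> - Pinf z"
    using j by (intro bexI[of _ "(- o1 j, int j)"]) (auto simp: index_set_def)
  obtain k where k: "k < m" "coeff N k \<noteq> 0" "Pinf z = - (int m * d k) - int r * int k"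
    using infinite_val(2)[OF rep z(1)] by (auto simp: d_def algebra_simps)
  have "pole_inf r m (- d k, int k) = - Pinf z" "pole1 m (- d k, int k) \<le> - v z"
    using k(3) w1(1)[OF k(2)] c[OF k(2)] unfolding pole1_def pole_inf_def prod.case mult_minus_right
    by linarith+
  thus "\<exists>i\<in>index_set m. pole_inf r m i = - Pinf z \<and> pole1 m i \<le> - v z"
    using k by (intro bexI[of _ "(- d k, int k)"]) (auto simp: index_set_def)
qed

end

lemma pole_tri_embed:
  assumes "m = u * r + 1"
  shows "pole1 m (tri_embed u (k, q, A)) = gap1 u r (k, q, A)"
    and "pole_inf r m (tri_embed u (k, q, A)) = gap_inf u r (k, q, A)"
    and "q < u \<Longrightarrow> pole2 u m (tri_embed u (k, q, A)) = gap2 u r (k, q, A)"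
  using block_tri[of q u k] assms
  by (simp_all add: pole1_def pole2_def pole_inf_def gap1_def gap2_def gap_inf_def tri_embed_def algebra_simps)

theorem theorem3p2:
  fixes K :: "'a::field set" and x y :: 'a and f :: "'a poly"
    and m r u :: nat and Pinf P1 P2 :: "'a \<Rightarrow> int"
  assumes K: "is_subfield K" "finite K"
    and char: "of_nat m \<noteq> (0::'a)"
    and m2: "m \<ge> 2"
    and f: "poly_over K f" "degree f = r" "coprime f (pderiv f)"
    and mr: "coprime m r"
    and x: "transcendental_over K x"
    and y: "y ^ m = poly f x"
    and F: "generated_field (K \<union> {x, y}) = UNIV"
    and u: "u > 0" "m = u * r + 1"
    and Pinf: "is_place K Pinf" "Pinf x < 0"
    and P1: "rational_place K P1" "totally_ramified K x m P1" "P1 \<noteq> Pinf"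
    and P2: "rational_place K P2" "totally_ramified K x m P2" "P2 \<noteq> Pinf"
    and P12: "P1 \<noteq> P2"
  shows "(finite (gaps2 K P1 P2) \<and>
         12 * int (card (gaps2 K P1 P2)) =
           int u * int r * (int r - 1) *
           (3 * int u * int r ^ 2 - 5 * int u * int r + 4 * int r + 4 * int u - 2)) \<and>
         (finite (gaps2 K Pinf P1) \<and>
         12 * int (card (gaps2 K Pinf P1)) =
           int u * int r * (int r - 1) *
           (3 * int u * int r ^ 2 - 3 * int u * int r + 2 * int r + 2))"
proof -
  interpret kummer_field K x y f m r Pinf
    by unfold_locales (use assms in \<open>auto simp: poly_over_iff\<close>)
  have pl: "is_place K P1" "is_place K P2" using P1 P2 by (auto simp: rational_place_def)
  obtain a1 where a1: "a1 \<in> K" "poly f a1 = 0" "P1 (x - a1) > 0" using rational_ramified_centre[OF P1] .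
  obtain a2 where a2: "a2 \<in> K" "poly f a2 = 0" "P2 (x - a2) > 0" using rational_ramified_centre[OF P2] .
  have ne: "a1 \<noteq> a2" using affine_place_unique[OF a1(1,2) pl(1) a1(3) pl(2)] a2(3) P12 by auto
  have tri_mem: "q < u" if "(k, q, A) \<in> tri_index u r" for k q A using that by (simp add: tri_index_def)
  note G1 = gaps2_count[OF semigroup_affine_affine[OF u a1(1,2) pl(1) a1(3) a2(1,2) pl(2) a2(3) ne]
      pole1_bij(1)[OF m_pos] pole2_bij(1)[OF m_pos] pole1_bij(2)[OF m_pos] pole2_bij(2)[OF m_pos]
      positive_poles2[OF u] inj_tri_embed, where a' = "gap1 u r" and b' = "gap2 u r"]
  note G2 = gaps2_count[OF semigroup_affine_infinite[OF a1(1,2) pl(1) a1(3)]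
      pole1_bij(1)[OF m_pos] pole_inf_bij(1)[OF u(2)] pole1_bij(2)[OF m_pos] pole_inf_bij(2)[OF u(2)]
      positive_poles_inf[OF u] inj_tri_embed, where a' = "gap1 u r" and b' = "gap_inf u r"]
  have e1: "pole1 m (tri_embed u t) = gap1 u r t" "pole_inf r m (tri_embed u t) = gap_inf u r t" for t
    using pole_tri_embed[OF u(2)] by (cases t; simp)+
  have e2: "pole2 u m (tri_embed u t) = gap2 u r t" if "t \<in> tri_index u r" for t
    using pole_tri_embed(3)[OF u(2)] that tri_mem by (cases t) simp
  have "finite (gaps2 K P1 P2)" using G1(1) e1 e2 by simp
  moreover have "12 * int (card (gaps2 K P1 P2)) = int u * int r * (int r - 1) *
       (3 * int u * int r ^ 2 - 5 * int u * int r + 4 * int r + 4 * int u - 2)"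
  proof -
    have "12 * int (card (gaps2 K P1 P2)) =
        2 * (6 * (\<Sum>i\<in>tri_index u r. gap1 u r i + gap2 u r i)) -
        12 * int (card {(s, t) \<in> tri_index u r \<times> tri_index u r. gap2 u r t < gap2 u r s \<and> gap1 u r s < gap1 u r t})"
      using G1(2) e1 e2 by simp
    thus ?thesis unfolding sum_gaps_affine inversion_count_affine
      by (simp add: algebra_simps power2_eq_square)
  qed
  moreover have fin2: "finite (gaps2 K P1 Pinf)" using G2(1) e1 by simp
  moreover have "12 * int (card (gaps2 K P1 Pinf)) = int u * int r * (int r - 1) *
           (3 * int u * int r ^ 2 - 3 * int u * int r + 2 * int r + 2)"
  proof -
    have "12 * int (card (gaps2 K P1 Pinf)) =
        12 * (\<Sum>i\<in>tri_index u r. gap1 u r i + gap_inf u r i) -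
        12 * int (card {(s, t) \<in> tri_index u r \<times> tri_index u r. gap_inf u r t < gap_inf u r s \<and> gap1 u r s < gap1 u r t})"
      using G2(2) e1 by simp
    thus ?thesis unfolding sum_gaps_infinity inversion_count_infinity
      by (simp add: algebra_simps power2_eq_square)
  qed
  moreover have "finite (gaps2 K Pinf P1)" "card (gaps2 K Pinf P1) = card (gaps2 K P1 Pinf)"
    unfolding gaps2_commute[of K Pinf P1] using fin2 by (auto simp: card_image)
  ultimately show ?thesis by simp
qed

end
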